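(* Let $k$ be a field, let $q\in k\setminus\{0\}$ have infinite multiplicative order, let $\Lambda=\Lambda(q)$, and let $M$ be a left $\Lambda$-module of dimension at most $3$. Then both $M$ and $M^*$ are semi-Gorenstein-projective, whereas $M$ is not reflexive, if and only if $M$ is isomorphic to a module of the form $M(1,-q,c)$ with $c\in k$. In this case $M$ is not even torsionless, and all the right modules $M(1,-q,c)^*$ with $c\in k$ are isomorphic.
   Context: $\Lambda=\Lambda(q)$ is the 6-dimensional local $k$-algebra generated by $x,y,z$ with relations $x^2=y^2=z^2=yz=0$, $xy+qyx=0$, $xz-zx=0$, $zy-zx=0$; it has $k$-basis $1,x,y,z,yx,zx$, and $\operatorname{soc}\Lambda=\operatorname{rad}^2\Lambda$ has basis $yx,zx$. For $(a,b,c)\in k^3\setminus\{0\}$ let $U(a,b,c)=\Lambda(ax+by+cz)+\operatorname{soc}\Lambda$ (a 3-dimensional left ideal) and $M(a,b,c)={}_\Lambda\Lambda/U(a,b,c)$. For a left module $M$, $M^*=\operatorname{Hom}_\Lambda(M,{}_\Lambda\Lambda)$ is its $\Lambda$-dual, a right $\Lambda$-module. A (left or right) module $N$ is semi-Gorenstein-projective if $\operatorname{Ext}^i(N,\Lambda)=0$ for all $i\ge1$; $M$ is torsionless (respectively reflexive) if the canonical map $M\to M^{**}$ is injective (respectively bijective). *)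

theory Defs
  imports "HOL-Algebra.Module" "HOL-Algebra.QuotRing" "HOL-Algebra.Elementary_Groups"
begin

section \<open>Modules over a ring that need not be commutative\<close>

text \<open>
  The locale \<^locale>\<open>module\<close> of the library requires a commutative ring; its record of operations
  and its notion of \<^const>\<open>submodule\<close> are reused here. A right \<open>R\<close>-module is a left module over
  the opposite ring, with \<open>r \<odot> m\<close> standing for \<open>m r\<close>. The \<open>mult\<close> and \<open>one\<close> fields of a module
  record play no role.
\<close>

locale left_module = R?: ring R + M?: abelian_group M for R (structure) and M (structure) +
  assumes smult_closed [simp, intro]:
      "\<lbrakk>a \<in> carrier R; x \<in> carrier M\<rbrakk> \<Longrightarrow> a \<odot>\<^bsub>M\<^esub> x \<in> carrier M"
    and smult_l_distr:
      "\<lbrakk>a \<in> carrier R; b \<in> carrier R; x \<in> carrier M\<rbrakk> \<Longrightarrow>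
        (a \<oplus>\<^bsub>R\<^esub> b) \<odot>\<^bsub>M\<^esub> x = a \<odot>\<^bsub>M\<^esub> x \<oplus>\<^bsub>M\<^esub> b \<odot>\<^bsub>M\<^esub> x"
    and smult_r_distr:
      "\<lbrakk>a \<in> carrier R; x \<in> carrier M; y \<in> carrier M\<rbrakk> \<Longrightarrow>
        a \<odot>\<^bsub>M\<^esub> (x \<oplus>\<^bsub>M\<^esub> y) = a \<odot>\<^bsub>M\<^esub> x \<oplus>\<^bsub>M\<^esub> a \<odot>\<^bsub>M\<^esub> y"
    and smult_assoc1:
      "\<lbrakk>a \<in> carrier R; b \<in> carrier R; x \<in> carrier M\<rbrakk> \<Longrightarrow>
        (a \<otimes>\<^bsub>R\<^esub> b) \<odot>\<^bsub>M\<^esub> x = a \<odot>\<^bsub>M\<^esub> (b \<odot>\<^bsub>M\<^esub> x)"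
    and smult_one [simp]:
      "x \<in> carrier M \<Longrightarrow> \<one>\<^bsub>R\<^esub> \<odot>\<^bsub>M\<^esub> x = x"

definition opp_ring :: "'a ring \<Rightarrow> 'a ring" where
  "opp_ring R = R\<lparr>mult := \<lambda>x y. y \<otimes>\<^bsub>R\<^esub> x\<rparr>"

definition regular_module :: "'a ring \<Rightarrow> ('a, 'a) module" where
  "regular_module R = \<lparr>carrier = carrier R, mult = mult R, one = one R,
     zero = zero R, add = add R, smult = mult R\<rparr>"

definition quotient_module :: "'a ring \<Rightarrow> ('a, 'm) module \<Rightarrow> 'm set \<Rightarrow> ('a, 'm set) module" where
  "quotient_module R M U = \<lparr>carrier = a_rcosets\<^bsub>M\<^esub> U, mult = undefined, one = undefined,
     zero = U, add = set_add M, smult = (\<lambda>r A. \<Union>m\<in>A. U +>\<^bsub>M\<^esub> (r \<odot>\<^bsub>M\<^esub> m))\<rparr>"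

definition lin_maps :: "'a ring \<Rightarrow> ('a, 'm) module \<Rightarrow> ('a, 'n) module \<Rightarrow> ('m \<Rightarrow> 'n) set" where
  "lin_maps R M N = {f \<in> carrier M \<rightarrow>\<^sub>E carrier N.
     (\<forall>x\<in>carrier M. \<forall>y\<in>carrier M. f (x \<oplus>\<^bsub>M\<^esub> y) = f x \<oplus>\<^bsub>N\<^esub> f y) \<and>
     (\<forall>r\<in>carrier R. \<forall>x\<in>carrier M. f (r \<odot>\<^bsub>M\<^esub> x) = r \<odot>\<^bsub>N\<^esub> f x)}"

definition module_iso :: "'a ring \<Rightarrow> ('a, 'm) module \<Rightarrow> ('a, 'n) module \<Rightarrow> bool" where
  "module_iso R M N \<longleftrightarrow> (\<exists>f \<in> lin_maps R M N. bij_betw f (carrier M) (carrier N))"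

definition simple_submodule :: "'a ring \<Rightarrow> ('a, 'm) module \<Rightarrow> 'm set \<Rightarrow> bool" where
  "simple_submodule R M S \<longleftrightarrow> submodule S R M \<and> S \<noteq> {\<zero>\<^bsub>M\<^esub>} \<and>
     (\<forall>T. submodule T R M \<and> T \<subseteq> S \<longrightarrow> T = {\<zero>\<^bsub>M\<^esub>} \<or> T = S)"

text \<open>The sum of the simple submodules, i.e. the smallest submodule containing all of them.\<close>

definition socle :: "'a ring \<Rightarrow> ('a, 'm) module \<Rightarrow> 'm set" where
  "socle R M = \<Inter>{N. submodule N R M \<and> (\<forall>S. simple_submodule R M S \<longrightarrow> S \<subseteq> N)}"

section \<open>Duality\<close>

text \<open>
  For a left \<open>R\<close>-module \<open>M\<close>, the right module \<open>Hom(M, R)\<close> with \<open>(f r)(m) = f(m) r\<close>, given as a left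
  module over \<^term>\<open>opp_ring R\<close>. Since \<open>opp_ring (opp_ring R) = R\<close>, applying the same construction
  over \<^term>\<open>opp_ring R\<close> yields the dual of a right module.
\<close>

definition dual :: "'a ring \<Rightarrow> ('a, 'm) module \<Rightarrow> ('a, 'm \<Rightarrow> 'a) module" where
  "dual R M = \<lparr>carrier = lin_maps R M (regular_module R), mult = undefined, one = undefined,
     zero = (\<lambda>m\<in>carrier M. \<zero>\<^bsub>R\<^esub>), add = (\<lambda>f g. \<lambda>m\<in>carrier M. f m \<oplus>\<^bsub>R\<^esub> g m),
     smult = (\<lambda>r f. \<lambda>m\<in>carrier M. f m \<otimes>\<^bsub>R\<^esub> r)\<rparr>"

definition bidual :: "'a ring \<Rightarrow> ('a, 'm) module \<Rightarrow> ('a, ('m \<Rightarrow> 'a) \<Rightarrow> 'a) module" where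
  "bidual R M = dual (opp_ring R) (dual R M)"

definition canonical_map :: "'a ring \<Rightarrow> ('a, 'm) module \<Rightarrow> 'm \<Rightarrow> ('m \<Rightarrow> 'a) \<Rightarrow> 'a" where
  "canonical_map R M m = (\<lambda>f\<in>carrier (dual R M). f m)"

definition torsionless :: "'a ring \<Rightarrow> ('a, 'm) module \<Rightarrow> bool" where
  "torsionless R M \<longleftrightarrow> inj_on (canonical_map R M) (carrier M)"

definition reflexive :: "'a ring \<Rightarrow> ('a, 'm) module \<Rightarrow> bool" where
  "reflexive R M \<longleftrightarrow> bij_betw (canonical_map R M) (carrier M) (carrier (bidual R M))"

section \<open>Ext\<close>

definition free_module :: "'a ring \<Rightarrow> 'i set \<Rightarrow> ('a, 'i \<Rightarrow> 'a) module" where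
  "free_module R I = \<lparr>carrier = {f \<in> I \<rightarrow>\<^sub>E carrier R. finite {i\<in>I. f i \<noteq> \<zero>\<^bsub>R\<^esub>}},
     mult = undefined, one = undefined, zero = (\<lambda>i\<in>I. \<zero>\<^bsub>R\<^esub>),
     add = (\<lambda>f g. \<lambda>i\<in>I. f i \<oplus>\<^bsub>R\<^esub> g i), smult = (\<lambda>r f. \<lambda>i\<in>I. r \<otimes>\<^bsub>R\<^esub> f i)\<rparr>"

text \<open>
  \<open>\<cdots> \<rightarrow> F\<^sub>2 \<rightarrow> F\<^sub>1 \<rightarrow> F\<^sub>0 \<rightarrow> N \<rightarrow> 0\<close> with \<open>F\<^sub>n\<close> free on \<open>I n\<close>, differentials
  \<open>d n : F\<^sub>n\<^sub>+\<^sub>1 \<rightarrow> F\<^sub>n\<close> and augmentation \<open>e\<close>.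
\<close>

definition is_free_resolution :: "'a ring \<Rightarrow> ('a, 'm) module \<Rightarrow> (nat \<Rightarrow> 'i set) \<Rightarrow>
    (nat \<Rightarrow> ('i \<Rightarrow> 'a) \<Rightarrow> ('i \<Rightarrow> 'a)) \<Rightarrow> (('i \<Rightarrow> 'a) \<Rightarrow> 'm) \<Rightarrow> bool" where
  "is_free_resolution R N I d e \<longleftrightarrow>
     e \<in> lin_maps R (free_module R (I 0)) N \<and>
     e ` carrier (free_module R (I 0)) = carrier N \<and>
     (\<forall>n. d n \<in> lin_maps R (free_module R (I (Suc n))) (free_module R (I n))) \<and>
     d 0 ` carrier (free_module R (I 1)) =
       {u \<in> carrier (free_module R (I 0)). e u = \<zero>\<^bsub>N\<^esub>} \<and>
     (\<forall>n. d (Suc n) ` carrier (free_module R (I (Suc (Suc n)))) =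
       {u \<in> carrier (free_module R (I (Suc n))). d n u = \<zero>\<^bsub>free_module R (I n)\<^esub>})"

definition hom_group :: "'a ring \<Rightarrow> ('a, 'm) module \<Rightarrow> ('a, 'n) module \<Rightarrow> ('m \<Rightarrow> 'n) monoid" where
  "hom_group R M N = \<lparr>carrier = lin_maps R M N,
     mult = (\<lambda>f g. \<lambda>x\<in>carrier M. f x \<oplus>\<^bsub>N\<^esub> g x), one = (\<lambda>x\<in>carrier M. \<zero>\<^bsub>N\<^esub>)\<rparr>"

definition cocycles :: "'a ring \<Rightarrow> (nat \<Rightarrow> 'i set) \<Rightarrow> (nat \<Rightarrow> ('i \<Rightarrow> 'a) \<Rightarrow> ('i \<Rightarrow> 'a)) \<Rightarrow>
    ('a, 'l) module \<Rightarrow> nat \<Rightarrow> (('i \<Rightarrow> 'a) \<Rightarrow> 'l) set" where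
  "cocycles R I d L n = {f \<in> lin_maps R (free_module R (I n)) L.
     \<forall>u\<in>carrier (free_module R (I (Suc n))). f (d n u) = \<zero>\<^bsub>L\<^esub>}"

definition coboundaries :: "'a ring \<Rightarrow> (nat \<Rightarrow> 'i set) \<Rightarrow> (nat \<Rightarrow> ('i \<Rightarrow> 'a) \<Rightarrow> ('i \<Rightarrow> 'a)) \<Rightarrow>
    ('a, 'l) module \<Rightarrow> nat \<Rightarrow> (('i \<Rightarrow> 'a) \<Rightarrow> 'l) set" where
  "coboundaries R I d L n = (case n of
       0 \<Rightarrow> {\<lambda>u\<in>carrier (free_module R (I 0)). \<zero>\<^bsub>L\<^esub>}
     | Suc m \<Rightarrow> (\<lambda>g. \<lambda>u\<in>carrier (free_module R (I (Suc m))). g (d m u)) `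
                  lin_maps R (free_module R (I m)) L)"

text \<open>
  Ext is computed from a chosen free resolution. The index type \<open>('m + 'a) list\<close> is large enough
  for every module with elements in \<open>'m\<close> to have one (\<open>free_resolution_exists\<close> below).
\<close>

definition chosen_resolution :: "'a ring \<Rightarrow> ('a, 'm) module \<Rightarrow>
    (nat \<Rightarrow> ('m + 'a) list set) \<times>
    (nat \<Rightarrow> (('m + 'a) list \<Rightarrow> 'a) \<Rightarrow> (('m + 'a) list \<Rightarrow> 'a)) \<times>
    ((('m + 'a) list \<Rightarrow> 'a) \<Rightarrow> 'm)" where
  "chosen_resolution R N = (SOME (I, d, e). is_free_resolution R N I d e)"

definition Ext :: "'a ring \<Rightarrow> nat \<Rightarrow> ('a, 'm) module \<Rightarrow> ('a, 'l) module \<Rightarrow>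
    ((('m + 'a) list \<Rightarrow> 'a) \<Rightarrow> 'l) set monoid" where
  "Ext R n N L = (case chosen_resolution R N of (I, d, e) \<Rightarrow>
     ((hom_group R (free_module R (I n)) L)\<lparr>carrier := cocycles R I d L n\<rparr>)
       Mod coboundaries R I d L n)"

definition semi_Gorenstein_projective :: "'a ring \<Rightarrow> ('a, 'm) module \<Rightarrow> bool" where
  "semi_Gorenstein_projective R N \<longleftrightarrow>
     (\<forall>n\<ge>1. trivial_group (Ext R n N (regular_module R)))"

section \<open>The algebra \<open>\<Lambda>(q)\<close>\<close>

datatype gen = Gx | Gy | Gz

text \<open>
  The free algebra \<open>k\<langle>x,y,z\<rangle>\<close>: finitely supported functions on words, with the convolution
  product (sum over all factorisations of a word).
\<close>

definition free_algebra :: "(gen list \<Rightarrow> 'k::field) ring" where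
  "free_algebra = \<lparr>carrier = {f. finite {w. f w \<noteq> 0}},
     mult = (\<lambda>f g w. \<Sum>i\<le>length w. f (take i w) * g (drop i w)),
     one = (\<lambda>w. if w = [] then 1 else 0),
     zero = (\<lambda>w. 0), add = (\<lambda>f g w. f w + g w)\<rparr>"

definition term_of_word :: "'k::field \<Rightarrow> gen list \<Rightarrow> gen list \<Rightarrow> 'k" where
  "term_of_word c v = (\<lambda>w. if w = v then c else 0)"

definition Lam_relations :: "'k::field \<Rightarrow> (gen list \<Rightarrow> 'k) set" where
  "Lam_relations q =
    {term_of_word 1 [Gx, Gx], term_of_word 1 [Gy, Gy], term_of_word 1 [Gz, Gz],
     term_of_word 1 [Gy, Gz],
     term_of_word 1 [Gx, Gy] \<oplus>\<^bsub>free_algebra\<^esub> term_of_word q [Gy, Gx],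
     term_of_word 1 [Gx, Gz] \<ominus>\<^bsub>free_algebra\<^esub> term_of_word 1 [Gz, Gx],
     term_of_word 1 [Gz, Gy] \<ominus>\<^bsub>free_algebra\<^esub> term_of_word 1 [Gz, Gx]}"

definition Lam_ideal :: "'k::field \<Rightarrow> (gen list \<Rightarrow> 'k) set" where
  "Lam_ideal q = Idl\<^bsub>free_algebra\<^esub> (Lam_relations q)"

definition Lam :: "'k::field \<Rightarrow> (gen list \<Rightarrow> 'k) set ring" where
  "Lam q = free_algebra Quot (Lam_ideal q)"

definition Lam_gen :: "'k::field \<Rightarrow> gen \<Rightarrow> (gen list \<Rightarrow> 'k) set" where
  "Lam_gen q g = Lam_ideal q +>\<^bsub>free_algebra\<^esub> term_of_word 1 [g]"

definition Lam_scalar :: "'k::field \<Rightarrow> 'k \<Rightarrow> (gen list \<Rightarrow> 'k) set" where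
  "Lam_scalar q c = Lam_ideal q +>\<^bsub>free_algebra\<^esub> term_of_word c []"

section \<open>\<open>k\<close>-dimension and the modules \<open>M(a,b,c)\<close>\<close>

definition k_basis :: "'k::field \<Rightarrow> ((gen list \<Rightarrow> 'k) set, 'm) module \<Rightarrow> 'm set \<Rightarrow> bool" where
  "k_basis q M B \<longleftrightarrow> finite B \<and> B \<subseteq> carrier M \<and>
     (\<forall>m\<in>carrier M. \<exists>!f. f \<in> B \<rightarrow>\<^sub>E UNIV \<and> m = (\<Oplus>\<^bsub>M\<^esub>b\<in>B. Lam_scalar q (f b) \<odot>\<^bsub>M\<^esub> b))"

definition k_dim_at_most ::
    "'k::field \<Rightarrow> ((gen list \<Rightarrow> 'k) set, 'm) module \<Rightarrow> nat \<Rightarrow> bool" where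
  "k_dim_at_most q M n \<longleftrightarrow> (\<exists>B. k_basis q M B \<and> card B \<le> n)"

definition Lam_U :: "'k::field \<Rightarrow> 'k \<Rightarrow> 'k \<Rightarrow> 'k \<Rightarrow> (gen list \<Rightarrow> 'k) set set" where
  "Lam_U q a b c =
     {r \<otimes>\<^bsub>Lam q\<^esub> (Lam_scalar q a \<otimes>\<^bsub>Lam q\<^esub> Lam_gen q Gx
                  \<oplus>\<^bsub>Lam q\<^esub> Lam_scalar q b \<otimes>\<^bsub>Lam q\<^esub> Lam_gen q Gy
                  \<oplus>\<^bsub>Lam q\<^esub> Lam_scalar q c \<otimes>\<^bsub>Lam q\<^esub> Lam_gen q Gz) | r. r \<in> carrier (Lam q)}
     <+>\<^bsub>Lam q\<^esub> socle (Lam q) (regular_module (Lam q))"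

definition Lam_M :: "'k::field \<Rightarrow> 'k \<Rightarrow> 'k \<Rightarrow> 'k \<Rightarrow>
    ((gen list \<Rightarrow> 'k) set, (gen list \<Rightarrow> 'k) set set) module" where
  "Lam_M q a b c = quotient_module (Lam q) (regular_module (Lam q)) (Lam_U q a b c)"

section \<open>The constructions yield rings and modules\<close>

lemma opp_ring_simps [simp]:
  "carrier (opp_ring R) = carrier R" "zero (opp_ring R) = zero R" "one (opp_ring R) = one R"
  "add (opp_ring R) = add R" "x \<otimes>\<^bsub>opp_ring R\<^esub> y = y \<otimes>\<^bsub>R\<^esub> x" "opp_ring (opp_ring R) = R"
  by (simp_all add: opp_ring_def)

lemma ring_opp_ring:
  assumes "ring R"
  shows "ring (opp_ring R)"
proof -
  interpret ring R by fact
  have "add_monoid (opp_ring R) = add_monoid R" by simp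
  then have "abelian_group (opp_ring R)"
    using abelian_group_axioms
    by (auto simp: abelian_group_def abelian_group_axioms_def abelian_monoid_def)
  moreover have "Group.monoid (opp_ring R)"
    by (rule monoidI) (auto simp: m_assoc)
  ultimately show ?thesis
    by (rule ringI) (auto simp: l_distr r_distr)
qed

lemma left_module_regular:
  assumes "ring R"
  shows "left_module R (regular_module R)"
proof -
  interpret ring R by fact
  have "abelian_group (regular_module R)"
    by (rule abelian_groupI) (auto simp: regular_module_def a_ac intro: l_neg)
  then show ?thesis
    by (intro left_module.intro left_module_axioms.intro)
      (auto simp: regular_module_def l_distr r_distr m_assoc ring_axioms)
qed

lemma free_algebra_mult_closed:
  fixes f g :: "gen list \<Rightarrow> 'k::field"
  assumes "finite {w. f w \<noteq> 0}" "finite {w. g w \<noteq> 0}"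
  shows "finite {w. (\<Sum>i\<le>length w. f (take i w) * g (drop i w)) \<noteq> 0}"
proof (rule finite_subset)
  show "finite ((\<lambda>(u, v). u @ v) ` ({w. f w \<noteq> 0} \<times> {w. g w \<noteq> 0}))"
    using assms by simp
  show "{w. (\<Sum>i\<le>length w. f (take i w) * g (drop i w)) \<noteq> 0}
      \<subseteq> (\<lambda>(u, v). u @ v) ` ({w. f w \<noteq> 0} \<times> {w. g w \<noteq> 0})"
  proof
    fix w assume "w \<in> {w. (\<Sum>i\<le>length w. f (take i w) * g (drop i w)) \<noteq> 0}"
    then obtain i where "f (take i w) * g (drop i w) \<noteq> 0"
      by (metis (mono_tags, lifting) mem_Collect_eq sum.neutral)
    then have "(take i w, drop i w) \<in> {w. f w \<noteq> 0} \<times> {w. g w \<noteq> 0}" by simp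
    then show "w \<in> (\<lambda>(u, v). u @ v) ` ({w. f w \<noteq> 0} \<times> {w. g w \<noteq> 0})"
      by (rule rev_image_eqI) simp
  qed
qed

lemma free_algebra_mult_assoc:
  fixes f g h :: "gen list \<Rightarrow> 'k::field"
  shows "(\<Sum>i\<le>length w. (\<Sum>j\<le>length (take i w). f (take j (take i w)) * g (drop j (take i w))) * h (drop i w))
    = (\<Sum>j\<le>length w. f (take j w) * (\<Sum>m\<le>length (drop j w). g (take m (drop j w)) * h (drop m (drop j w))))"
  (is "?L = ?R")
proof -
  let ?t = "\<lambda>j m. f (take j w) * (g (take m (drop j w)) * h (drop (j + m) w))"
  have "?L = (\<Sum>i\<le>length w. \<Sum>j\<le>i. ?t j (i - j))"
  proof (rule sum.cong)
    fix i assume "i \<in> {..length w}"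
    then show "(\<Sum>j\<le>length (take i w). f (take j (take i w)) * g (drop j (take i w))) * h (drop i w)
        = (\<Sum>j\<le>i. ?t j (i - j))"
      by (auto simp: sum_distrib_right min_def drop_take mult.assoc intro!: sum.cong)
  qed simp
  also have "\<dots> = (\<Sum>(j, m)\<in>{(j, m). j + m \<le> length w}. ?t j m)"
    by (subst sum.triangle_reindex_eq) simp
  also have "{(j, m). j + m \<le> length w} = (SIGMA j:{..length w}. {..length w - j})"
    by auto
  also have "(\<Sum>(j, m)\<in>(SIGMA j:{..length w}. {..length w - j}). ?t j m)
      = (\<Sum>j\<le>length w. \<Sum>m\<le>length w - j. ?t j m)"
    by (subst sum.Sigma) auto
  also have "\<dots> = ?R"
    by (auto simp: sum_distrib_left add.commute intro!: sum.cong)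
  finally show ?thesis .
qed

lemma ring_free_algebra: "ring (free_algebra :: (gen list \<Rightarrow> 'k::field) ring)"
proof (rule ringI)
  show "abelian_group (free_algebra :: (gen list \<Rightarrow> 'k) ring)"
  proof (rule abelian_groupI)
    fix f g :: "gen list \<Rightarrow> 'k"
    assume f: "f \<in> carrier free_algebra" and g: "g \<in> carrier free_algebra"
    have "{w. f w + g w \<noteq> 0} \<subseteq> {w. f w \<noteq> 0} \<union> {w. g w \<noteq> 0}" by auto
    with f g show "f \<oplus>\<^bsub>free_algebra\<^esub> g \<in> carrier free_algebra"
      by (auto simp: free_algebra_def intro: finite_subset)
    show "\<exists>h\<in>carrier free_algebra. h \<oplus>\<^bsub>free_algebra\<^esub> f = \<zero>\<^bsub>free_algebra\<^esub>"
      using f by (intro bexI[of _ "\<lambda>w. - f w"]) (auto simp: free_algebra_def)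
  qed (auto simp: free_algebra_def algebra_simps)
  show "Group.monoid (free_algebra :: (gen list \<Rightarrow> 'k) ring)"
  proof (rule monoidI)
    fix f g h :: "gen list \<Rightarrow> 'k"
    assume f: "f \<in> carrier free_algebra" and g: "g \<in> carrier free_algebra"
    show "f \<otimes>\<^bsub>free_algebra\<^esub> g \<in> carrier free_algebra"
      using f g free_algebra_mult_closed[where f = f and g = g] by (simp add: free_algebra_def)
    show "f \<otimes>\<^bsub>free_algebra\<^esub> g \<otimes>\<^bsub>free_algebra\<^esub> h = f \<otimes>\<^bsub>free_algebra\<^esub> (g \<otimes>\<^bsub>free_algebra\<^esub> h)"
      using free_algebra_mult_assoc[where f = f and g = g and h = h] by (simp only: free_algebra_def monoid.simps)
    show "\<one>\<^bsub>free_algebra\<^esub> \<otimes>\<^bsub>free_algebra\<^esub> f = f"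
    proof (rule ext)
      fix w :: "gen list"
      have "(\<Sum>i\<le>length w. (if take i w = [] then 1 else 0) * f (drop i w))
          = (\<Sum>i\<le>length w. if i = 0 then f (drop i w) else 0)"
        by (rule sum.cong) auto
      then show "(\<one>\<^bsub>free_algebra\<^esub> \<otimes>\<^bsub>free_algebra\<^esub> f) w = f w"
        by (simp add: free_algebra_def)
    qed
    show "f \<otimes>\<^bsub>free_algebra\<^esub> \<one>\<^bsub>free_algebra\<^esub> = f"
    proof (rule ext)
      fix w :: "gen list"
      have "(\<Sum>i\<le>length w. f (take i w) * (if drop i w = [] then 1 else 0))
          = (\<Sum>i\<le>length w. if i = length w then f (take i w) else 0)"
        by (rule sum.cong) auto
      then show "(f \<otimes>\<^bsub>free_algebra\<^esub> \<one>\<^bsub>free_algebra\<^esub>) w = f w"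
        by (simp add: free_algebra_def)
    qed
  qed (auto simp: free_algebra_def)
qed (auto simp: free_algebra_def algebra_simps sum.distrib)

lemma ring_Lam: "ring (Lam q)"
proof -
  interpret F: ring "free_algebra :: (gen list \<Rightarrow> 'a) ring"
    by (rule ring_free_algebra)
  have word: "term_of_word c v \<in> carrier free_algebra" for c :: 'a and v
    by (simp add: free_algebra_def term_of_word_def)
  have "Lam_relations q \<subseteq> carrier free_algebra"
    by (auto simp: Lam_relations_def intro!: word)
  then show ?thesis
    unfolding Lam_def Lam_ideal_def by (intro ideal.quotient_is_ring F.genideal_ideal)
qed

lemma left_module_dual:
  assumes "left_module R M"
  shows "left_module (opp_ring R) (dual R M)"
proof -
  interpret left_module R M by fact
  have closed: "f x \<in> carrier R" if "f \<in> carrier (dual R M)" "x \<in> carrier M" for f x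
    using that by (auto simp: dual_def lin_maps_def regular_module_def)
  have "abelian_group (dual R M)"
  proof (rule abelian_groupI)
    fix f assume "f \<in> carrier (dual R M)"
    then show "\<exists>g\<in>carrier (dual R M). g \<oplus>\<^bsub>dual R M\<^esub> f = \<zero>\<^bsub>dual R M\<^esub>"
      using closed[of f]
      by (intro bexI[of _ "\<lambda>x\<in>carrier M. \<ominus>\<^bsub>R\<^esub> f x"])
        (auto simp: dual_def lin_maps_def regular_module_def R.l_neg R.minus_add R.r_minus
          intro!: restrict_ext)
  next
    fix f assume "f \<in> carrier (dual R M)"
    then show "\<zero>\<^bsub>dual R M\<^esub> \<oplus>\<^bsub>dual R M\<^esub> f = f"
      using closed[of f]
      by (auto simp: dual_def lin_maps_def regular_module_def PiE_iff extensional_def fun_eq_iff)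
  qed (auto simp: dual_def lin_maps_def regular_module_def PiE_iff R.a_ac R.r_distr
        intro!: restrict_ext)
  moreover have "\<one>\<^bsub>opp_ring R\<^esub> \<odot>\<^bsub>dual R M\<^esub> f = f" if "f \<in> carrier (dual R M)" for f
    using that closed[of f]
    by (auto simp: dual_def lin_maps_def regular_module_def PiE_iff extensional_def fun_eq_iff)
  ultimately show ?thesis
    by (intro left_module.intro left_module_axioms.intro ring_opp_ring R.ring_axioms)
      (auto simp: dual_def lin_maps_def regular_module_def PiE_iff R.m_assoc R.l_distr R.r_distr
        intro!: restrict_ext)
qed

lemma canonical_map_linear:
  assumes "left_module R M"
  shows "(\<lambda>m\<in>carrier M. canonical_map R M m) \<in> lin_maps R M (bidual R M)"
proof -
  interpret left_module R M by fact
  interpret D: left_module "opp_ring R" "dual R M" by (rule left_module_dual) fact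
  have val: "f x \<in> carrier R" "f (x \<oplus>\<^bsub>M\<^esub> y) = f x \<oplus>\<^bsub>R\<^esub> f y"
    "r \<in> carrier R \<Longrightarrow> f (r \<odot>\<^bsub>M\<^esub> x) = r \<otimes>\<^bsub>R\<^esub> f x"
    if "f \<in> carrier (dual R M)" "x \<in> carrier M" "y \<in> carrier M" for f x y r
    using that by (auto simp: dual_def lin_maps_def regular_module_def)
  have ops: "(f \<oplus>\<^bsub>dual R M\<^esub> g) x = f x \<oplus>\<^bsub>R\<^esub> g x" "(r \<odot>\<^bsub>dual R M\<^esub> f) x = f x \<otimes>\<^bsub>R\<^esub> r"
    if "x \<in> carrier M" for f g x r
    using that by (auto simp: dual_def)
  have "canonical_map R M x \<in> carrier (bidual R M)" if x: "x \<in> carrier M" for x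
    using D.M.a_closed D.smult_closed x
    by (auto simp: canonical_map_def bidual_def dual_def[of "opp_ring R" "dual R M"] lin_maps_def[of "opp_ring R"]
        regular_module_def ops val)
  moreover have "canonical_map R M (x \<oplus>\<^bsub>M\<^esub> y)
      = canonical_map R M x \<oplus>\<^bsub>bidual R M\<^esub> canonical_map R M y"
    if "x \<in> carrier M" "y \<in> carrier M" for x y
    using that by (auto simp: canonical_map_def bidual_def dual_def[of "opp_ring R" "dual R M"] val
        intro!: restrict_ext)
  moreover have "canonical_map R M (r \<odot>\<^bsub>M\<^esub> x) = r \<odot>\<^bsub>bidual R M\<^esub> canonical_map R M x"
    if "x \<in> carrier M" "r \<in> carrier R" for x r
    using that by (auto simp: canonical_map_def bidual_def dual_def[of "opp_ring R" "dual R M"] val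
        intro!: restrict_ext)
  ultimately show ?thesis
    by (auto simp: lin_maps_def[of R])
qed

section \<open>Existence of free resolutions\<close>

lemma left_module_free:
  fixes R (structure)
  assumes "ring R"
  shows "left_module R (free_module R I)"
proof -
  interpret ring R by fact
  have "abelian_group (free_module R I)"
  proof (rule abelian_groupI)
    fix f g assume f: "f \<in> carrier (free_module R I)" and g: "g \<in> carrier (free_module R I)"
    have "{i\<in>I. f i \<oplus> g i \<noteq> \<zero>} \<subseteq> {i\<in>I. f i \<noteq> \<zero>} \<union> {i\<in>I. g i \<noteq> \<zero>}"
      by auto
    then have "finite {i\<in>I. f i \<oplus> g i \<noteq> \<zero>}"
      using f g by (auto simp: free_module_def intro: finite_subset)
    moreover have "{i \<in> I. (\<lambda>i\<in>I. f i \<oplus> g i) i \<noteq> \<zero>} = {i\<in>I. f i \<oplus> g i \<noteq> \<zero>}" by auto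
    ultimately show "f \<oplus>\<^bsub>free_module R I\<^esub> g \<in> carrier (free_module R I)"
      using f g by (auto simp: free_module_def PiE_iff cong: conj_cong)
    have "{i \<in> I. (\<lambda>i\<in>I. \<ominus> f i) i \<noteq> \<zero>} \<subseteq> {i\<in>I. f i \<noteq> \<zero>}" by auto
    then have "finite {i \<in> I. (\<lambda>i\<in>I. \<ominus> f i) i \<noteq> \<zero>}"
      by (rule finite_subset) (use f in \<open>simp add: free_module_def\<close>)
    moreover have "(\<lambda>i\<in>I. \<ominus> f i) \<in> I \<rightarrow>\<^sub>E carrier R"
      using f by (auto simp: free_module_def PiE_iff)
    ultimately have "(\<lambda>i\<in>I. \<ominus> f i) \<in> carrier (free_module R I)"
      by (simp only: free_module_def partial_object.simps mem_Collect_eq simp_thms)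
    then show "\<exists>h\<in>carrier (free_module R I). h \<oplus>\<^bsub>free_module R I\<^esub> f = \<zero>\<^bsub>free_module R I\<^esub>"
      using f by (intro bexI[of _ "\<lambda>i\<in>I. \<ominus> f i"]) (auto simp: free_module_def PiE_iff l_neg intro!: restrict_ext)
  next
    have "{i \<in> I. (\<lambda>i\<in>I. \<zero>) i \<noteq> \<zero>} = {}" by auto
    then show "\<zero>\<^bsub>free_module R I\<^esub> \<in> carrier (free_module R I)" by (auto simp: free_module_def)
  next
    fix f assume "f \<in> carrier (free_module R I)"
    then show "\<zero>\<^bsub>free_module R I\<^esub> \<oplus>\<^bsub>free_module R I\<^esub> f = f"
      by (auto simp: free_module_def PiE_iff extensional_def fun_eq_iff)
  qed (auto simp: free_module_def PiE_iff a_ac intro!: restrict_ext)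
  then show ?thesis
  proof (intro left_module.intro left_module_axioms.intro)
    fix a f assume a: "a \<in> carrier R" and f: "f \<in> carrier (free_module R I)"
    have "{i \<in> I. (\<lambda>i\<in>I. a \<otimes> f i) i \<noteq> \<zero>} \<subseteq> {i\<in>I. f i \<noteq> \<zero>}" using a by auto
    then have "finite {i \<in> I. (\<lambda>i\<in>I. a \<otimes> f i) i \<noteq> \<zero>}"
      by (rule finite_subset) (use f in \<open>simp add: free_module_def\<close>)
    moreover have "(\<lambda>i\<in>I. a \<otimes> f i) \<in> I \<rightarrow>\<^sub>E carrier R"
      using a f by (auto simp: free_module_def PiE_iff)
    ultimately show "a \<odot>\<^bsub>free_module R I\<^esub> f \<in> carrier (free_module R I)"
      by (simp only: free_module_def partial_object.simps module.simps mem_Collect_eq simp_thms)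
  next
    fix f assume "f \<in> carrier (free_module R I)"
    then show "\<one> \<odot>\<^bsub>free_module R I\<^esub> f = f"
      by (auto simp: free_module_def PiE_iff extensional_def fun_eq_iff)
  qed (auto simp: free_module_def PiE_iff l_distr r_distr m_assoc ring_axioms intro!: restrict_ext)
qed

lemma left_module_submodule:
  assumes "left_module R M" "submodule H R M"
  shows "left_module R (M\<lparr>carrier := H\<rparr>)"
proof -
  interpret left_module R M by fact
  interpret H: submodule H R M by fact
  have "abelian_monoid (M\<lparr>carrier := H\<rparr>)"
    using comm_monoid.submonoid_is_comm_monoid[OF _ H.subgroup_is_submonoid]
      M.a_comm_monoid
    by (simp add: abelian_monoid_def)
  moreover have "group ((add_monoid M)\<lparr>carrier := H\<rparr>)"
    by (rule M.add.subgroup_imp_group[OF H.subgroup_axioms])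
  ultimately have "abelian_group (M\<lparr>carrier := H\<rparr>)"
    by (simp add: abelian_group_def abelian_group_axioms_def abelian_monoid_def comm_group_def)
  moreover have "x \<in> carrier M" if "x \<in> H" for x
    using H.subset that by auto
  ultimately show ?thesis
    by (intro left_module.intro left_module_axioms.intro)
      (auto simp: smult_l_distr smult_r_distr smult_assoc1 R.ring_axioms)
qed

lemma left_module_smult_zero:
  assumes "left_module R M" "a \<in> carrier R"
  shows "a \<odot>\<^bsub>M\<^esub> \<zero>\<^bsub>M\<^esub> = \<zero>\<^bsub>M\<^esub>"
proof -
  interpret left_module R M by fact
  have "a \<odot>\<^bsub>M\<^esub> \<zero>\<^bsub>M\<^esub> \<oplus>\<^bsub>M\<^esub> a \<odot>\<^bsub>M\<^esub> \<zero>\<^bsub>M\<^esub> = a \<odot>\<^bsub>M\<^esub> \<zero>\<^bsub>M\<^esub>"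
    using assms(2) smult_r_distr[of a "\<zero>\<^bsub>M\<^esub>" "\<zero>\<^bsub>M\<^esub>"] by simp
  then show ?thesis using assms(2)
    by (metis M.add.r_cancel_one' M.zero_closed smult_closed)
qed

lemma left_module_zero_smult:
  assumes "left_module R M" "x \<in> carrier M"
  shows "\<zero>\<^bsub>R\<^esub> \<odot>\<^bsub>M\<^esub> x = \<zero>\<^bsub>M\<^esub>"
proof -
  interpret left_module R M by fact
  have "\<zero>\<^bsub>R\<^esub> \<odot>\<^bsub>M\<^esub> x \<oplus>\<^bsub>M\<^esub> \<zero>\<^bsub>R\<^esub> \<odot>\<^bsub>M\<^esub> x = \<zero>\<^bsub>R\<^esub> \<odot>\<^bsub>M\<^esub> x"
    using assms(2) smult_l_distr[of "\<zero>\<^bsub>R\<^esub>" "\<zero>\<^bsub>R\<^esub>" x] by simp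
  then show ?thesis using assms(2)
    by (metis M.add.r_cancel_one' R.zero_closed smult_closed)
qed

lemma finsum_smult:
  assumes "left_module R M" "finite A" "a \<in> carrier R" "f \<in> A \<rightarrow> carrier M"
  shows "a \<odot>\<^bsub>M\<^esub> (\<Oplus>\<^bsub>M\<^esub>i\<in>A. f i) = (\<Oplus>\<^bsub>M\<^esub>i\<in>A. a \<odot>\<^bsub>M\<^esub> f i)"
proof -
  interpret left_module R M by fact
  show ?thesis
    using assms(2,4)
  proof (induction A)
    case empty
    then show ?case using assms by (simp add: left_module_smult_zero)
  next
    case (insert x F)
    then show ?case using assms(3) by (simp add: Pi_def smult_r_distr)
  qed
qed

text \<open>The linear map from the free module on \<open>I\<close> sending the basis element \<open>i\<close> to \<open>p i\<close>.\<close>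

definition free_lift :: "'a ring \<Rightarrow> ('a, 'm) module \<Rightarrow> 'i set \<Rightarrow> ('i \<Rightarrow> 'm) \<Rightarrow> ('i \<Rightarrow> 'a) \<Rightarrow> 'm" where
  "free_lift R M I p =
     (\<lambda>f\<in>carrier (free_module R I). \<Oplus>\<^bsub>M\<^esub>i\<in>{i\<in>I. f i \<noteq> \<zero>\<^bsub>R\<^esub>}. f i \<odot>\<^bsub>M\<^esub> p i)"

lemma free_lift_eq:
  assumes "left_module R M" "p \<in> I \<rightarrow> carrier M" "f \<in> carrier (free_module R I)"
    and "finite A" "A \<subseteq> I" "{i\<in>I. f i \<noteq> \<zero>\<^bsub>R\<^esub>} \<subseteq> A"
  shows "free_lift R M I p f = (\<Oplus>\<^bsub>M\<^esub>i\<in>A. f i \<odot>\<^bsub>M\<^esub> p i)"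
proof -
  interpret left_module R M by fact
  have f: "f i \<in> carrier R" if "i \<in> I" for i
    using assms(3) that by (auto simp: free_module_def PiE_iff)
  have "(\<Oplus>\<^bsub>M\<^esub>i\<in>{i\<in>I. f i \<noteq> \<zero>\<^bsub>R\<^esub>}. f i \<odot>\<^bsub>M\<^esub> p i) = (\<Oplus>\<^bsub>M\<^esub>i\<in>A. f i \<odot>\<^bsub>M\<^esub> p i)"
  proof (rule M.add.finprod_mono_neutral_cong_left)
    fix i assume "i \<in> A - {i\<in>I. f i \<noteq> \<zero>\<^bsub>R\<^esub>}"
    then have "i \<in> I" "f i = \<zero>\<^bsub>R\<^esub>" using assms(5) by auto
    then show "f i \<odot>\<^bsub>M\<^esub> p i = \<zero>\<^bsub>M\<^esub>"
      using assms(2) left_module_zero_smult[OF assms(1), of "p i"] by (simp add: Pi_iff)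
  next
    show "(\<lambda>i. f i \<odot>\<^bsub>M\<^esub> p i) \<in> A \<rightarrow> carrier M"
      using f assms(2,5) by (intro Pi_I smult_closed) auto
  qed (use assms(4,6) in auto)
  then show ?thesis using assms(3) by (simp add: free_lift_def)
qed

lemma free_lift_linear:
  assumes "left_module R M" "p \<in> I \<rightarrow> carrier M"
  shows "free_lift R M I p \<in> lin_maps R (free_module R I) M"
proof -
  interpret left_module R M by fact
  interpret F: left_module R "free_module R I" by (rule left_module_free) (rule R.ring_axioms)
  let ?S = "\<lambda>f. {i\<in>I. f i \<noteq> \<zero>\<^bsub>R\<^esub>}"
  have fin: "finite (?S f)" and val: "i \<in> I \<Longrightarrow> f i \<in> carrier R"
    if "f \<in> carrier (free_module R I)" for f i
    using that by (auto simp: free_module_def PiE_iff)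
  note eq = free_lift_eq[OF assms]
  have p: "p i \<in> carrier M" if "i \<in> I" for i using assms(2) that by auto
  show ?thesis
    unfolding lin_maps_def
  proof (intro CollectI conjI ballI)
    have "free_lift R M I p f \<in> carrier M" if "f \<in> carrier (free_module R I)" for f
      using that by (subst eq[OF that fin[OF that]]) (auto intro!: M.finsum_closed val p)
    then show "free_lift R M I p \<in> carrier (free_module R I) \<rightarrow>\<^sub>E carrier M"
      by (auto simp: free_lift_def)
  next
    fix f g assume f: "f \<in> carrier (free_module R I)" and g: "g \<in> carrier (free_module R I)"
    let ?A = "?S f \<union> ?S g"
    have fg: "f \<oplus>\<^bsub>free_module R I\<^esub> g \<in> carrier (free_module R I)" using f g by simp
    have add: "(f \<oplus>\<^bsub>free_module R I\<^esub> g) i = f i \<oplus>\<^bsub>R\<^esub> g i" if "i \<in> I" for i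
      using that by (simp add: free_module_def)
    have A: "finite ?A" "?A \<subseteq> I" using f g fin by auto
    have "free_lift R M I p (f \<oplus>\<^bsub>free_module R I\<^esub> g)
        = (\<Oplus>\<^bsub>M\<^esub>i\<in>?A. (f \<oplus>\<^bsub>free_module R I\<^esub> g) i \<odot>\<^bsub>M\<^esub> p i)"
      by (rule eq[OF fg A]) (auto simp: add)
    also have "\<dots> = (\<Oplus>\<^bsub>M\<^esub>i\<in>?A. f i \<odot>\<^bsub>M\<^esub> p i \<oplus>\<^bsub>M\<^esub> g i \<odot>\<^bsub>M\<^esub> p i)"
      by (rule M.finsum_cong') (use f g val p in \<open>auto simp: add smult_l_distr\<close>)
    also have "\<dots> = (\<Oplus>\<^bsub>M\<^esub>i\<in>?A. f i \<odot>\<^bsub>M\<^esub> p i) \<oplus>\<^bsub>M\<^esub> (\<Oplus>\<^bsub>M\<^esub>i\<in>?A. g i \<odot>\<^bsub>M\<^esub> p i)"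
      by (rule M.finsum_addf) (use f g val p in auto)
    also have "\<dots> = free_lift R M I p f \<oplus>\<^bsub>M\<^esub> free_lift R M I p g"
      using eq[OF f A] eq[OF g A] by auto
    finally show "free_lift R M I p (f \<oplus>\<^bsub>free_module R I\<^esub> g)
        = free_lift R M I p f \<oplus>\<^bsub>M\<^esub> free_lift R M I p g" .
  next
    fix r f assume r: "r \<in> carrier R" and f: "f \<in> carrier (free_module R I)"
    have rf: "r \<odot>\<^bsub>free_module R I\<^esub> f \<in> carrier (free_module R I)" using r f by simp
    have sm: "(r \<odot>\<^bsub>free_module R I\<^esub> f) i = r \<otimes>\<^bsub>R\<^esub> f i" if "i \<in> I" for i
      using that by (simp add: free_module_def)
    have "free_lift R M I p (r \<odot>\<^bsub>free_module R I\<^esub> f)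
        = (\<Oplus>\<^bsub>M\<^esub>i\<in>?S f. (r \<odot>\<^bsub>free_module R I\<^esub> f) i \<odot>\<^bsub>M\<^esub> p i)"
      by (rule eq[OF rf fin[OF f]]) (use r in \<open>auto simp: sm\<close>)
    also have "\<dots> = (\<Oplus>\<^bsub>M\<^esub>i\<in>?S f. r \<odot>\<^bsub>M\<^esub> (f i \<odot>\<^bsub>M\<^esub> p i))"
      by (rule M.finsum_cong') (use f r val p in \<open>auto simp: sm smult_assoc1\<close>)
    also have "\<dots> = r \<odot>\<^bsub>M\<^esub> (\<Oplus>\<^bsub>M\<^esub>i\<in>?S f. f i \<odot>\<^bsub>M\<^esub> p i)"
      by (rule finsum_smult[symmetric]) (use f r val p fin assms(1) in auto)
    also have "\<dots> = r \<odot>\<^bsub>M\<^esub> free_lift R M I p f"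
      using eq[OF f fin[OF f]] by auto
    finally show "free_lift R M I p (r \<odot>\<^bsub>free_module R I\<^esub> f) = r \<odot>\<^bsub>M\<^esub> free_lift R M I p f" .
  qed
qed

lemma free_lift_basis:
  assumes "left_module R M" "p \<in> I \<rightarrow> carrier M" "j \<in> I"
  shows "(\<lambda>i\<in>I. if i = j then \<one>\<^bsub>R\<^esub> else \<zero>\<^bsub>R\<^esub>) \<in> carrier (free_module R I)" (is "?b \<in> _")
    and "free_lift R M I p (\<lambda>i\<in>I. if i = j then \<one>\<^bsub>R\<^esub> else \<zero>\<^bsub>R\<^esub>) = p j"
proof -
  interpret left_module R M by fact
  have sub: "{i\<in>I. ?b i \<noteq> \<zero>\<^bsub>R\<^esub>} \<subseteq> {j}" by auto
  then show b: "?b \<in> carrier (free_module R I)"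
    by (auto simp: free_module_def intro: finite_subset)
  have pj: "p j \<in> carrier M" using assms by auto
  have "free_lift R M I p ?b = (\<Oplus>\<^bsub>M\<^esub>i\<in>{j}. ?b i \<odot>\<^bsub>M\<^esub> p i)"
    by (rule free_lift_eq[OF assms(1,2) b]) (use assms(3) sub in auto)
  then show "free_lift R M I p ?b = p j" using assms(3) pj by simp
qed

text \<open>Every module with at most \<open>|'i|\<close> elements is a quotient of a free module on a subset of \<open>'i\<close>.\<close>

lemma free_cover_exists:
  fixes N :: "('a, 'm) module" and h :: "'m \<Rightarrow> 'i"
  assumes "left_module R N" "inj_on h (carrier N)"
  shows "\<exists>(I :: 'i set) e. e \<in> lin_maps R (free_module R I) N \<and>
           e ` carrier (free_module R I) = carrier N"
proof -
  define I where "I = h ` carrier N"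
  define p where "p = inv_into (carrier N) h"
  have p: "p \<in> I \<rightarrow> carrier N" by (auto simp: I_def p_def inv_into_into)
  let ?e = "free_lift R N I p"
  have lin: "?e \<in> lin_maps R (free_module R I) N" by (rule free_lift_linear[OF assms(1) p])
  have "x \<in> ?e ` carrier (free_module R I)" if x: "x \<in> carrier N" for x
  proof -
    have "h x \<in> I" "p (h x) = x" using x assms(2) by (auto simp: I_def p_def)
    then show ?thesis using free_lift_basis[OF assms(1) p, of "h x"] by (metis image_eqI)
  qed
  then have "?e ` carrier (free_module R I) = carrier N"
    using lin by (auto simp: lin_maps_def)
  with lin show ?thesis by blast
qed

lemma submodule_kernel:
  assumes "left_module R M" "left_module R N" "f \<in> lin_maps R M N"
  shows "submodule {u \<in> carrier M. f u = \<zero>\<^bsub>N\<^esub>} R M"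
proof -
  interpret M: left_module R M by fact
  interpret N: left_module R N by fact
  have cl: "f x \<in> carrier N" if "x \<in> carrier M" for x
    using assms(3) that by (auto simp: lin_maps_def)
  have add: "f (x \<oplus>\<^bsub>M\<^esub> y) = f x \<oplus>\<^bsub>N\<^esub> f y" if "x \<in> carrier M" "y \<in> carrier M" for x y
    using assms(3) that by (auto simp: lin_maps_def)
  have sm: "f (r \<odot>\<^bsub>M\<^esub> x) = r \<odot>\<^bsub>N\<^esub> f x" if "r \<in> carrier R" "x \<in> carrier M" for r x
    using assms(3) that by (auto simp: lin_maps_def)
  have zero: "f \<zero>\<^bsub>M\<^esub> = \<zero>\<^bsub>N\<^esub>"
    using sm[of "\<zero>\<^bsub>R\<^esub>" "\<zero>\<^bsub>M\<^esub>"] left_module_zero_smult[OF assms(1)] left_module_zero_smult[OF assms(2)]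
    by (simp add: cl)
  have neg: "f (\<ominus>\<^bsub>M\<^esub> x) = \<zero>\<^bsub>N\<^esub>" if x: "x \<in> carrier M" "f x = \<zero>\<^bsub>N\<^esub>" for x
    using add[of x "\<ominus>\<^bsub>M\<^esub> x"] x zero cl[of "\<ominus>\<^bsub>M\<^esub> x"] by (simp add: M.M.r_neg)
  show ?thesis
  proof (intro submodule.intro subgroup.intro submodule_axioms.intro)
    fix x assume "x \<in> {u \<in> carrier M. f u = \<zero>\<^bsub>N\<^esub>}"
    then show "inv\<^bsub>add_monoid M\<^esub> x \<in> {u \<in> carrier M. f u = \<zero>\<^bsub>N\<^esub>}"
      using neg by (simp add: a_inv_def[symmetric])
  qed (auto simp: zero add sm left_module_smult_zero[OF assms(2)])
qed

subsection \<open>Finitely supported functions on lists can be coded by lists\<close>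

definition self_delim :: "('m + 'a) list \<Rightarrow> ('m + 'a) list" where
  "self_delim w = replicate (length w) (Inl undefined) @ Inr undefined # w"

lemma replicate_delim_inj:
  "replicate m x @ y # s = replicate n x @ y # t \<Longrightarrow> x \<noteq> y \<Longrightarrow> m = n \<and> s = t"
proof (induction m arbitrary: n)
  case 0
  then show ?case by (cases n) auto
next
  case (Suc m)
  then show ?case by (cases n) auto
qed

lemma self_delim_inj: "self_delim w @ s = self_delim w' @ s' \<Longrightarrow> w = w' \<and> s = s'"
  unfolding self_delim_def by (auto dest!: replicate_delim_inj)

fun code_list :: "(('m + 'a) list \<times> 'a) list \<Rightarrow> ('m + 'a) list" where
  "code_list [] = []"
| "code_list ((w, a) # ps) = Inr a # self_delim w @ code_list ps"

lemma code_list_inj: "code_list ps = code_list qs \<Longrightarrow> ps = qs"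
proof (induction ps arbitrary: qs rule: code_list.induct)
  case 1
  then show ?case by (cases qs rule: code_list.cases) auto
next
  case (2 w a ps)
  then show ?case by (cases qs rule: code_list.cases) (auto dest: self_delim_inj)
qed

lemma free_module_small:
  fixes R :: "'a ring" and I :: "('m + 'a) list set"
  shows "\<exists>h :: (('m + 'a) list \<Rightarrow> 'a) \<Rightarrow> ('m + 'a) list. inj_on h (carrier (free_module R I))"
proof -
  define G where "G f = (\<lambda>i. (i, f i)) ` {i\<in>I. f i \<noteq> \<zero>\<^bsub>R\<^esub>}" for f
  define l where "l A = (SOME xs. set xs = A)" for A :: "(('m + 'a) list \<times> 'a) set"
  have l: "set (l A) = A" if "finite A" for A
    unfolding l_def using finite_list[OF that] by (rule someI_ex)
  have "inj_on (\<lambda>f. code_list (l (G f))) (carrier (free_module R I))"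
  proof (rule inj_onI)
    fix f g assume f: "f \<in> carrier (free_module R I)" and g: "g \<in> carrier (free_module R I)"
      and eq: "code_list (l (G f)) = code_list (l (G g))"
    have "finite (G f)" "finite (G g)" using f g by (auto simp: G_def free_module_def)
    with code_list_inj[OF eq] l have G: "G f = G g" by metis
    have "f i = g i" if "i \<in> I" for i
    proof (rule ccontr)
      assume "f i \<noteq> g i"
      then have "(i, f i) \<in> G f \<and> (i, f i) \<notin> G g \<or> (i, g i) \<in> G g \<and> (i, g i) \<notin> G f"
        using that by (cases "f i = \<zero>\<^bsub>R\<^esub>") (auto simp: G_def)
      then show False using G by auto
    qed
    then show "f = g"
      using f g by (intro PiE_ext[of f I "\<lambda>_. carrier R" g]) (auto simp: free_module_def)
  qed
  then show ?thesis by blast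
qed

lemma free_cover_kernel_exists:
  fixes R :: "'a ring" and I :: "('m + 'a) list set"
  assumes "left_module R N" "f \<in> lin_maps R (free_module R I) N"
  shows "\<exists>(J :: ('m + 'a) list set) d. d \<in> lin_maps R (free_module R J) (free_module R I) \<and>
    d ` carrier (free_module R J) = {u \<in> carrier (free_module R I). f u = \<zero>\<^bsub>N\<^esub>}"
proof -
  interpret left_module R N by fact
  let ?F = "free_module R I"
  let ?K = "{u \<in> carrier ?F. f u = \<zero>\<^bsub>N\<^esub>}"
  have F: "left_module R ?F" by (rule left_module_free) (rule R.ring_axioms)
  have K: "left_module R (?F\<lparr>carrier := ?K\<rparr>)"
    by (intro left_module_submodule submodule_kernel F assms)
  obtain h :: "(('m + 'a) list \<Rightarrow> 'a) \<Rightarrow> ('m + 'a) list" where "inj_on h (carrier ?F)"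
    using free_module_small by blast
  then have "inj_on h (carrier (?F\<lparr>carrier := ?K\<rparr>))"
    by (rule inj_on_subset) auto
  from free_cover_exists[OF K this] obtain J :: "('m + 'a) list set" and d where
    "d \<in> lin_maps R (free_module R J) (?F\<lparr>carrier := ?K\<rparr>)" "d ` carrier (free_module R J) = ?K"
    by auto
  moreover from this have "d \<in> lin_maps R (free_module R J) ?F"
    by (auto simp: lin_maps_def PiE_iff)
  ultimately show ?thesis by blast
qed

theorem free_resolution_exists:
  fixes R :: "'a ring" and N :: "('a, 'm) module"
  assumes "left_module R N"
  shows "\<exists>(I :: nat \<Rightarrow> ('m + 'a) list set) d e. is_free_resolution R N I d e"
proof -
  interpret left_module R N by fact
  have "inj_on (\<lambda>m. [Inl m :: 'm + 'a]) (carrier N)" by (auto intro: inj_onI)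
  from free_cover_exists[OF assms this] obtain I0 :: "('m + 'a) list set" and e where
    e: "e \<in> lin_maps R (free_module R I0) N" "e ` carrier (free_module R I0) = carrier N"
    by blast
  from free_cover_kernel_exists[OF assms e(1)] obtain I1 :: "('m + 'a) list set" and d0 where
    d0: "d0 \<in> lin_maps R (free_module R I1) (free_module R I0)"
      "d0 ` carrier (free_module R I1) = {u \<in> carrier (free_module R I0). e u = \<zero>\<^bsub>N\<^esub>}"
    by blast
  define P where "P = (\<lambda>(n::nat) (I :: ('m + 'a) list set, J :: ('m + 'a) list set, d).
    d \<in> lin_maps R (free_module R J) (free_module R I) \<and> (n = 0 \<longrightarrow> (I, J, d) = (I0, I1, d0)))"
  define Q where "Q = (\<lambda>(n::nat) (I :: ('m + 'a) list set, J :: ('m + 'a) list set,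
      d :: (('m + 'a) list \<Rightarrow> 'a) \<Rightarrow> ('m + 'a) list \<Rightarrow> 'a)
      (I' :: ('m + 'a) list set, J' :: ('m + 'a) list set, d' :: (('m + 'a) list \<Rightarrow> 'a) \<Rightarrow> ('m + 'a) list \<Rightarrow> 'a).
    I' = J \<and> d' ` carrier (free_module R J') =
      {u \<in> carrier (free_module R J). d u = \<zero>\<^bsub>free_module R I\<^esub>})"
  have "\<exists>s. \<forall>n. P n (s n) \<and> Q n (s n) (s (Suc n))"
  proof (rule dependent_nat_choice)
    show "\<exists>x. P 0 x" using d0 by (auto simp: P_def)
    fix x n assume "P n x"
    then obtain I J d where x: "x = (I, J, d)"
      and d: "d \<in> lin_maps R (free_module R J) (free_module R I)"
      by (cases x) (auto simp: P_def)
    have "left_module R (free_module R I)" by (rule left_module_free) (rule R.ring_axioms)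
    from free_cover_kernel_exists[OF this d]
    obtain J' :: "('m + 'a) list set" and d' where "d' \<in> lin_maps R (free_module R J') (free_module R J)"
      "d' ` carrier (free_module R J') = {u \<in> carrier (free_module R J). d u = \<zero>\<^bsub>free_module R I\<^esub>}"
      by blast
    then show "\<exists>y. P (Suc n) y \<and> Q n x y"
      by (intro exI[of _ "(J, J', d')"]) (auto simp: P_def Q_def x)
  qed
  then obtain s where s: "\<And>n. P n (s n)" "\<And>n. Q n (s n) (s (Suc n))" by blast
  define I where "I n = fst (s n)" for n
  define d where "d n = snd (snd (s n))" for n
  have J: "fst (snd (s n)) = I (Suc n)" for n
    using s(2)[of n] by (auto simp: Q_def I_def split: prod.splits)
  have sn: "s n = (I n, I (Suc n), d n)" for n
    by (simp add: J[symmetric] I_def[of n] d_def)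
  have "I 0 = I0" "I (Suc 0) = I1" "d 0 = d0"
    using s(1)[of 0] by (auto simp: P_def sn)
  moreover have "d n \<in> lin_maps R (free_module R (I (Suc n))) (free_module R (I n))" for n
    using s(1)[of n] by (simp add: P_def sn)
  moreover have "d (Suc n) ` carrier (free_module R (I (Suc (Suc n)))) =
      {u \<in> carrier (free_module R (I (Suc n))). d n u = \<zero>\<^bsub>free_module R (I n)\<^esub>}" for n
    using s(2)[of n] by (simp add: Q_def sn)
  ultimately have "is_free_resolution R N I d e"
    using e d0 by (simp add: is_free_resolution_def)
  then show ?thesis by blast
qed

lemma chosen_resolution:
  assumes "left_module R N" "chosen_resolution R N = (I, d, e)"
  shows "is_free_resolution R N I d e"
proof -
  have "\<exists>x :: (nat \<Rightarrow> ('b + 'a) list set) \<times> (nat \<Rightarrow> (('b + 'a) list \<Rightarrow> 'a) \<Rightarrow> ('b + 'a) list \<Rightarrow> 'a)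
      \<times> ((('b + 'a) list \<Rightarrow> 'a) \<Rightarrow> 'b).
      case x of (I, d, e) \<Rightarrow> is_free_resolution R N I d e"
    using free_resolution_exists[OF assms(1)] by auto
  from someI_ex[OF this] assms(2) show ?thesis
    unfolding chosen_resolution_def by auto
qed

end

theory Submission
  imports Defs "HOL.Vector_Spaces" "HOL-Library.Function_Algebras"
begin

text \<open>
  Write \<open>J\<close> for the radical of \<open>\<Lambda>\<close>, so that \<open>J\<^sup>3 = 0\<close> and \<open>J\<^sup>2\<close> is the socle, and let
  \<open>w = x + by + cz\<close>. The products of linear elements are explicit bilinear forms, and they give

    \<^item> \<open>\<Lambda>w = U(1,b,c)\<close> and \<open>{r. r w = 0} = U(1, qb, -c/(1+b))\<close> if \<open>b \<noteq> -1\<close>,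
    \<^item> \<open>w\<Lambda> = U(1,b,c)\<close> and \<open>{r. w r = 0} = U(1, b/q, -c(1+b/q))\<close> for all \<open>b\<close>.

  So the syzygy of \<open>M(1,b,c)\<close> is \<open>M(1, qb, -c/(1+b))\<close> as long as \<open>b \<noteq> -1\<close>, and then every map from the
  left ideal \<open>U(1,b,c)\<close> to \<open>\<Lambda>\<close> is a right multiplication, i.e. \<open>Ext\<^sup>1\<close> vanishes. Starting with
  \<open>b = -q\<close> one passes through the parameters \<open>-q\<^sup>n\<close>, which avoid \<open>-1\<close> because \<open>q\<close> is not a root of
  unity; hence \<open>M(1,-q,c)\<close> is semi-Gorenstein-projective. Its dual is the right annihilator of
  \<open>U(1,-q,c)\<close>, the right ideal \<open>(x - y)\<Lambda>\<close>, whatever \<open>c\<close> is; the syzygies of the latter are the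
  right ideals \<open>(x - q\<^sup>-\<^sup>n y)\<Lambda>\<close>, and the same argument applies. Since \<open>z (x - y) = 0\<close>, all maps
  \<open>M(1,-q,c) \<rightarrow> \<Lambda>\<close> kill the nonzero residue class of \<open>z\<close>, so that the module is not torsionless.
  This is carried by \<open>semi_Gorenstein_projective_cyclic\<close>, which reduces the vanishing of all \<open>Ext\<^sup>n\<close>
  for a cyclic module to such statements on annihilators of ring elements.

  Conversely let \<open>M\<close> have dimension at most \<open>3\<close>. Only \<open>Ext\<^sup>1(M,\<Lambda>) = 0\<close> and
  \<open>Ext\<^sup>1(M\<^sup>*,\<Lambda>) = 0\<close> are needed. If \<open>M\<close> is not reflexive, then \<open>M \<noteq> 0\<close> and there is \<open>m \<notin> JM\<close>. For a
  linear map \<open>\<eta>\<close> from the span \<open>V\<close> of \<open>x, y, z\<close> to the socle and a functional \<open>\<theta>\<close> on \<open>M/JM\<close>, the map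
  \<open>(v, n) \<mapsto> \<theta>(n) \<eta>(v)\<close> is a \<open>1\<close>-cocycle with values in \<open>\<Lambda>\<close>. As it is a coboundary, \<open>- \<eta>\<close> agrees with a
  right multiplication by an element of \<open>V\<close> on all \<open>v\<close> with \<open>v m \<in> J\<^sup>2m\<close>. The space of these \<open>v\<close> is
  nonzero, because \<open>dim M \<le> 3\<close>, and it is a line, because there are only three coordinates to
  choose in \<open>V\<close> while a plane imposes four conditions (\<open>Ext1_relations_proportional\<close>). Counting dimensions
  again, \<open>M\<close> is generated by \<open>m\<close> and is an \<open>M(a,b,c)\<close> (\<open>Ext1_structure\<close>). Explicit maps from \<open>U(a,b,c)\<close> to
  \<open>\<Lambda>\<close> show that \<open>a \<noteq> 0\<close> and \<open>a + b \<noteq> 0\<close> (\<open>Ext1_M_nonzero\<close>), so \<open>a = 1\<close> may be assumed. By the formulas above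
  \<open>M(1,b,c)\<close> is reflexive unless \<open>b\<close> is \<open>-q\<close> or \<open>-q\<^sup>2\<close> (\<open>reflexive_M\<close>), and in the second case
  \<open>Ext\<^sup>1(M\<^sup>*,\<Lambda>) \<noteq> 0\<close> (\<open>Ext1_dual_exceptional\<close>).
\<close>

section \<open>Linear maps\<close>

lemma lin_maps_closed:
  "f \<in> lin_maps R M N \<Longrightarrow> x \<in> carrier M \<Longrightarrow> f x \<in> carrier N"
  by (auto simp: lin_maps_def)

lemma lin_maps_add:
  "f \<in> lin_maps R M N \<Longrightarrow> x \<in> carrier M \<Longrightarrow> y \<in> carrier M \<Longrightarrow>
    f (x \<oplus>\<^bsub>M\<^esub> y) = f x \<oplus>\<^bsub>N\<^esub> f y"
  by (auto simp: lin_maps_def)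

lemma lin_maps_smult:
  "f \<in> lin_maps R M N \<Longrightarrow> r \<in> carrier R \<Longrightarrow> x \<in> carrier M \<Longrightarrow>
    f (r \<odot>\<^bsub>M\<^esub> x) = r \<odot>\<^bsub>N\<^esub> f x"
  by (auto simp: lin_maps_def)

lemma lin_maps_zero:
  assumes "left_module R M" "left_module R N" "f \<in> lin_maps R M N"
  shows "f \<zero>\<^bsub>M\<^esub> = \<zero>\<^bsub>N\<^esub>"
proof -
  interpret M: left_module R M by fact
  interpret N: left_module R N by fact
  have "f (\<zero>\<^bsub>R\<^esub> \<odot>\<^bsub>M\<^esub> \<zero>\<^bsub>M\<^esub>) = \<zero>\<^bsub>R\<^esub> \<odot>\<^bsub>N\<^esub> f \<zero>\<^bsub>M\<^esub>"
    using assms(3) by (intro lin_maps_smult) auto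
  then show ?thesis
    using lin_maps_closed[OF assms(3)] by (simp add: left_module_zero_smult[OF assms(1)]
        left_module_zero_smult[OF assms(2)])
qed

lemma lin_maps_uminus:
  assumes "left_module R M" "left_module R N" "f \<in> lin_maps R M N" "x \<in> carrier M"
  shows "f (\<ominus>\<^bsub>M\<^esub> x) = \<ominus>\<^bsub>N\<^esub> f x"
proof -
  interpret M: left_module R M by fact
  interpret N: left_module R N by fact
  have "f (\<ominus>\<^bsub>M\<^esub> x) \<oplus>\<^bsub>N\<^esub> f x = \<zero>\<^bsub>N\<^esub>"
    using lin_maps_add[OF assms(3), of "\<ominus>\<^bsub>M\<^esub> x" x] lin_maps_zero[OF assms(1-3)] assms(4)
    by (simp add: M.M.l_neg)
  then show ?thesis
    using lin_maps_closed[OF assms(3)] assms(4)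
    by (metis M.M.a_inv_closed N.M.minus_equality)
qed

lemma lin_maps_minus:
  assumes "left_module R M" "left_module R N" "f \<in> lin_maps R M N"
    and "x \<in> carrier M" "y \<in> carrier M"
  shows "f (x \<ominus>\<^bsub>M\<^esub> y) = f x \<ominus>\<^bsub>N\<^esub> f y"
proof -
  interpret M: left_module R M by fact
  show ?thesis
    using lin_maps_add[OF assms(3,4)] lin_maps_uminus[OF assms(1-3,5)] assms(5)
    by (simp add: a_minus_def)
qed

lemma lin_mapsI:
  assumes "\<And>x. x \<in> carrier M \<Longrightarrow> f x \<in> carrier N"
    and "\<And>x y. x \<in> carrier M \<Longrightarrow> y \<in> carrier M \<Longrightarrow> f (x \<oplus>\<^bsub>M\<^esub> y) = f x \<oplus>\<^bsub>N\<^esub> f y"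
    and "\<And>r x. r \<in> carrier R \<Longrightarrow> x \<in> carrier M \<Longrightarrow> f (r \<odot>\<^bsub>M\<^esub> x) = r \<odot>\<^bsub>N\<^esub> f x"
    and "left_module R M"
  shows "(\<lambda>x\<in>carrier M. f x) \<in> lin_maps R M N"
proof -
  interpret M: left_module R M by fact
  show ?thesis
    using assms(1-3) by (auto simp: lin_maps_def)
qed

lemma lin_maps_compose:
  assumes "left_module R M" "f \<in> lin_maps R M N" "g \<in> lin_maps R N P"
  shows "(\<lambda>x\<in>carrier M. g (f x)) \<in> lin_maps R M P"
proof -
  note f = lin_maps_closed[OF assms(2)] lin_maps_add[OF assms(2)] lin_maps_smult[OF assms(2)]
  note g = lin_maps_closed[OF assms(3)] lin_maps_add[OF assms(3)] lin_maps_smult[OF assms(3)]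
  show ?thesis
    by (rule lin_mapsI[OF _ _ _ assms(1)]) (simp_all add: f g)
qed

lemma left_module_smult_uminus:
  assumes "left_module R M" "r \<in> carrier R" "x \<in> carrier M"
  shows "r \<odot>\<^bsub>M\<^esub> (\<ominus>\<^bsub>M\<^esub> x) = \<ominus>\<^bsub>M\<^esub> (r \<odot>\<^bsub>M\<^esub> x)"
proof -
  interpret left_module R M by fact
  have "r \<odot>\<^bsub>M\<^esub> (\<ominus>\<^bsub>M\<^esub> x) \<oplus>\<^bsub>M\<^esub> r \<odot>\<^bsub>M\<^esub> x = \<zero>\<^bsub>M\<^esub>"
    using smult_r_distr[of r "\<ominus>\<^bsub>M\<^esub> x" x] assms
    by (simp add: M.l_neg left_module_smult_zero[OF assms(1)])
  then show ?thesis
    using assms by (metis M.a_inv_closed M.minus_equality smult_closed)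
qed

lemma lin_maps_diff:
  assumes "left_module R M" "left_module R N" "f \<in> lin_maps R M N" "g \<in> lin_maps R M N"
  shows "(\<lambda>x\<in>carrier M. f x \<ominus>\<^bsub>N\<^esub> g x) \<in> lin_maps R M N"
proof -
  interpret M: left_module R M by fact
  interpret N: left_module R N by fact
  note cl = lin_maps_closed[OF assms(3)] lin_maps_closed[OF assms(4)]
  show ?thesis
  proof (rule lin_mapsI[OF _ _ _ assms(1)])
    fix x y assume x: "x \<in> carrier M" and y: "y \<in> carrier M"
    show "f (x \<oplus>\<^bsub>M\<^esub> y) \<ominus>\<^bsub>N\<^esub> g (x \<oplus>\<^bsub>M\<^esub> y) = (f x \<ominus>\<^bsub>N\<^esub> g x) \<oplus>\<^bsub>N\<^esub> (f y \<ominus>\<^bsub>N\<^esub> g y)"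
      using x y cl
      by (simp add: lin_maps_add[OF assms(3)] lin_maps_add[OF assms(4)] a_minus_def
          N.M.minus_add N.M.a_ac)
  next
    fix r x assume r: "r \<in> carrier R" and x: "x \<in> carrier M"
    show "f (r \<odot>\<^bsub>M\<^esub> x) \<ominus>\<^bsub>N\<^esub> g (r \<odot>\<^bsub>M\<^esub> x) = r \<odot>\<^bsub>N\<^esub> (f x \<ominus>\<^bsub>N\<^esub> g x)"
      using r x cl
      by (simp add: lin_maps_smult[OF assms(3)] lin_maps_smult[OF assms(4)] a_minus_def
          N.smult_r_distr left_module_smult_uminus[OF assms(2)])
  qed (simp add: cl)
qed

lemma lin_maps_restrict:
  assumes "left_module R M" "submodule K R M" "f \<in> lin_maps R M N"
  shows "restrict f K \<in> lin_maps R (M\<lparr>carrier := K\<rparr>) N"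
proof -
  interpret M: left_module R "M\<lparr>carrier := K\<rparr>"
    by (rule left_module_submodule[OF assms(1,2)])
  interpret K: submodule K R M by fact
  have "K \<subseteq> carrier M" using K.subset by simp
  then have "(\<lambda>x\<in>carrier (M\<lparr>carrier := K\<rparr>). f x) \<in> lin_maps R (M\<lparr>carrier := K\<rparr>) N"
    by (intro lin_mapsI M.left_module_axioms)
      (simp_all add: subset_iff lin_maps_closed[OF assms(3)] lin_maps_add[OF assms(3)]
        lin_maps_smult[OF assms(3)])
  then show ?thesis by simp
qed

section \<open>Lifting maps along surjections\<close>

abbreviation ker :: "('a, 'm) module \<Rightarrow> ('m \<Rightarrow> 'n) \<Rightarrow> ('a, 'n) module \<Rightarrow> 'm set" where
  "ker F p N \<equiv> {u \<in> carrier F. p u = \<zero>\<^bsub>N\<^esub>}"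

definition epi :: "'a ring \<Rightarrow> ('a, 'f) module \<Rightarrow> ('f \<Rightarrow> 'm) \<Rightarrow> ('a, 'm) module \<Rightarrow> bool" where
  "epi R F p N \<longleftrightarrow> left_module R F \<and> left_module R N \<and> p \<in> lin_maps R F N \<and>
     p ` carrier F = carrier N"

definition lifts :: "'a ring \<Rightarrow> ('a, 'f) module \<Rightarrow> ('a, 'p) module \<Rightarrow> ('p \<Rightarrow> 'm) \<Rightarrow>
    ('a, 'm) module \<Rightarrow> bool" where
  "lifts R F P p N \<longleftrightarrow>
     (\<forall>f\<in>lin_maps R F N. \<exists>g\<in>lin_maps R F P. \<forall>x\<in>carrier F. p (g x) = f x)"

lemma liftsD:
  assumes "lifts R F P p N" "f \<in> lin_maps R F N"
  obtains g where "g \<in> lin_maps R F P" "\<And>x. x \<in> carrier F \<Longrightarrow> p (g x) = f x"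
  using assms unfolding lifts_def by blast

lemma free_module_ext:
  assumes "left_module R N" "f \<in> lin_maps R (free_module R I) N" "g \<in> lin_maps R (free_module R I) N"
    and agree: "\<And>j. j \<in> I \<Longrightarrow> f (\<lambda>i\<in>I. if i = j then \<one>\<^bsub>R\<^esub> else \<zero>\<^bsub>R\<^esub>)
                          = g (\<lambda>i\<in>I. if i = j then \<one>\<^bsub>R\<^esub> else \<zero>\<^bsub>R\<^esub>)"
    and "u \<in> carrier (free_module R I)"
  shows "f u = g u"
proof -
  interpret left_module R N by fact
  interpret F: left_module R "free_module R I" by (rule left_module_free) (rule R.ring_axioms)
  let ?b = "\<lambda>j. \<lambda>i\<in>I. if i = j then \<one>\<^bsub>R\<^esub> else \<zero>\<^bsub>R\<^esub>"
  have b: "?b j \<in> carrier (free_module R I)" for j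
  proof -
    have "{i\<in>I. ?b j i \<noteq> \<zero>\<^bsub>R\<^esub>} \<subseteq> {j}" by auto
    then show ?thesis by (auto simp: free_module_def intro: finite_subset)
  qed
  have "finite S \<Longrightarrow> S \<subseteq> I \<Longrightarrow> u \<in> carrier (free_module R I) \<Longrightarrow>
      {i\<in>I. u i \<noteq> \<zero>\<^bsub>R\<^esub>} \<subseteq> S \<Longrightarrow> f u = g u" for S u
  proof (induction S arbitrary: u rule: finite_induct)
    case empty
    then have "u = \<zero>\<^bsub>free_module R I\<^esub>"
      by (auto simp: free_module_def PiE_iff extensional_def fun_eq_iff)
    then show ?case
      using lin_maps_zero[OF F.left_module_axioms assms(1)] assms(2,3) by metis
  next
    case (insert j S)
    let ?v = "\<lambda>i\<in>I. if i = j then \<zero>\<^bsub>R\<^esub> else u i"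
    have uI: "u i \<in> carrier R" if "i \<in> I" for i
      using insert.prems that by (auto simp: free_module_def)
    have "{i\<in>I. ?v i \<noteq> \<zero>\<^bsub>R\<^esub>} \<subseteq> S" using insert.prems by auto
    moreover from this have v: "?v \<in> carrier (free_module R I)"
      using insert.prems insert.hyps uI finite_subset[of _ S] by (auto simp: free_module_def)
    ultimately have fg: "f ?v = g ?v"
      using insert by blast
    have j: "j \<in> I" using insert.prems by auto
    have ju: "u j \<odot>\<^bsub>free_module R I\<^esub> ?b j \<in> carrier (free_module R I)"
      by (intro F.smult_closed uI j b)
    have u: "u = ?v \<oplus>\<^bsub>free_module R I\<^esub> (u j \<odot>\<^bsub>free_module R I\<^esub> ?b j)"
    proof
      fix i
      show "u i = (?v \<oplus>\<^bsub>free_module R I\<^esub> (u j \<odot>\<^bsub>free_module R I\<^esub> ?b j)) i"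
        using insert.prems uI by (cases "i \<in> I") (auto simp: free_module_def)
    qed
    have "f (?v \<oplus>\<^bsub>free_module R I\<^esub> (u j \<odot>\<^bsub>free_module R I\<^esub> ?b j))
        = g (?v \<oplus>\<^bsub>free_module R I\<^esub> (u j \<odot>\<^bsub>free_module R I\<^esub> ?b j))"
      using lin_maps_add[OF assms(2) v ju] lin_maps_add[OF assms(3) v ju] fg agree[OF j]
        lin_maps_smult[OF assms(2) uI[OF j] b] lin_maps_smult[OF assms(3) uI[OF j] b] by simp
    then show ?case using u by argo
  qed
  then show ?thesis using assms(5) by (auto simp: free_module_def)
qed

lemma lifts_free:
  assumes "epi R P p N"
  shows "lifts R (free_module R I) P p N"
  unfolding lifts_def
proof
  fix f assume f: "f \<in> lin_maps R (free_module R I) N"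
  interpret P: left_module R P using assms by (simp add: epi_def)
  interpret N: left_module R N using assms by (simp add: epi_def)
  have F: "left_module R (free_module R I)" by (rule left_module_free) (rule P.R.ring_axioms)
  have p: "p \<in> lin_maps R P N" using assms by (simp add: epi_def)
  let ?b = "\<lambda>j. \<lambda>i\<in>I. if i = j then \<one>\<^bsub>R\<^esub> else \<zero>\<^bsub>R\<^esub>"
  define y where "y j = inv_into (carrier P) p (f (?b j))" for j
  have b: "?b j \<in> carrier (free_module R I)" if "j \<in> I" for j
    using free_lift_basis(1)[OF P.left_module_axioms, of "\<lambda>_. \<zero>\<^bsub>P\<^esub>" I j] that by auto
  have y: "y j \<in> carrier P" "p (y j) = f (?b j)" if "j \<in> I" for j
    using lin_maps_closed[OF f b[OF that]] assms
    by (auto simp: y_def epi_def inv_into_into f_inv_into_f)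
  then have yP: "y \<in> I \<rightarrow> carrier P" by auto
  define g where "g = free_lift R P I y"
  have g: "g \<in> lin_maps R (free_module R I) P"
    unfolding g_def by (rule free_lift_linear[OF P.left_module_axioms yP])
  have "p (g x) = f x" if x: "x \<in> carrier (free_module R I)" for x
  proof -
    have "(\<lambda>x\<in>carrier (free_module R I). p (g x)) x = f x"
      by (rule free_module_ext[OF N.left_module_axioms lin_maps_compose[OF F g p] f _ x])
        (use b y free_lift_basis(2)[OF P.left_module_axioms yP] in \<open>simp add: g_def\<close>)
    then show ?thesis using x by simp
  qed
  with g show "\<exists>g\<in>lin_maps R (free_module R I) P. \<forall>x\<in>carrier (free_module R I). p (g x) = f x"
    by blast
qed

lemma regular_simps [simp]:
  "carrier (regular_module R) = carrier R" "add (regular_module R) = add R"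
  "zero (regular_module R) = zero R" "smult (regular_module R) = mult R"
  by (simp_all add: regular_module_def)

lemma lin_maps_regular:
  assumes "left_module R P" "y \<in> carrier P"
  shows "(\<lambda>r\<in>carrier R. r \<odot>\<^bsub>P\<^esub> y) \<in> lin_maps R (regular_module R) P"
proof -
  interpret P: left_module R P by fact
  show ?thesis
    using lin_mapsI[OF _ _ _ left_module_regular[OF P.R.ring_axioms], of "\<lambda>r. r \<odot>\<^bsub>P\<^esub> y" P] assms(2)
    by (simp add: P.smult_l_distr P.smult_assoc1)
qed

lemma lin_maps_regular_eq:
  assumes "ring R" "f \<in> lin_maps R (regular_module R) P" "r \<in> carrier R"
  shows "f r = r \<odot>\<^bsub>P\<^esub> f \<one>\<^bsub>R\<^esub>"
proof -
  interpret ring R by fact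
  show ?thesis using lin_maps_smult[OF assms(2,3), of "\<one>\<^bsub>R\<^esub>"] assms(3) by simp
qed

lemma lifts_regular:
  assumes "epi R P p N"
  shows "lifts R (regular_module R) P p N"
  unfolding lifts_def
proof
  fix f assume f: "f \<in> lin_maps R (regular_module R) N"
  interpret P: left_module R P using assms by (simp add: epi_def)
  have p: "p \<in> lin_maps R P N" using assms by (simp add: epi_def)
  have "f \<one>\<^bsub>R\<^esub> \<in> p ` carrier P"
    using lin_maps_closed[OF f, of "\<one>\<^bsub>R\<^esub>"] assms by (simp add: epi_def)
  then obtain y where y: "y \<in> carrier P" "p y = f \<one>\<^bsub>R\<^esub>" by auto
  show "\<exists>g\<in>lin_maps R (regular_module R) P. \<forall>x\<in>carrier (regular_module R). p (g x) = f x"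
  proof (rule bexI[OF _ lin_maps_regular[OF P.left_module_axioms y(1)]], rule ballI)
    fix r assume "r \<in> carrier (regular_module R)"
    then have r: "r \<in> carrier R" by simp
    show "p ((\<lambda>r\<in>carrier R. r \<odot>\<^bsub>P\<^esub> y) r) = f r"
      using r y lin_maps_smult[OF p r y(1)] lin_maps_regular_eq[OF P.R.ring_axioms f r] by simp
  qed
qed

section \<open>Syzygies and stable retracts\<close>

definition hom_extends :: "'a ring \<Rightarrow> ('a, 'f) module \<Rightarrow> 'f set \<Rightarrow> ('a, 'l) module \<Rightarrow> bool" where
  "hom_extends R F K L \<longleftrightarrow>
     (\<forall>f\<in>lin_maps R (F\<lparr>carrier := K\<rparr>) L. \<exists>g\<in>lin_maps R F L. \<forall>x\<in>K. g x = f x)"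

text \<open>\<open>K\<close> is a direct summand of \<open>L\<close> up to maps that factor through \<open>Q\<close>.\<close>

definition stable_retract ::
    "'a ring \<Rightarrow> ('a, 'q) module \<Rightarrow> ('a, 'm) module \<Rightarrow> ('a, 'n) module \<Rightarrow> bool" where
  "stable_retract R Q K L \<longleftrightarrow>
     (\<exists>a\<in>lin_maps R K L. \<exists>b\<in>lin_maps R L K. \<exists>f\<in>lin_maps R K Q. \<exists>g\<in>lin_maps R Q K.
        \<forall>x\<in>carrier K. b (a x) = x \<oplus>\<^bsub>K\<^esub> g (f x))"

text \<open>Lifting the maps of a stable retraction \<open>K \<rightarrow> L \<rightarrow> K\<close> to presentations \<open>F \<rightarrow> K\<close> and \<open>P \<rightarrow> L\<close> yields a
  stable retraction of the kernels, now up to maps through \<open>F\<close>. Iterated along two resolutions this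
  replaces the comparison theorem, and it transports the extension property that
  expresses the vanishing of \<open>Ext\<close> from one resolution to the other.\<close>

lemma stable_retract_syzygy:
  assumes FK: "epi R F p K" and PL: "epi R P p' L" and Q: "left_module R Q"
    and sr: "stable_retract R Q K L"
    and lift: "lifts R F P p' L" "lifts R P F p K" "lifts R Q F p K"
  shows "stable_retract R F (F\<lparr>carrier := ker F p K\<rparr>) (P\<lparr>carrier := ker P p' L\<rparr>)" (is ?stable)
    and "hom_extends R P (ker P p' L) X \<Longrightarrow> left_module R X \<Longrightarrow> hom_extends R F (ker F p K) X"
      (is "_ \<Longrightarrow> _ \<Longrightarrow> ?extends")
proof -
  have mods: "left_module R F" "left_module R P" "left_module R K" "left_module R L"
    and p: "p \<in> lin_maps R F K" and p': "p' \<in> lin_maps R P L"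
    using FK PL by (auto simp: epi_def)
  interpret F: left_module R F by fact
  interpret P: left_module R P by fact
  interpret K: left_module R K by fact
  interpret L: left_module R L by fact
  obtain a b f g where a: "a \<in> lin_maps R K L" and b: "b \<in> lin_maps R L K"
    and f: "f \<in> lin_maps R K Q" and g: "g \<in> lin_maps R Q K"
    and ba: "\<And>x. x \<in> carrier K \<Longrightarrow> b (a x) = x \<oplus>\<^bsub>K\<^esub> g (f x)"
    using sr unfolding stable_retract_def by blast
  obtain A where A: "A \<in> lin_maps R F P" and pA: "\<And>x. x \<in> carrier F \<Longrightarrow> p' (A x) = a (p x)"
    using liftsD[OF lift(1) lin_maps_compose[OF mods(1) p a]] by (metis restrict_apply')
  obtain B where B: "B \<in> lin_maps R P F" and pB: "\<And>x. x \<in> carrier P \<Longrightarrow> p (B x) = b (p' x)"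
    using liftsD[OF lift(2) lin_maps_compose[OF mods(2) p' b]] by (metis restrict_apply')
  obtain G where G: "G \<in> lin_maps R Q F" and pG: "\<And>x. x \<in> carrier Q \<Longrightarrow> p (G x) = g x"
    using liftsD[OF lift(3) g] by blast
  note cl [simp] = lin_maps_closed[OF A] lin_maps_closed[OF B] lin_maps_closed[OF G]
    lin_maps_closed[OF p] lin_maps_closed[OF p'] lin_maps_closed[OF f] lin_maps_closed[OF g]
    lin_maps_closed[OF a] lin_maps_closed[OF b]
  let ?KF = "ker F p K" and ?KP = "ker P p' L"
  have sK: "submodule ?KF R F" by (rule submodule_kernel[OF mods(1,3) p])
  have sP: "submodule ?KP R P" by (rule submodule_kernel[OF mods(2,4) p'])
  have mK: "left_module R (F\<lparr>carrier := ?KF\<rparr>)" by (rule left_module_submodule[OF mods(1) sK])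
  have mP: "left_module R (P\<lparr>carrier := ?KP\<rparr>)" by (rule left_module_submodule[OF mods(2) sP])
  \<comment> \<open>The deviation of \<open>B \<circ> A\<close> from the identity, corrected by \<open>G \<circ> f \<circ> p\<close>, has values in the kernel.\<close>
  define BA where "BA = (\<lambda>x\<in>carrier F. B (A x))"
  define Gfp where "Gfp = (\<lambda>x\<in>carrier F. G ((\<lambda>x\<in>carrier F. f (p x)) x))"
  define one where "one = (\<lambda>x\<in>carrier F. x)"
  define h0 where "h0 = (\<lambda>x\<in>carrier F. BA x \<ominus>\<^bsub>F\<^esub> one x)"
  define h where "h = (\<lambda>x\<in>carrier F. h0 x \<ominus>\<^bsub>F\<^esub> Gfp x)"
  have BA: "BA \<in> lin_maps R F F" unfolding BA_def by (rule lin_maps_compose[OF mods(1) A B])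
  have Gfp: "Gfp \<in> lin_maps R F F" unfolding Gfp_def
    by (rule lin_maps_compose[OF mods(1) lin_maps_compose[OF mods(1) p f] G])
  have one: "one \<in> lin_maps R F F" unfolding one_def by (rule lin_mapsI) (auto simp: mods)
  have h0: "h0 \<in> lin_maps R F F" unfolding h0_def by (rule lin_maps_diff[OF mods(1,1) BA one])
  have h: "h \<in> lin_maps R F F" unfolding h_def by (rule lin_maps_diff[OF mods(1,1) h0 Gfp])
  have hker: "h x \<in> ?KF" if x: "x \<in> carrier F" for x
  proof -
    have "p (h x) = (p (BA x) \<ominus>\<^bsub>K\<^esub> p x) \<ominus>\<^bsub>K\<^esub> p (Gfp x)"
      using x lin_maps_closed[OF BA x] lin_maps_closed[OF Gfp x] lin_maps_closed[OF h0 x]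
      by (simp add: h_def h0_def one_def lin_maps_minus[OF mods(1,3) p])
    also have "\<dots> = (b (a (p x)) \<ominus>\<^bsub>K\<^esub> p x) \<ominus>\<^bsub>K\<^esub> g (f (p x))"
      using x by (simp add: BA_def Gfp_def pB pA pG)
    also have "\<dots> = \<zero>\<^bsub>K\<^esub>"
      using x ba[of "p x"]
      by (simp add: a_minus_def K.M.a_ac) (metis K.M.a_assoc K.M.a_inv_closed K.M.r_neg K.M.r_neg1 K.M.r_neg2 cl(4,6,7) K.M.add.m_closed)
    finally show ?thesis using lin_maps_closed[OF h x] by simp
  qed
  have hK: "h \<in> lin_maps R F (F\<lparr>carrier := ?KF\<rparr>)"
    using h hker by (auto simp: lin_maps_def PiE_iff)
  have BAh: "B (A x) = x \<oplus>\<^bsub>F\<^esub> h x" if x: "x \<in> ?KF" for x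
  proof -
    have "Gfp x = \<zero>\<^bsub>F\<^esub>"
      using x lin_maps_zero[OF mods(3) Q f] lin_maps_zero[OF Q mods(1) G] by (simp add: Gfp_def)
    then have "h x = B (A x) \<ominus>\<^bsub>F\<^esub> x" using x by (simp add: h_def h0_def BA_def one_def a_minus_def)
    then have "x \<oplus>\<^bsub>F\<^esub> h x = x \<oplus>\<^bsub>F\<^esub> (\<ominus>\<^bsub>F\<^esub> x \<oplus>\<^bsub>F\<^esub> B (A x))"
      using x F.M.a_comm[of "B (A x)" "\<ominus>\<^bsub>F\<^esub> x"] by (simp add: a_minus_def)
    then show ?thesis using x by (simp only: F.M.r_neg2 cl mem_Collect_eq)
  qed
  define a' where "a' = restrict A ?KF"
  define b' where "b' = restrict B ?KP"
  have ra: "A x \<in> ?KP" if "x \<in> ?KF" for x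
    using that pA[of x] lin_maps_zero[OF mods(3,4) a] by simp
  have rb: "B x \<in> ?KF" if "x \<in> ?KP" for x
    using that pB[of x] lin_maps_zero[OF mods(4,3) b] by simp
  have a': "a' \<in> lin_maps R (F\<lparr>carrier := ?KF\<rparr>) (P\<lparr>carrier := ?KP\<rparr>)"
    using lin_maps_restrict[OF mods(1) sK A] ra by (auto simp: a'_def lin_maps_def PiE_iff)
  have b': "b' \<in> lin_maps R (P\<lparr>carrier := ?KP\<rparr>) (F\<lparr>carrier := ?KF\<rparr>)"
    using lin_maps_restrict[OF mods(2) sP B] rb by (auto simp: b'_def lin_maps_def PiE_iff)
  have b'a': "b' (a' x) = x \<oplus>\<^bsub>F\<^esub> h x" if x: "x \<in> ?KF" for x
    using BAh[OF x] ra[OF x] x by (simp add: a'_def b'_def)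
  have incl: "restrict one ?KF \<in> lin_maps R (F\<lparr>carrier := ?KF\<rparr>) F"
    by (rule lin_maps_restrict[OF mods(1) sK one])
  show ?stable
    unfolding stable_retract_def
    by (rule bexI[OF _ a'], rule bexI[OF _ b'], rule bexI[OF _ incl], rule bexI[OF _ hK])
      (use b'a' in \<open>auto simp: one_def\<close>)
  show ?extends if ext: "hom_extends R P ?KP X" and X: "left_module R X"
    unfolding hom_extends_def
  proof
    interpret X: left_module R X by fact
    fix \<phi> assume \<phi>: "\<phi> \<in> lin_maps R (F\<lparr>carrier := ?KF\<rparr>) X"
    from lin_maps_compose[OF mP b' \<phi>] ext obtain \<psi> where \<psi>: "\<psi> \<in> lin_maps R P X"
      and eq: "\<And>x. x \<in> ?KP \<Longrightarrow> \<psi> x = \<phi> (b' x)"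
      unfolding hom_extends_def by fastforce
    let ?g1 = "\<lambda>x\<in>carrier F. \<psi> (A x)" and ?g2 = "\<lambda>x\<in>carrier F. \<phi> (h x)"
    show "\<exists>g\<in>lin_maps R F X. \<forall>x\<in>?KF. g x = \<phi> x"
    proof (rule bexI[OF _ lin_maps_diff[OF mods(1) X lin_maps_compose[OF mods(1) A \<psi>]
              lin_maps_compose[OF mods(1) hK \<phi>]]], rule ballI)
      fix x assume x: "x \<in> ?KF"
      have "\<psi> (A x) = \<phi> (x \<oplus>\<^bsub>F\<^esub> h x)"
        using eq[OF ra[OF x]] b'a'[OF x] x by (simp add: a'_def)
      also have "\<dots> = \<phi> x \<oplus>\<^bsub>X\<^esub> \<phi> (h x)"
        using lin_maps_add[OF \<phi>, of x "h x"] x hker[of x] by simp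
      finally have "\<psi> (A x) = \<phi> x \<oplus>\<^bsub>X\<^esub> \<phi> (h x)" .
      moreover have "\<phi> x \<in> carrier X" "\<phi> (h x) \<in> carrier X"
        using lin_maps_closed[OF \<phi>, of x] lin_maps_closed[OF \<phi>, of "h x"] x hker[of x] by auto
      ultimately show "(\<lambda>x\<in>carrier F. ?g1 x \<ominus>\<^bsub>X\<^esub> ?g2 x) x = \<phi> x"
        using x by (simp add: a_minus_def X.M.a_assoc X.M.r_neg)
    qed
  qed
qed

lemma hom_extendsD:
  assumes "hom_extends R F K L" "f \<in> lin_maps R (F\<lparr>carrier := K\<rparr>) L"
  obtains g where "g \<in> lin_maps R F L" "\<And>x. x \<in> K \<Longrightarrow> g x = f x"
  using assms unfolding hom_extends_def by blast

lemma epi_factor: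
  assumes "epi R F p N" "left_module R L" "f \<in> lin_maps R F L"
    and "\<And>u. u \<in> ker F p N \<Longrightarrow> f u = \<zero>\<^bsub>L\<^esub>"
  obtains g where "g \<in> lin_maps R N L" "\<And>u. u \<in> carrier F \<Longrightarrow> g (p u) = f u"
proof -
  have F: "left_module R F" and N: "left_module R N" and p: "p \<in> lin_maps R F N"
    and surj: "p ` carrier F = carrier N" using assms(1) by (auto simp: epi_def)
  interpret F: left_module R F by fact
  interpret N: left_module R N by fact
  interpret L: left_module R L by fact
  define j where "j = inv_into (carrier F) p"
  have j: "j x \<in> carrier F" "p (j x) = x" if "x \<in> carrier N" for x
    using that surj by (simp_all add: j_def inv_into_into f_inv_into_f)
  have fib: "f u = f v" if "u \<in> carrier F" "v \<in> carrier F" "p u = p v" for u v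
  proof -
    have "p (u \<ominus>\<^bsub>F\<^esub> v) = \<zero>\<^bsub>N\<^esub>"
      using that lin_maps_minus[OF F N p, of u v] lin_maps_closed[OF p]
      by (simp add: a_minus_def N.M.r_neg)
    then have "f u \<ominus>\<^bsub>L\<^esub> f v = \<zero>\<^bsub>L\<^esub>"
      using that assms(4)[of "u \<ominus>\<^bsub>F\<^esub> v"] lin_maps_minus[OF F assms(2,3), of u v] by simp
    then show ?thesis
      using that lin_maps_closed[OF assms(3)] by (simp add: a_minus_def L.M.minus_equality L.M.r_neg)
        (metis L.M.a_inv_closed L.M.minus_equality L.M.minus_minus)
  qed
  define g where "g = (\<lambda>x\<in>carrier N. f (j x))"
  have gp: "g (p u) = f u" if u: "u \<in> carrier F" for u
    using u lin_maps_closed[OF p u] j[of "p u"] fib[of "j (p u)" u] by (simp add: g_def)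
  have "g \<in> lin_maps R N L"
    unfolding g_def
  proof (rule lin_mapsI[OF _ _ _ N])
    show "f (j x) \<in> carrier L" if "x \<in> carrier N" for x
      using lin_maps_closed[OF assms(3)] j that by simp
    show "f (j (x \<oplus>\<^bsub>N\<^esub> y)) = f (j x) \<oplus>\<^bsub>L\<^esub> f (j y)" if "x \<in> carrier N" "y \<in> carrier N" for x y
      using that j lin_maps_add[OF assms(3), of "j x" "j y"] lin_maps_add[OF p, of "j x" "j y"]
        fib[of "j (x \<oplus>\<^bsub>N\<^esub> y)" "j x \<oplus>\<^bsub>F\<^esub> j y"] by simp
    show "f (j (r \<odot>\<^bsub>N\<^esub> x)) = r \<odot>\<^bsub>L\<^esub> f (j x)" if "r \<in> carrier R" "x \<in> carrier N" for r x
      using that j lin_maps_smult[OF assms(3), of r "j x"] lin_maps_smult[OF p, of r "j x"]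
        fib[of "j (r \<odot>\<^bsub>N\<^esub> x)" "r \<odot>\<^bsub>F\<^esub> j x"] by simp
  qed
  with gp show ?thesis by (rule that[rotated])
qed

section \<open>Vanishing of Ext as an extension property\<close>

lemma trivial_Mod_iff:
  fixes L :: "('a, 'l) module"
  assumes F: "left_module R F" and L: "left_module R L"
    and Z: "Z \<subseteq> lin_maps R F L"
    and Zadd: "\<And>f g. f \<in> Z \<Longrightarrow> g \<in> Z \<Longrightarrow> (\<lambda>x\<in>carrier F. f x \<oplus>\<^bsub>L\<^esub> g x) \<in> Z"
    and Zneg: "\<And>f. f \<in> Z \<Longrightarrow> (\<lambda>x\<in>carrier F. \<ominus>\<^bsub>L\<^esub> f x) \<in> Z"
    and B0: "(\<lambda>x\<in>carrier F. \<zero>\<^bsub>L\<^esub>) \<in> B" and BZ: "B \<subseteq> Z"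
  shows "trivial_group ((hom_group R F L)\<lparr>carrier := Z\<rparr> Mod B) \<longleftrightarrow> Z = B"
proof -
  interpret F: left_module R F by fact
  interpret L: left_module R L by fact
  define G where "G = (hom_group R F L)\<lparr>carrier := Z\<rparr>"
  have simps: "carrier G = Z" "f \<otimes>\<^bsub>G\<^esub> g = (\<lambda>x\<in>carrier F. f x \<oplus>\<^bsub>L\<^esub> g x)"
    "\<one>\<^bsub>G\<^esub> = (\<lambda>x\<in>carrier F. \<zero>\<^bsub>L\<^esub>)" for f g
    by (simp_all add: G_def hom_group_def)
  have ZE: "f \<in> carrier F \<rightarrow>\<^sub>E carrier L" if "f \<in> Z" for f
    using that Z by (auto simp: lin_maps_def)
  have cl: "f x \<in> carrier L" if "f \<in> Z" "x \<in> carrier F" for f x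
    using that Z by (auto simp: lin_maps_def)
  have one: "(\<lambda>x\<in>carrier F. \<zero>\<^bsub>L\<^esub> \<oplus>\<^bsub>L\<^esub> f x) = f" if "f \<in> Z" for f
    using ZE[OF that] by (auto simp: PiE_iff extensional_def fun_eq_iff)
  have G: "comm_group G"
  proof (rule comm_groupI)
    fix f assume f: "f \<in> carrier G"
    then show "\<exists>g\<in>carrier G. g \<otimes>\<^bsub>G\<^esub> f = \<one>\<^bsub>G\<^esub>"
      using Zneg[of f] cl[of f]
      by (intro bexI[of _ "\<lambda>x\<in>carrier F. \<ominus>\<^bsub>L\<^esub> f x"]) (auto simp: simps L.M.l_neg intro!: restrict_ext)
  qed (use Zadd B0 BZ one cl in \<open>auto simp: simps L.M.a_ac cong: restrict_cong intro!: restrict_ext\<close>)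
  interpret G: comm_group G by fact
  have "trivial_group (G Mod B) \<longleftrightarrow> Z = B"
  proof
    assume "trivial_group (G Mod B)"
    then have coset: "B #>\<^bsub>G\<^esub> f = B" if "f \<in> Z" for f
      using that by (auto simp: trivial_group_def FactGroup_def RCOSETS_def simps)
    have "f \<in> B" if f: "f \<in> Z" for f
    proof -
      have "\<one>\<^bsub>G\<^esub> \<otimes>\<^bsub>G\<^esub> f \<in> B #>\<^bsub>G\<^esub> f" using B0 by (auto simp: r_coset_def simps(3))
      then show ?thesis using coset[OF f] G.l_one[of f] f by (simp add: simps(1))
    qed
    with BZ show "Z = B" by auto
  next
    assume "Z = B"
    then have B: "carrier G = B" by (simp add: simps)
    have "subgroup B G" using G.subgroup_self B by simp
    then have n: "B \<lhd> G" by (simp add: G.normal_iff_subgroup)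
    have "B #>\<^bsub>G\<^esub> f = B" if "f \<in> B" for f
      using that B \<open>subgroup B G\<close> by (intro G.coset_join2) auto
    then have "carrier (G Mod B) = {B}"
      using B B0 by (auto simp: FactGroup_def RCOSETS_def)
    then show "trivial_group (G Mod B)"
      using normal.factorgroup_is_group[OF n] by (simp add: trivial_group_def FactGroup_def)
  qed
  then show ?thesis by (simp add: G_def)
qed

lemma resolution_epi:
  assumes "left_module R N" "is_free_resolution R N I d e"
  shows "epi R (free_module R (I 0)) e N"
    and "d 0 ` carrier (free_module R (I (Suc 0))) = ker (free_module R (I 0)) e N"
    and "d (Suc n) ` carrier (free_module R (I (Suc (Suc n))))
      = ker (free_module R (I (Suc n))) (d n) (free_module R (I n))"
    and "left_module R ((free_module R (I n))\<lparr>carrier := d n ` carrier (free_module R (I (Suc n)))\<rparr>)"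
    and "epi R (free_module R (I (Suc n))) (d n)
      ((free_module R (I n))\<lparr>carrier := d n ` carrier (free_module R (I (Suc n)))\<rparr>)"
proof -
  interpret N: left_module R N by fact
  have F: "left_module R (free_module R J)" for J by (rule left_module_free) (rule N.R.ring_axioms)
  note res = assms(2)[unfolded is_free_resolution_def]
  have d: "d m \<in> lin_maps R (free_module R (I (Suc m))) (free_module R (I m))" for m
    using res by blast
  show e: "epi R (free_module R (I 0)) e N" using res F assms(1) by (simp add: epi_def)
  show k0: "d 0 ` carrier (free_module R (I (Suc 0))) = ker (free_module R (I 0)) e N"
    using res by simp
  have kS: "d (Suc n) ` carrier (free_module R (I (Suc (Suc n))))
      = ker (free_module R (I (Suc n))) (d n) (free_module R (I n))" for n
    using res by blast
  then show "d (Suc n) ` carrier (free_module R (I (Suc (Suc n))))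
      = ker (free_module R (I (Suc n))) (d n) (free_module R (I n))" .
  show L: "left_module R ((free_module R (I n))\<lparr>carrier := d n ` carrier (free_module R (I (Suc n)))\<rparr>)"
  proof (cases n)
    case 0
    have "submodule (ker (free_module R (I 0)) e N) R (free_module R (I 0))"
      using e F assms(1) by (intro submodule_kernel) (auto simp: epi_def)
    then show ?thesis using left_module_submodule[OF F] k0 0 by simp
  next
    case (Suc m)
    show ?thesis
      using left_module_submodule[OF F submodule_kernel[OF F F d[of m]]] kS[of m] Suc by simp
  qed
  have "d n \<in> lin_maps R (free_module R (I (Suc n)))
      ((free_module R (I n))\<lparr>carrier := d n ` carrier (free_module R (I (Suc n)))\<rparr>)"
    using d[of n] by (auto simp: lin_maps_def PiE_iff)
  with L show "epi R (free_module R (I (Suc n))) (d n)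
      ((free_module R (I n))\<lparr>carrier := d n ` carrier (free_module R (I (Suc n)))\<rparr>)"
    using F by (simp add: epi_def)
qed

text \<open>A cocycle of degree \<open>n + 1\<close> vanishes on the kernel of \<open>d n\<close>, hence is the same thing as a map
  on the image of \<open>d n\<close>; it is a coboundary iff that map extends to the whole free module.\<close>

lemma trivial_Ext_iff:
  assumes N: "left_module R N" and L: "left_module R L" and cr: "chosen_resolution R N = (I, d, e)"
  shows "trivial_group (Ext R (Suc n) N L) \<longleftrightarrow>
    hom_extends R (free_module R (I n)) (d n ` carrier (free_module R (I (Suc n)))) L"
proof -
  interpret N: left_module R N by fact
  interpret L: left_module R L by fact
  have res: "is_free_resolution R N I d e" by (rule chosen_resolution[OF N cr])
  have mF: "left_module R (free_module R J)" for J by (rule left_module_free) (rule N.R.ring_axioms)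
  define F where "F m = free_module R (I m)" for m
  have F: "left_module R (F m)" for m by (simp add: F_def mF)
  interpret F1: left_module R "F (Suc n)" by (rule F)
  define K where "K = d n ` carrier (F (Suc n))"
  have d: "d m \<in> lin_maps R (F (Suc m)) (F m)" for m
    using res by (simp add: is_free_resolution_def F_def)
  have img: "d (Suc n) ` carrier (F (Suc (Suc n))) = ker (F (Suc n)) (d n) (F n)"
    using resolution_epi(3)[OF N res] by (simp add: F_def)
  have K: "left_module R ((F n)\<lparr>carrier := K\<rparr>)"
    and epi: "epi R (F (Suc n)) (d n) ((F n)\<lparr>carrier := K\<rparr>)"
    using resolution_epi(4,5)[OF N res] by (simp_all add: F_def K_def)
  interpret K: left_module R "(F n)\<lparr>carrier := K\<rparr>" by fact
  define Z where "Z = cocycles R I d L (Suc n)"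
  define B where "B = coboundaries R I d L (Suc n)"
  have Z_iff: "f \<in> Z \<longleftrightarrow> f \<in> lin_maps R (F (Suc n)) L \<and> (\<forall>u\<in>ker (F (Suc n)) (d n) (F n). f u = \<zero>\<^bsub>L\<^esub>)"
    for f
    unfolding Z_def cocycles_def img[symmetric] by (auto simp: F_def)
  have B_eq: "B = (\<lambda>g. \<lambda>u\<in>carrier (F (Suc n)). g (d n u)) ` lin_maps R (F n) L"
    by (simp add: B_def coboundaries_def F_def)
  have zero: "(\<lambda>u\<in>carrier (F m). \<zero>\<^bsub>L\<^esub>) \<in> lin_maps R (F m) L" for m
    by (rule lin_mapsI[OF _ _ _ F]) (auto simp: left_module_smult_zero[OF L])
  have BZ: "B \<subseteq> Z"
  proof
    fix f assume "f \<in> B"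
    then obtain g where g: "g \<in> lin_maps R (F n) L" and f: "f = (\<lambda>u\<in>carrier (F (Suc n)). g (d n u))"
      by (auto simp: B_eq)
    then show "f \<in> Z"
      using lin_maps_compose[OF F d g] lin_maps_zero[OF F L g] by (auto simp: Z_iff)
  qed
  have "trivial_group (Ext R (Suc n) N L) \<longleftrightarrow> Z = B"
    unfolding Ext_def cr prod.case Z_def[symmetric] B_def[symmetric] F_def[symmetric]
  proof (rule trivial_Mod_iff[OF F L])
    show "Z \<subseteq> lin_maps R (F (Suc n)) L" by (auto simp: Z_iff)
    show "(\<lambda>x\<in>carrier (F (Suc n)). f x \<oplus>\<^bsub>L\<^esub> g x) \<in> Z" if "f \<in> Z" "g \<in> Z" for f g
    proof -
      have f: "f \<in> lin_maps R (F (Suc n)) L" and g: "g \<in> lin_maps R (F (Suc n)) L"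
        using that by (simp_all add: Z_iff)
      have "(\<lambda>x\<in>carrier (F (Suc n)). f x \<oplus>\<^bsub>L\<^esub> g x) \<in> lin_maps R (F (Suc n)) L"
        by (rule lin_mapsI[OF _ _ _ F])
          (simp_all add: lin_maps_closed[OF f] lin_maps_closed[OF g] lin_maps_add[OF f]
            lin_maps_add[OF g] lin_maps_smult[OF f] lin_maps_smult[OF g] L.smult_r_distr L.M.a_ac)
      then show ?thesis using that by (auto simp: Z_iff)
    qed
    show "(\<lambda>x\<in>carrier (F (Suc n)). \<ominus>\<^bsub>L\<^esub> f x) \<in> Z" if "f \<in> Z" for f
    proof -
      have f: "f \<in> lin_maps R (F (Suc n)) L" using that by (simp add: Z_iff)
      have "(\<lambda>x\<in>carrier (F (Suc n)). \<ominus>\<^bsub>L\<^esub> f x) \<in> lin_maps R (F (Suc n)) L"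
        by (rule lin_mapsI[OF _ _ _ F])
          (simp_all add: lin_maps_closed[OF f] lin_maps_add[OF f] lin_maps_smult[OF f]
            L.M.minus_add left_module_smult_uminus[OF L])
      then show ?thesis using that by (auto simp: Z_iff)
    qed
    show "(\<lambda>x\<in>carrier (F (Suc n)). \<zero>\<^bsub>L\<^esub>) \<in> B"
      unfolding B_eq
    proof (rule image_eqI[OF _ zero])
      show "(\<lambda>x\<in>carrier (F (Suc n)). \<zero>\<^bsub>L\<^esub>)
          = (\<lambda>u\<in>carrier (F (Suc n)). (\<lambda>u\<in>carrier (F n). \<zero>\<^bsub>L\<^esub>) (d n u))"
        by (rule restrict_ext) (simp add: lin_maps_closed[OF d])
    qed
  qed (rule BZ)
  also have "Z = B \<longleftrightarrow> hom_extends R (F n) K L"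
  proof
    assume ZB: "Z = B"
    show "hom_extends R (F n) K L"
      unfolding hom_extends_def
    proof
      fix f assume f: "f \<in> lin_maps R ((F n)\<lparr>carrier := K\<rparr>) L"
      have "d n \<in> lin_maps R (F (Suc n)) ((F n)\<lparr>carrier := K\<rparr>)" using epi by (simp add: epi_def)
      from lin_maps_compose[OF F this f]
      have "(\<lambda>u\<in>carrier (F (Suc n)). f (d n u)) \<in> Z"
        using lin_maps_zero[OF K L f] by (auto simp: Z_iff)
      then obtain g where g: "g \<in> lin_maps R (F n) L"
        and eq: "(\<lambda>u\<in>carrier (F (Suc n)). f (d n u)) = (\<lambda>u\<in>carrier (F (Suc n)). g (d n u))"
        unfolding ZB B_eq by blast
      have "g x = f x" if "x \<in> K" for x
        using that fun_cong[OF eq] by (auto simp: K_def) (metis restrict_apply')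
      with g show "\<exists>g\<in>lin_maps R (F n) L. \<forall>x\<in>K. g x = f x" by blast
    qed
  next
    assume ext: "hom_extends R (F n) K L"
    have "Z \<subseteq> B"
    proof
      fix f assume "f \<in> Z"
      then have f: "f \<in> lin_maps R (F (Suc n)) L"
        and f0: "\<And>u. u \<in> ker (F (Suc n)) (d n) ((F n)\<lparr>carrier := K\<rparr>) \<Longrightarrow> f u = \<zero>\<^bsub>L\<^esub>"
        by (simp_all add: Z_iff)
      obtain g where g: "g \<in> lin_maps R ((F n)\<lparr>carrier := K\<rparr>) L"
        and gd: "\<And>u. u \<in> carrier (F (Suc n)) \<Longrightarrow> g (d n u) = f u"
        using epi_factor[OF epi L f f0] by blast
      obtain h where h: "h \<in> lin_maps R (F n) L" and hg: "\<And>x. x \<in> K \<Longrightarrow> h x = g x"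
        using hom_extendsD[OF ext g] by blast
      have "f = restrict f (carrier (F (Suc n)))" using f by (auto simp: lin_maps_def)
      also have "\<dots> = (\<lambda>u\<in>carrier (F (Suc n)). h (d n u))"
        using gd hg by (intro restrict_ext) (simp add: K_def)
      finally have "f = (\<lambda>u\<in>carrier (F (Suc n)). h (d n u))" .
      then show "f \<in> B" unfolding B_eq using h by (rule image_eqI)
    qed
    with BZ show "Z = B" by blast
  qed
  finally show ?thesis by (simp add: F_def K_def)
qed

lemma semi_Gorenstein_projective_iff:
  assumes "left_module R N" "chosen_resolution R N = (I, d, e)"
  shows "semi_Gorenstein_projective R N \<longleftrightarrow> (\<forall>n. hom_extends R (free_module R (I n))
     (d n ` carrier (free_module R (I (Suc n)))) (regular_module R))"
proof -
  interpret N: left_module R N by fact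
  have "(\<forall>n\<ge>1. P n) \<longleftrightarrow> (\<forall>n. P (Suc n))" for P :: "nat \<Rightarrow> bool"
    using Suc_le_D by auto
  then show ?thesis
    unfolding semi_Gorenstein_projective_def
    by (simp only: trivial_Ext_iff[OF assms(1) left_module_regular[OF N.R.ring_axioms] assms(2)])
qed

section \<open>Cyclic modules\<close>

text \<open>Generator \<open>m\<close> and annihilator \<open>U\<close> determine a cyclic module up to isomorphism.\<close>

definition cyclic_on :: "'a ring \<Rightarrow> ('a, 'm) module \<Rightarrow> 'm \<Rightarrow> 'a set \<Rightarrow> bool" where
  "cyclic_on R N m U \<longleftrightarrow> left_module R N \<and> m \<in> carrier N \<and>
     carrier N = {r \<odot>\<^bsub>N\<^esub> m | r. r \<in> carrier R} \<and> U = {r \<in> carrier R. r \<odot>\<^bsub>N\<^esub> m = \<zero>\<^bsub>N\<^esub>}"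

lemma cyclic_on_epi:
  assumes "cyclic_on R N m U"
  shows "epi R (regular_module R) (\<lambda>r\<in>carrier R. r \<odot>\<^bsub>N\<^esub> m) N"
    and "ker (regular_module R) (\<lambda>r\<in>carrier R. r \<odot>\<^bsub>N\<^esub> m) N = U"
proof -
  interpret N: left_module R N using assms by (simp add: cyclic_on_def)
  define p where "p = (\<lambda>r\<in>carrier R. r \<odot>\<^bsub>N\<^esub> m)"
  have "p \<in> lin_maps R (regular_module R) N"
    unfolding p_def using assms unfolding cyclic_on_def by (blast intro: lin_maps_regular)
  moreover have "p ` carrier (regular_module R) = carrier N"
    using assms by (auto simp: p_def cyclic_on_def)
  ultimately show "epi R (regular_module R) (\<lambda>r\<in>carrier R. r \<odot>\<^bsub>N\<^esub> m) N"
    unfolding p_def[symmetric] epi_def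
    using left_module_regular[OF N.R.ring_axioms] N.left_module_axioms by blast
  show "ker (regular_module R) (\<lambda>r\<in>carrier R. r \<odot>\<^bsub>N\<^esub> m) N = U"
    using assms by (auto simp: cyclic_on_def)
qed

lemma stable_retract_refl:
  assumes "left_module R N" "left_module R Q"
  shows "stable_retract R Q N N"
proof -
  interpret N: left_module R N by fact
  interpret Q: left_module R Q by fact
  have one: "(\<lambda>x\<in>carrier N. x) \<in> lin_maps R N N" by (rule lin_mapsI) (auto simp: assms)
  have f: "(\<lambda>x\<in>carrier N. \<zero>\<^bsub>Q\<^esub>) \<in> lin_maps R N Q"
    by (rule lin_mapsI) (auto simp: assms left_module_smult_zero[OF assms(2)])
  have g: "(\<lambda>x\<in>carrier Q. \<zero>\<^bsub>N\<^esub>) \<in> lin_maps R Q N"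
    by (rule lin_mapsI) (auto simp: assms left_module_smult_zero[OF assms(1)])
  show ?thesis
    unfolding stable_retract_def
    by (rule bexI[OF _ one], rule bexI[OF _ one], rule bexI[OF _ f], rule bexI[OF _ g]) simp
qed

text \<open>The chosen resolution, with free modules on large index sets, is traded here for the presentation
  \<open>R \<rightarrow> N\<close> given by the generator.\<close>

lemma Ext1_cyclic:
  assumes "trivial_group (Ext R 1 N (regular_module R))" "cyclic_on R N m U"
  shows "hom_extends R (regular_module R) U (regular_module R)"
proof -
  interpret N: left_module R N using assms(2) by (simp add: cyclic_on_def)
  obtain I d e where cr: "chosen_resolution R N = (I, d, e)" by (cases "chosen_resolution R N")
  note res = chosen_resolution[OF N.left_module_axioms cr]
  have reg: "left_module R (regular_module R)" by (rule left_module_regular[OF N.R.ring_axioms])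
  note e = resolution_epi(1)[OF N.left_module_axioms res]
  note c = cyclic_on_epi[OF assms(2)]
  have "hom_extends R (free_module R (I 0)) (ker (free_module R (I 0)) e N) (regular_module R)"
    using assms(1) trivial_Ext_iff[OF N.left_module_axioms reg cr, of 0]
      resolution_epi(2)[OF N.left_module_axioms res] by simp
  from stable_retract_syzygy(2)[OF c(1) e reg stable_retract_refl[OF N.left_module_axioms reg]
      lifts_regular[OF e] lifts_free[OF c(1)] lifts_regular[OF c(1)] this reg]
  show ?thesis unfolding c(2) .
qed

text \<open>A map on \<open>R w\<close> is determined by the image \<open>t\<close> of \<open>w\<close>, and \<open>v w = 0\<close> forces \<open>v t = 0\<close>; it is a right
  multiplication iff \<open>t \<in> w R\<close>.\<close>

lemma hom_extends_principal:
  assumes "ring R" "w \<in> carrier R" "v \<in> carrier R" "v \<otimes>\<^bsub>R\<^esub> w = \<zero>\<^bsub>R\<^esub>"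
    and sub: "K = {s \<otimes>\<^bsub>R\<^esub> w | s. s \<in> carrier R}"
    and "\<And>t. t \<in> carrier R \<Longrightarrow> v \<otimes>\<^bsub>R\<^esub> t = \<zero>\<^bsub>R\<^esub> \<Longrightarrow> \<exists>s\<in>carrier R. t = w \<otimes>\<^bsub>R\<^esub> s"
    and K: "left_module R ((regular_module R)\<lparr>carrier := K\<rparr>)"
  shows "hom_extends R (regular_module R) K (regular_module R)"
  unfolding hom_extends_def
proof
  interpret ring R by fact
  have reg: "left_module R (regular_module R)" by (rule left_module_regular) fact
  fix f assume f: "f \<in> lin_maps R ((regular_module R)\<lparr>carrier := K\<rparr>) (regular_module R)"
  have w: "w \<in> K" unfolding sub using assms(2) by (auto intro!: exI[of _ "\<one>\<^bsub>R\<^esub>"])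
  have fs: "f (s \<otimes>\<^bsub>R\<^esub> w) = s \<otimes>\<^bsub>R\<^esub> f w" if "s \<in> carrier R" for s
    using lin_maps_smult[OF f that, of w] w by simp
  have fw: "f w \<in> carrier R" using lin_maps_closed[OF f] w by simp
  have "v \<otimes>\<^bsub>R\<^esub> f w = \<zero>\<^bsub>R\<^esub>"
    using fs[OF assms(3)] assms(4) lin_maps_zero[OF K reg f] by simp
  then obtain s where s: "s \<in> carrier R" "f w = w \<otimes>\<^bsub>R\<^esub> s" using assms(6) fw by blast
  have "(\<lambda>r\<in>carrier R. r \<otimes>\<^bsub>R\<^esub> s) x = f x" if "x \<in> K" for x
    using that s fs assms(2) by (auto simp: sub m_assoc)
  then show "\<exists>g\<in>lin_maps R (regular_module R) (regular_module R). \<forall>x\<in>K. g x = f x"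
    using lin_maps_regular[OF reg, of s] s by (intro bexI[of _ "\<lambda>r\<in>carrier R. r \<otimes>\<^bsub>R\<^esub> s"]) auto
qed

text \<open>The hypotheses make \<open>\<cdots> \<rightarrow> R \<rightarrow> R \<rightarrow> N\<close>, with right multiplications by the \<open>w n\<close> as
  differentials, a free resolution whose dual is exact in positive degrees.\<close>

theorem semi_Gorenstein_projective_cyclic:
  assumes cyc: "cyclic_on R N m {s \<otimes>\<^bsub>R\<^esub> w 0 | s. s \<in> carrier R}"
    and w: "\<And>n. w n \<in> carrier R"
    and ann: "\<And>n. {r \<in> carrier R. r \<otimes>\<^bsub>R\<^esub> w n = \<zero>\<^bsub>R\<^esub>} = {s \<otimes>\<^bsub>R\<^esub> w (Suc n) | s. s \<in> carrier R}"
    and ext: "\<And>n t. t \<in> carrier R \<Longrightarrow> w (Suc n) \<otimes>\<^bsub>R\<^esub> t = \<zero>\<^bsub>R\<^esub> \<Longrightarrow> \<exists>s\<in>carrier R. t = w n \<otimes>\<^bsub>R\<^esub> s"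
  shows "semi_Gorenstein_projective R N"
proof -
  interpret N: left_module R N using cyc by (simp add: cyclic_on_def)
  have R: "ring R" by (rule N.R.ring_axioms)
  have reg: "left_module R (regular_module R)" by (rule left_module_regular[OF R])
  have F: "left_module R (free_module R J)" for J by (rule left_module_free) (rule R)
  obtain I d e where cr: "chosen_resolution R N = (I, d, e)" by (cases "chosen_resolution R N")
  note res = chosen_resolution[OF N.left_module_axioms cr]
  let ?F = "\<lambda>n. free_module R (I n)"
  let ?K = "\<lambda>n. d n ` carrier (?F (Suc n))"
  let ?L = "\<lambda>n. {s \<otimes>\<^bsub>R\<^esub> w n | s. s \<in> carrier R}"
  let ?Lm = "\<lambda>n. (regular_module R)\<lparr>carrier := ?L n\<rparr>"
  note e = resolution_epi(1)[OF N.left_module_axioms res]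
  note K0 = resolution_epi(2)[OF N.left_module_axioms res]
  note KS = resolution_epi(3)[OF N.left_module_axioms res]
  note dn = resolution_epi(5)[OF N.left_module_axioms res]
  note c = cyclic_on_epi[OF cyc]
  have Lmod: "left_module R (?Lm n)" for n
  proof (cases n)
    case 0
    have "submodule (?L 0) R (regular_module R)"
      unfolding c(2)[symmetric] using c(1)
      by (intro submodule_kernel reg N.left_module_axioms) (simp only: epi_def)
    then show ?thesis using left_module_submodule[OF reg] 0 by simp
  next
    case (Suc n)
    have "ker (regular_module R) (\<lambda>r\<in>carrier R. r \<odot>\<^bsub>regular_module R\<^esub> w n) (regular_module R) = ?L (Suc n)"
      using ann[of n] by auto
    then have "submodule (?L (Suc n)) R (regular_module R)"
      using submodule_kernel[OF reg reg lin_maps_regular[OF reg, of "w n"]] w by simp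
    then show ?thesis using left_module_submodule[OF reg] Suc by simp
  qed
  have wL: "w n \<in> ?L n" for n
    using w[of n] by (intro CollectI exI[of _ "\<one>\<^bsub>R\<^esub>"]) simp
  have cycL: "cyclic_on R (?Lm n) (w n) (?L (Suc n))" for n
    unfolding ann[of n, symmetric] using Lmod[of n] wL[of n] by (simp add: cyclic_on_def)
  have vw: "w (Suc n) \<otimes>\<^bsub>R\<^esub> w n = \<zero>\<^bsub>R\<^esub>" for n
    using wL[of "Suc n"] unfolding ann[of n, symmetric] by simp
  have L: "hom_extends R (regular_module R) (?L n) (regular_module R)" for n
    by (rule hom_extends_principal[OF R w w vw refl ext Lmod])
  have "stable_retract R (?F n) ((?F n)\<lparr>carrier := ?K n\<rparr>) (?Lm n) \<and>
      hom_extends R (?F n) (?K n) (regular_module R)" for n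
  proof (induction n)
    case 0
    note syz = stable_retract_syzygy[OF e c(1) F[of "I 0"] stable_retract_refl[OF N.left_module_axioms F]
        lifts_free[OF c(1)] lifts_regular[OF e] lifts_free[OF e], unfolded c(2)]
    show ?case using syz(1) syz(2)[OF L reg] by (simp only: K0)
  next
    case (Suc n)
    have kd: "ker (?F (Suc n)) (d n) ((?F n)\<lparr>carrier := ?K n\<rparr>) = ?K (Suc n)"
      using KS[of n] by simp
    note cL = cyclic_on_epi[OF cycL[of n]]
    note syz = stable_retract_syzygy[OF dn cL(1) F[of "I n"] conjunct1[OF Suc.IH]
        lifts_free[OF cL(1)] lifts_regular[OF dn] lifts_free[OF dn], unfolded cL(2) kd]
    show ?case using syz(1) syz(2)[OF L reg] by simp
  qed
  then show ?thesis
    using semi_Gorenstein_projective_iff[OF N.left_module_axioms cr] by blast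
qed

text \<open>A \<open>1\<close>-cocycle \<open>c\<close> makes \<open>R \<times> M\<close> an extension of \<open>M\<close> by \<open>R\<close>, and \<open>s\<close> is the first component
  of a splitting.\<close>

lemma Ext1_cocycle:
  fixes M :: "('a, 'm) module"
  assumes triv: "trivial_group (Ext R 1 M (regular_module R))" and M: "left_module R M"
    and c: "\<And>r x. r \<in> carrier R \<Longrightarrow> x \<in> carrier M \<Longrightarrow> c r x \<in> carrier R"
    and c_addl: "\<And>r r' x. r \<in> carrier R \<Longrightarrow> r' \<in> carrier R \<Longrightarrow> x \<in> carrier M \<Longrightarrow>
        c (r \<oplus>\<^bsub>R\<^esub> r') x = c r x \<oplus>\<^bsub>R\<^esub> c r' x"
    and c_addr: "\<And>r x y. r \<in> carrier R \<Longrightarrow> x \<in> carrier M \<Longrightarrow> y \<in> carrier M \<Longrightarrow>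
        c r (x \<oplus>\<^bsub>M\<^esub> y) = c r x \<oplus>\<^bsub>R\<^esub> c r y"
    and c_mult: "\<And>r r' x. r \<in> carrier R \<Longrightarrow> r' \<in> carrier R \<Longrightarrow> x \<in> carrier M \<Longrightarrow>
        c (r \<otimes>\<^bsub>R\<^esub> r') x = r \<otimes>\<^bsub>R\<^esub> c r' x \<oplus>\<^bsub>R\<^esub> c r (r' \<odot>\<^bsub>M\<^esub> x)"
  obtains s where "\<And>x. x \<in> carrier M \<Longrightarrow> s x \<in> carrier R"
    "\<And>x y. x \<in> carrier M \<Longrightarrow> y \<in> carrier M \<Longrightarrow> s (x \<oplus>\<^bsub>M\<^esub> y) = s x \<oplus>\<^bsub>R\<^esub> s y"
    "\<And>r x. r \<in> carrier R \<Longrightarrow> x \<in> carrier M \<Longrightarrow>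
       s (r \<odot>\<^bsub>M\<^esub> x) = r \<otimes>\<^bsub>R\<^esub> s x \<oplus>\<^bsub>R\<^esub> c r x"
proof -
  interpret M: left_module R M by fact
  have R: "ring R" by (rule M.R.ring_axioms)
  have reg: "left_module R (regular_module R)" by (rule left_module_regular[OF R])
  have idem: "a = \<zero>\<^bsub>R\<^esub>" if "a \<in> carrier R" "a \<oplus>\<^bsub>R\<^esub> a = a" for a
    using M.R.add.r_cancel_one'[OF that(1,1)] that(2) by metis
  have c1: "c \<one>\<^bsub>R\<^esub> x = \<zero>\<^bsub>R\<^esub>" if x: "x \<in> carrier M" for x
    by (rule idem[OF c[OF M.R.one_closed x]])
      (use c_mult[OF M.R.one_closed M.R.one_closed x, symmetric] c[OF M.R.one_closed x] x in simp)
  have c0: "c r \<zero>\<^bsub>M\<^esub> = \<zero>\<^bsub>R\<^esub>" if r: "r \<in> carrier R" for r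
    by (rule idem[OF c[OF r M.M.zero_closed]])
      (use c_addr[OF r M.M.zero_closed M.M.zero_closed, symmetric] in simp)
  define E :: "('a, 'a \<times> 'm) module" where "E = \<lparr>carrier = carrier R \<times> carrier M,
      mult = undefined, one = undefined, zero = (\<zero>\<^bsub>R\<^esub>, \<zero>\<^bsub>M\<^esub>),
      add = (\<lambda>u v. (fst u \<oplus>\<^bsub>R\<^esub> fst v, snd u \<oplus>\<^bsub>M\<^esub> snd v)),
      smult = (\<lambda>r u. (r \<otimes>\<^bsub>R\<^esub> fst u \<oplus>\<^bsub>R\<^esub> c r (snd u), r \<odot>\<^bsub>M\<^esub> snd u))\<rparr>"
  have E: "left_module R E"
  proof (intro left_module.intro left_module_axioms.intro R)
    show "abelian_group E"
    proof (rule abelian_groupI)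
      fix u assume "u \<in> carrier E"
      then show "\<exists>v\<in>carrier E. v \<oplus>\<^bsub>E\<^esub> u = \<zero>\<^bsub>E\<^esub>"
        by (intro bexI[of _ "(\<ominus>\<^bsub>R\<^esub> fst u, \<ominus>\<^bsub>M\<^esub> snd u)"]) (auto simp: E_def M.R.l_neg M.M.l_neg)
    qed (auto simp: E_def M.R.a_ac M.M.a_ac)
  qed (auto simp: E_def c c1 c_addl c_addr c_mult M.R.l_distr M.R.r_distr M.R.a_ac M.R.m_assoc
      M.smult_l_distr M.smult_r_distr M.smult_assoc1)
  have proj: "restrict snd (carrier E) \<in> lin_maps R E M"
    by (rule lin_mapsI[OF _ _ _ E]) (auto simp: E_def)
  have "restrict snd (carrier E) ` carrier E = carrier M"
  proof
    show "carrier M \<subseteq> restrict snd (carrier E) ` carrier E"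
    proof
      fix x assume "x \<in> carrier M"
      then show "x \<in> restrict snd (carrier E) ` carrier E"
        by (intro image_eqI[of _ _ "(\<zero>\<^bsub>R\<^esub>, x)"]) (simp_all add: E_def)
    qed
  qed (auto simp: E_def)
  with proj E M have EM: "epi R E (restrict snd (carrier E)) M" by (simp add: epi_def)
  obtain I d e where cr: "chosen_resolution R M = (I, d, e)" by (cases "chosen_resolution R M")
  note res = chosen_resolution[OF M cr]
  let ?F = "free_module R (I 0)"
  have F: "left_module R ?F" by (rule left_module_free) (rule R)
  interpret F: left_module R ?F by fact
  note e = resolution_epi(1)[OF M res]
  have el: "e \<in> lin_maps R ?F M" and es: "e ` carrier ?F = carrier M" using e by (auto simp: epi_def)
  have ker: "hom_extends R ?F (ker ?F e M) (regular_module R)"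
    using triv trivial_Ext_iff[OF M reg cr, of 0] resolution_epi(2)[OF M res] by simp
  obtain g where g: "g \<in> lin_maps R ?F E"
    and ge: "\<And>u. u \<in> carrier ?F \<Longrightarrow> restrict snd (carrier E) (g u) = e u"
    using liftsD[OF lifts_free[OF EM] el] by blast
  have gE: "g u \<in> carrier E" and g2: "snd (g u) = e u" and g1: "fst (g u) \<in> carrier R"
    if "u \<in> carrier ?F" for u
    using that ge[of u] lin_maps_closed[OF g that] by (auto simp: E_def)
  have g_add: "fst (g (u \<oplus>\<^bsub>?F\<^esub> v)) = fst (g u) \<oplus>\<^bsub>R\<^esub> fst (g v)"
    if "u \<in> carrier ?F" "v \<in> carrier ?F" for u v
    using lin_maps_add[OF g that] by (simp add: E_def)
  have g_smult: "fst (g (r \<odot>\<^bsub>?F\<^esub> u)) = r \<otimes>\<^bsub>R\<^esub> fst (g u) \<oplus>\<^bsub>R\<^esub> c r (e u)"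
    if "r \<in> carrier R" "u \<in> carrier ?F" for r u
    using lin_maps_smult[OF g that] g2[OF that(2)] by (simp add: E_def)
  have sub: "submodule (ker ?F e M) R ?F" by (rule submodule_kernel[OF F M el])
  define g1 where "g1 = (\<lambda>u\<in>carrier (?F\<lparr>carrier := ker ?F e M\<rparr>). fst (g u))"
  have g1l: "g1 \<in> lin_maps R (?F\<lparr>carrier := ker ?F e M\<rparr>) (regular_module R)"
    unfolding g1_def
    by (rule lin_mapsI[OF _ _ _ left_module_submodule[OF F sub]]) (auto simp: g1 g_add g_smult c0)
  obtain h where h: "h \<in> lin_maps R ?F (regular_module R)"
    and hg1: "\<And>u. u \<in> ker ?F e M \<Longrightarrow> h u = g1 u"
    using hom_extendsD[OF ker g1l] by blast
  have hg: "h u = fst (g u)" if "u \<in> ker ?F e M" for u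
    using hg1[OF that] that by (simp add: g1_def)
  have hcl: "h u \<in> carrier R" if "u \<in> carrier ?F" for u using lin_maps_closed[OF h that] by simp
  have h_add: "h (u \<oplus>\<^bsub>?F\<^esub> v) = h u \<oplus>\<^bsub>R\<^esub> h v" if "u \<in> carrier ?F" "v \<in> carrier ?F" for u v
    using lin_maps_add[OF h that] by simp
  have h_smult: "h (r \<odot>\<^bsub>?F\<^esub> u) = r \<otimes>\<^bsub>R\<^esub> h u" if "r \<in> carrier R" "u \<in> carrier ?F" for r u
    using lin_maps_smult[OF h that] by simp
  define t where "t u = fst (g u) \<ominus>\<^bsub>R\<^esub> h u" for u
  have tcl: "t u \<in> carrier R" if "u \<in> carrier ?F" for u
    using g1[OF that] hcl[OF that] by (simp add: t_def)
  have t_add: "t (u \<oplus>\<^bsub>?F\<^esub> v) = t u \<oplus>\<^bsub>R\<^esub> t v" if "u \<in> carrier ?F" "v \<in> carrier ?F" for u v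
    using that g1 hcl by (simp add: t_def g_add h_add a_minus_def M.R.minus_add M.R.a_ac)
  have t_smult: "t (r \<odot>\<^bsub>?F\<^esub> u) = r \<otimes>\<^bsub>R\<^esub> t u \<oplus>\<^bsub>R\<^esub> c r (e u)"
    if "r \<in> carrier R" "u \<in> carrier ?F" for r u
    using that g1 hcl c[of r "e u"] lin_maps_closed[OF el]
    by (simp add: t_def g_smult h_smult a_minus_def M.R.r_distr M.R.r_minus M.R.a_ac)
  have t_ker: "t u = \<zero>\<^bsub>R\<^esub>" if "u \<in> ker ?F e M" for u
    using hg[OF that] g1 that by (simp add: t_def a_minus_def M.R.r_neg)
  have t_fib: "t u = t v" if "u \<in> carrier ?F" "v \<in> carrier ?F" "e u = e v" for u v
  proof -
    have "u \<ominus>\<^bsub>?F\<^esub> v \<in> ker ?F e M"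
      using that lin_maps_minus[OF F M el, of u v] lin_maps_closed[OF el]
      by (simp add: a_minus_def M.M.r_neg)
    then have "t (u \<ominus>\<^bsub>?F\<^esub> v \<oplus>\<^bsub>?F\<^esub> v) = t v"
      using t_ker[of "u \<ominus>\<^bsub>?F\<^esub> v"] t_add[of "u \<ominus>\<^bsub>?F\<^esub> v" v] that tcl by simp
    moreover have "u \<ominus>\<^bsub>?F\<^esub> v \<oplus>\<^bsub>?F\<^esub> v = u"
      using that by (simp add: a_minus_def F.M.a_assoc F.M.l_neg)
    ultimately show ?thesis by simp
  qed
  define j where "j = inv_into (carrier ?F) e"
  have j: "j x \<in> carrier ?F" "e (j x) = x" if "x \<in> carrier M" for x
    using that es by (simp_all add: j_def inv_into_into f_inv_into_f)
  show ?thesis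
  proof (rule that[of "\<lambda>x. t (j x)"])
    show "t (j x) \<in> carrier R" if "x \<in> carrier M" for x using j[OF that] tcl by simp
    show "t (j (x \<oplus>\<^bsub>M\<^esub> y)) = t (j x) \<oplus>\<^bsub>R\<^esub> t (j y)" if "x \<in> carrier M" "y \<in> carrier M" for x y
      using that j t_add[of "j x" "j y"] lin_maps_add[OF el, of "j x" "j y"]
        t_fib[of "j (x \<oplus>\<^bsub>M\<^esub> y)" "j x \<oplus>\<^bsub>?F\<^esub> j y"] by simp
    show "t (j (r \<odot>\<^bsub>M\<^esub> x)) = r \<otimes>\<^bsub>R\<^esub> t (j x) \<oplus>\<^bsub>R\<^esub> c r x" if "r \<in> carrier R" "x \<in> carrier M" for r x
      using that j t_smult[of r "j x"] lin_maps_smult[OF el, of r "j x"]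
        t_fib[of "j (r \<odot>\<^bsub>M\<^esub> x)" "r \<odot>\<^bsub>?F\<^esub> j x"] by simp
  qed
qed

section \<open>Coordinates on \<open>\<Lambda>(q)\<close>\<close>

text \<open>The elements \<open>a0 + a1 x + a2 y + a3 z + a4 yx + a5 zx\<close> of the free algebra represent the
  cosets of the ideal of relations uniquely.\<close>

definition nf :: "'k::field \<Rightarrow> 'k \<Rightarrow> 'k \<Rightarrow> 'k \<Rightarrow> 'k \<Rightarrow> 'k \<Rightarrow> gen list \<Rightarrow> 'k" where
  "nf a0 a1 a2 a3 a4 a5 = (\<lambda>w. if w = [] then a0 else if w = [Gx] then a1 else if w = [Gy] then a2
     else if w = [Gz] then a3 else if w = [Gy, Gx] then a4 else if w = [Gz, Gx] then a5 else 0)"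

definition lam :: "'k::field \<Rightarrow> 'k \<Rightarrow> 'k \<Rightarrow> 'k \<Rightarrow> 'k \<Rightarrow> 'k \<Rightarrow> 'k \<Rightarrow> (gen list \<Rightarrow> 'k) set" where
  "lam q a0 a1 a2 a3 a4 a5 = Lam_ideal q +>\<^bsub>free_algebra\<^esub> nf a0 a1 a2 a3 a4 a5"

text \<open>Reading the relations as rewriting rules \<open>xy \<rightarrow> -q yx\<close>, \<open>xz \<rightarrow> zx\<close>, \<open>zy \<rightarrow> zx\<close>, where the other words of
  length two besides \<open>yx\<close>, \<open>zx\<close> and all longer words become \<open>0\<close>.\<close>

definition reduce :: "'k::field \<Rightarrow> (gen list \<Rightarrow> 'k) \<Rightarrow> gen list \<Rightarrow> 'k" where
  "reduce q f = nf (f []) (f [Gx]) (f [Gy]) (f [Gz]) (f [Gy, Gx] - q * f [Gx, Gy])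
     (f [Gz, Gx] + f [Gx, Gz] + f [Gz, Gy])"

lemma fa_simps:
  "f \<oplus>\<^bsub>free_algebra\<^esub> g = (\<lambda>w. f w + g w)" "\<zero>\<^bsub>free_algebra\<^esub> = (\<lambda>w. 0)"
  "f \<otimes>\<^bsub>free_algebra\<^esub> g = (\<lambda>w. \<Sum>i\<le>length w. f (take i w) * g (drop i w))"
  "\<one>\<^bsub>free_algebra\<^esub> = term_of_word 1 []"
  by (simp_all add: free_algebra_def term_of_word_def)

lemma fa_carrier: "f \<in> carrier free_algebra \<longleftrightarrow> finite {w. f w \<noteq> 0}"
  by (simp add: free_algebra_def)

interpretation FA: ring "free_algebra :: (gen list \<Rightarrow> 'k::field) ring"
  by (rule ring_free_algebra)

lemma term_of_word_closed [simp]: "term_of_word c v \<in> carrier free_algebra"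
  by (simp add: fa_carrier term_of_word_def)

lemma fa_uminus:
  assumes "f \<in> carrier (free_algebra :: (gen list \<Rightarrow> 'k::field) ring)"
  shows "\<ominus>\<^bsub>free_algebra\<^esub> f = (\<lambda>w. - f w)"
  using assms by (intro FA.minus_equality) (auto simp: fa_simps fa_carrier)

lemma fa_minus:
  assumes "g \<in> carrier (free_algebra :: (gen list \<Rightarrow> 'k::field) ring)"
  shows "f \<ominus>\<^bsub>free_algebra\<^esub> g = (\<lambda>w. f w - g w)"
  using assms by (simp add: a_minus_def fa_uminus fa_simps)

lemma nf_closed [simp]: "nf a0 a1 a2 a3 a4 a5 \<in> carrier free_algebra"
proof -
  have "{w. nf a0 a1 a2 a3 a4 a5 w \<noteq> 0} \<subseteq> {[], [Gx], [Gy], [Gz], [Gy, Gx], [Gz, Gx]}"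
    by (auto simp: nf_def split: if_splits)
  then show ?thesis by (auto simp: fa_carrier intro: finite_subset)
qed

lemma reduce_closed [simp]: "reduce q f \<in> carrier free_algebra"
  by (simp add: reduce_def)

lemma word_mult: "term_of_word c u \<otimes>\<^bsub>free_algebra\<^esub> term_of_word d v = term_of_word (c * d) (u @ v)"
proof
  fix w
  have "(\<Sum>i\<le>length w. term_of_word c u (take i w) * term_of_word d v (drop i w))
      = (\<Sum>i\<le>length w. if i = length u then (if w = u @ v then c * d else 0) else 0)"
  proof (rule sum.cong)
    fix i assume "i \<in> {..length w}"
    then have i: "i \<le> length w" by simp
    have "take i w = u \<and> drop i w = v \<longleftrightarrow> i = length u \<and> w = u @ v"
    proof
      assume uv: "take i w = u \<and> drop i w = v"
      then have "length u = i" using i by (metis length_take min_absorb2)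
      then show "i = length u \<and> w = u @ v" using append_take_drop_id[of i w] uv by simp
    qed auto
    moreover have "term_of_word c u (take i w) * term_of_word d v (drop i w)
        = (if take i w = u \<and> drop i w = v then c * d else 0)"
      by (simp add: term_of_word_def)
    ultimately have "term_of_word c u (take i w) * term_of_word d v (drop i w)
        = (if i = length u \<and> w = u @ v then c * d else 0)"
      by presburger
    then show "term_of_word c u (take i w) * term_of_word d v (drop i w)
        = (if i = length u then (if w = u @ v then c * d else 0) else 0)"
      by (metis (full_types))
  qed simp
  also have "\<dots> = term_of_word (c * d) (u @ v) w"
    by (auto simp: term_of_word_def)
  finally show "(term_of_word c u \<otimes>\<^bsub>free_algebra\<^esub> term_of_word d v) w = term_of_word (c * d) (u @ v) w"
    by (simp add: fa_simps)
qed

lemma mult_short_words: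
  "(f \<otimes>\<^bsub>free_algebra\<^esub> g) [] = f [] * g []"
  "(f \<otimes>\<^bsub>free_algebra\<^esub> g) [a] = f [] * g [a] + f [a] * g []"
  "(f \<otimes>\<^bsub>free_algebra\<^esub> g) [a, b] = f [] * g [a, b] + f [a] * g [b] + f [a, b] * g []"
  by (simp_all add: fa_simps numeral_2_eq_2 atMost_Suc)

lemma Lam_relations_closed: "Lam_relations q \<subseteq> carrier free_algebra"
  by (auto simp: Lam_relations_def)

lemma Lam_ideal_ideal: "ideal (Lam_ideal q) free_algebra"
  unfolding Lam_ideal_def by (rule FA.genideal_ideal[OF Lam_relations_closed])

text \<open>The coefficients of \<open>reduce q f\<close> are unchanged by the relations, so they separate cosets: this is the
  half of the basis theorem saying that \<open>1, x, y, z, yx, zx\<close> stay independent.\<close>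

lemma reduce_kernel_ideal:
  fixes q :: "'k::field"
  shows "ideal {f \<in> carrier free_algebra. reduce q f = (\<lambda>w. 0)} free_algebra" (is "ideal ?K _")
proof -
  have K: "f \<in> ?K \<longleftrightarrow> f \<in> carrier free_algebra \<and> f [] = 0 \<and> f [Gx] = 0 \<and> f [Gy] = 0 \<and> f [Gz] = 0 \<and>
      f [Gy, Gx] - q * f [Gx, Gy] = 0 \<and> f [Gz, Gx] + f [Gx, Gz] + f [Gz, Gy] = 0" (is "_ \<longleftrightarrow> ?P f") for f
  proof
    assume f: "f \<in> ?K"
    then have "reduce q f w = 0" for w by simp
    from this[of "[]"] this[of "[Gx]"] this[of "[Gy]"] this[of "[Gz]"] this[of "[Gy, Gx]"]
      this[of "[Gz, Gx]"] f show "?P f" by (simp add: reduce_def nf_def)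
  qed (auto simp: reduce_def nf_def)
  show ?thesis
  proof (rule idealI[OF FA.ring_axioms])
    show "subgroup ?K (add_monoid free_algebra)"
    proof (rule FA.add.subgroupI)
      have "\<zero>\<^bsub>free_algebra\<^esub> \<in> ?K"
        unfolding K using FA.zero_closed by (simp add: fa_simps(2))
      then show "?K \<noteq> {}" by blast
      fix f g assume f: "f \<in> ?K" and g: "g \<in> ?K"
      then have "f \<oplus>\<^bsub>free_algebra\<^esub> g \<in> carrier free_algebra" by simp
      moreover have "(f [Gy, Gx] - q * f [Gx, Gy]) + (g [Gy, Gx] - q * g [Gx, Gy]) = 0"
        "(f [Gz, Gx] + f [Gx, Gz] + f [Gz, Gy]) + (g [Gz, Gx] + g [Gx, Gz] + g [Gz, Gy]) = 0"
        using f g unfolding K by simp_all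
      ultimately show "f \<oplus>\<^bsub>free_algebra\<^esub> g \<in> ?K"
        using f g unfolding K by (simp add: fa_simps algebra_simps)
    next
      fix f assume f: "f \<in> ?K"
      then have "\<ominus>\<^bsub>free_algebra\<^esub> f \<in> carrier free_algebra" by simp
      moreover have "- (f [Gy, Gx] - q * f [Gx, Gy]) = 0" "- (f [Gz, Gx] + f [Gx, Gz] + f [Gz, Gy]) = 0"
        using f unfolding K by simp_all
      ultimately show "\<ominus>\<^bsub>free_algebra\<^esub> f \<in> ?K"
        using f unfolding K by (simp add: fa_uminus algebra_simps)
    qed auto
  next
    fix f g :: "gen list \<Rightarrow> 'k"
    assume f: "f \<in> ?K" and g: "g \<in> carrier free_algebra"
    have z: "f [Gy, Gx] = q * f [Gx, Gy]" "f [Gz, Gx] = - f [Gx, Gz] - f [Gz, Gy]"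
      using f unfolding K by (simp_all add: algebra_simps eq_neg_iff_add_eq_0)
    show "g \<otimes>\<^bsub>free_algebra\<^esub> f \<in> ?K" "f \<otimes>\<^bsub>free_algebra\<^esub> g \<in> ?K"
      using f g unfolding K mult_short_words z by (simp_all add: algebra_simps)
  qed
qed

lemma reduce_Lam_ideal: "f \<in> Lam_ideal q \<Longrightarrow> reduce q f = (\<lambda>w. 0)"
proof -
  have "reduce q r = (\<lambda>w. 0)" if "r \<in> Lam_relations q" for r
    using that unfolding Lam_relations_def
    by (elim insertE emptyE; simp add: fa_minus fa_simps(1))
      (simp_all add: term_of_word_def reduce_def nf_def fun_eq_iff)
  then have "Lam_relations q \<subseteq> {f \<in> carrier free_algebra. reduce q f = (\<lambda>w. 0)}"
    using Lam_relations_closed[of q] by auto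
  then have "Lam_ideal q \<subseteq> {f \<in> carrier free_algebra. reduce q f = (\<lambda>w. 0)}"
    unfolding Lam_ideal_def by (rule FA.genideal_minimal[OF reduce_kernel_ideal])
  then show "f \<in> Lam_ideal q \<Longrightarrow> reduce q f = (\<lambda>w. 0)" by auto
qed

lemma Lam_ideal_add: "f \<in> Lam_ideal q \<Longrightarrow> g \<in> Lam_ideal q \<Longrightarrow> (\<lambda>w. f w + g w) \<in> Lam_ideal q"
  using additive_subgroup.a_closed[OF ideal.axioms(1)[OF Lam_ideal_ideal], of f q g] by (simp add: fa_simps)

lemma Lam_ideal_minus: "f \<in> Lam_ideal q \<Longrightarrow> g \<in> Lam_ideal q \<Longrightarrow> (\<lambda>w. f w - g w) \<in> Lam_ideal q"
proof -
  interpret ideal "Lam_ideal q" free_algebra by (rule Lam_ideal_ideal)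
  assume f: "f \<in> Lam_ideal q" and g: "g \<in> Lam_ideal q"
  then have "(\<lambda>w. - g w) \<in> Lam_ideal q" using a_inv_closed[OF g] by (simp add: fa_uminus)
  from Lam_ideal_add[OF f this] show ?thesis by simp
qed

lemma Lam_ideal_sandwich:
  assumes "r \<in> Lam_relations q"
  shows "term_of_word c u \<otimes>\<^bsub>free_algebra\<^esub> (r \<otimes>\<^bsub>free_algebra\<^esub> term_of_word 1 w) \<in> Lam_ideal q"
proof -
  interpret ideal "Lam_ideal q" free_algebra by (rule Lam_ideal_ideal)
  have "r \<in> Lam_ideal q"
    unfolding Lam_ideal_def using FA.genideal_self[OF Lam_relations_closed] assms by auto
  then show ?thesis by (intro I_l_closed I_r_closed) auto
qed

lemma term_of_word_rewrite:
  shows word_xx: "term_of_word c (u @ [Gx, Gx] @ w) \<in> Lam_ideal q"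
    and word_yy: "term_of_word c (u @ [Gy, Gy] @ w) \<in> Lam_ideal q"
    and word_zz: "term_of_word c (u @ [Gz, Gz] @ w) \<in> Lam_ideal q"
    and word_yz: "term_of_word c (u @ [Gy, Gz] @ w) \<in> Lam_ideal q"
    and word_xy: "(\<lambda>t. term_of_word c (u @ [Gx, Gy] @ w) t + term_of_word (c * q) (u @ [Gy, Gx] @ w) t) \<in> Lam_ideal q"
    and word_xz: "(\<lambda>t. term_of_word c (u @ [Gx, Gz] @ w) t - term_of_word c (u @ [Gz, Gx] @ w) t) \<in> Lam_ideal q"
    and word_zy: "(\<lambda>t. term_of_word c (u @ [Gz, Gy] @ w) t - term_of_word c (u @ [Gz, Gx] @ w) t) \<in> Lam_ideal q"
proof -
  have mono: "term_of_word c (u @ v @ w) \<in> Lam_ideal q" if "term_of_word 1 v \<in> Lam_relations q" for v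
    using Lam_ideal_sandwich[OF that, of c u w] by (simp add: word_mult)
  show "term_of_word c (u @ [Gx, Gx] @ w) \<in> Lam_ideal q" "term_of_word c (u @ [Gy, Gy] @ w) \<in> Lam_ideal q"
    "term_of_word c (u @ [Gz, Gz] @ w) \<in> Lam_ideal q" "term_of_word c (u @ [Gy, Gz] @ w) \<in> Lam_ideal q"
    by (rule mono, simp add: Lam_relations_def)+
  have "term_of_word 1 [Gx, Gy] \<oplus>\<^bsub>free_algebra\<^esub> term_of_word q [Gy, Gx] \<in> Lam_relations q"
    by (simp add: Lam_relations_def)
  from Lam_ideal_sandwich[OF this, of c u w]
  have "term_of_word c (u @ [Gx, Gy] @ w) \<oplus>\<^bsub>free_algebra\<^esub> term_of_word (c * q) (u @ [Gy, Gx] @ w) \<in> Lam_ideal q"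
    by (simp add: FA.l_distr FA.r_distr word_mult)
  then show "(\<lambda>t. term_of_word c (u @ [Gx, Gy] @ w) t + term_of_word (c * q) (u @ [Gy, Gx] @ w) t) \<in> Lam_ideal q"
    by (simp add: fa_simps)
  have diff: "(\<lambda>t. term_of_word c (u @ v @ w) t - term_of_word c (u @ v' @ w) t) \<in> Lam_ideal q"
    if "term_of_word 1 v \<ominus>\<^bsub>free_algebra\<^esub> term_of_word 1 v' \<in> Lam_relations q" for v v'
  proof -
    from Lam_ideal_sandwich[OF that, of c u w]
    have "term_of_word c (u @ v @ w) \<ominus>\<^bsub>free_algebra\<^esub> term_of_word c (u @ v' @ w) \<in> Lam_ideal q"
      by (simp add: a_minus_def FA.l_distr FA.r_distr FA.l_minus FA.r_minus word_mult)
    then show ?thesis by (simp add: fa_minus)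
  qed
  show "(\<lambda>t. term_of_word c (u @ [Gx, Gz] @ w) t - term_of_word c (u @ [Gz, Gx] @ w) t) \<in> Lam_ideal q"
    "(\<lambda>t. term_of_word c (u @ [Gz, Gy] @ w) t - term_of_word c (u @ [Gz, Gx] @ w) t) \<in> Lam_ideal q"
    by (rule diff, simp add: Lam_relations_def)+
qed

text \<open>Words of length three vanish: the rewriting rules bring the last two letters into the form \<open>yx\<close> or \<open>zx\<close>,
  and applying them next to the first two letters produces a square or \<open>yz\<close>.\<close>

lemma long_word: "term_of_word c (a # b # d # w) \<in> Lam_ideal q"
proof -
  define P where "P v \<longleftrightarrow> (\<forall>c. term_of_word c (v @ w) \<in> Lam_ideal q)" for v
  have xy: "P (u @ [Gy, Gx] @ v) \<Longrightarrow> P (u @ [Gx, Gy] @ v)" for u v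
    unfolding P_def
  proof
    fix c assume "\<forall>c. term_of_word c ((u @ [Gy, Gx] @ v) @ w) \<in> Lam_ideal q"
    then show "term_of_word c ((u @ [Gx, Gy] @ v) @ w) \<in> Lam_ideal q"
      using Lam_ideal_minus[OF word_xy[of c u "v @ w" q], of "term_of_word (c * q) (u @ [Gy, Gx] @ v @ w)"]
      by simp
  qed
  have xz: "P (u @ [Gz, Gx] @ v) \<Longrightarrow> P (u @ [Gx, Gz] @ v)" for u v
    unfolding P_def
  proof
    fix c assume "\<forall>c. term_of_word c ((u @ [Gz, Gx] @ v) @ w) \<in> Lam_ideal q"
    then show "term_of_word c ((u @ [Gx, Gz] @ v) @ w) \<in> Lam_ideal q"
      using Lam_ideal_add[OF word_xz[of c u "v @ w" q], of "term_of_word c (u @ [Gz, Gx] @ v @ w)"]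
      by simp
  qed
  have zy: "P (u @ [Gz, Gx] @ v) \<Longrightarrow> P (u @ [Gz, Gy] @ v)" for u v
    unfolding P_def
  proof
    fix c assume "\<forall>c. term_of_word c ((u @ [Gz, Gx] @ v) @ w) \<in> Lam_ideal q"
    then show "term_of_word c ((u @ [Gz, Gy] @ v) @ w) \<in> Lam_ideal q"
      using Lam_ideal_add[OF word_zy[of c u "v @ w" q], of "term_of_word c (u @ [Gz, Gx] @ v @ w)"]
      by simp
  qed
  have sq: "P (u @ [Gx, Gx] @ v)" "P (u @ [Gy, Gy] @ v)" "P (u @ [Gz, Gz] @ v)" "P (u @ [Gy, Gz] @ v)" for u v
    using word_xx[of _ u "v @ w" q] word_yy[of _ u "v @ w" q] word_zz[of _ u "v @ w" q]
      word_yz[of _ u "v @ w" q]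
    by (simp_all add: P_def)
  note left = sq[of "[]" "[_]", simplified] and right = sq[of "[_]" "[]", simplified]
  have zx: "P [a, Gz, Gx]" for a
    using left xz[of "[]" "[Gx]"] right by (cases a) auto
  have yx: "P [a, Gy, Gx]" for a
    using left xy[of "[]" "[Gx]"] zy[of "[]" "[Gx]"] right by (cases a) auto
  have "P [a, b, d]"
    using zx[of a] yx[of a] right xy[of "[a]" "[]"] xz[of "[a]" "[]"] zy[of "[a]" "[]"]
    by (cases b; cases d) auto
  then show ?thesis by (simp add: P_def)
qed

lemma nf_unit:
  "nf 0 0 0 0 0 0 = (\<lambda>w. 0)" "nf c 0 0 0 0 0 = term_of_word c []" "nf 0 c 0 0 0 0 = term_of_word c [Gx]"
  "nf 0 0 c 0 0 0 = term_of_word c [Gy]" "nf 0 0 0 c 0 0 = term_of_word c [Gz]"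
  "nf 0 0 0 0 c 0 = term_of_word c [Gy, Gx]" "nf 0 0 0 0 0 c = term_of_word c [Gz, Gx]"
  by (rule ext, simp add: nf_def term_of_word_def)+

lemma term_of_word_apply: "term_of_word c v w = (if w = v then c else 0)"
  by (simp add: term_of_word_def)

lemma term_of_word_0 [simp]: "term_of_word 0 v = (\<lambda>w. 0)"
  by (simp add: term_of_word_def)

lemma reduce_word: "(\<lambda>t. term_of_word c v t - reduce q (term_of_word c v) t) \<in> Lam_ideal q"
proof -
  have zero: "(\<lambda>t. 0) \<in> Lam_ideal q"
    using additive_subgroup.zero_closed[OF ideal.axioms(1)[OF Lam_ideal_ideal], of q] by (simp add: fa_simps)
  consider "v = []" | a where "v = [a]" | a b where "v = [a, b]" | a b d w where "v = a # b # d # w"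
    by (metis list.exhaust)
  then show ?thesis
  proof cases
    case 1
    then have "reduce q (term_of_word c v) = term_of_word c v"
      by (simp add: reduce_def term_of_word_apply nf_unit)
    with zero show ?thesis by simp
  next
    case 2
    then have "reduce q (term_of_word c v) = term_of_word c v"
      by (cases "hd v") (simp_all add: reduce_def term_of_word_apply nf_unit)
    with zero show ?thesis by simp
  next
    case (3 a b)
    note rel = word_xx[of c "[]" "[]" q] word_yy[of c "[]" "[]" q] word_zz[of c "[]" "[]" q]
      word_yz[of c "[]" "[]" q] word_xy[of c "[]" "[]" q] word_xz[of c "[]" "[]" q] word_zy[of c "[]" "[]" q]
    have "(\<lambda>t. term_of_word c [Gx, Gy] t - term_of_word (- (q * c)) [Gy, Gx] t)
        = (\<lambda>t. term_of_word c [Gx, Gy] t + term_of_word (c * q) [Gy, Gx] t)"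
      by (rule ext) (simp add: term_of_word_apply)
    then have "(\<lambda>t. term_of_word c [Gx, Gy] t - term_of_word (- (q * c)) [Gy, Gx] t) \<in> Lam_ideal q"
      using rel(5) by simp
    moreover have "reduce q (term_of_word c [g, h]) =
        (if h = g \<or> g = Gy \<and> h = Gz then (\<lambda>t. 0)
         else if g = Gx \<and> h = Gy then term_of_word (- (q * c)) [Gy, Gx]
         else if g = Gy then term_of_word c [Gy, Gx] else term_of_word c [Gz, Gx])" for g h
      by (cases g; cases h; simp add: reduce_def term_of_word_apply nf_unit)
    ultimately show ?thesis
      using 3 rel zero by (cases a; cases b) simp_all
  next
    case (4 a b d w)
    then have "reduce q (term_of_word c v) = (\<lambda>t. 0)"
      by (simp add: reduce_def term_of_word_apply nf_unit)
    then show ?thesis using long_word[of c a b d w q] 4 by simp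
  qed
qed

lemma reduce_congruent:
  assumes "f \<in> carrier free_algebra"
  shows "(\<lambda>t. f t - reduce q f t) \<in> Lam_ideal q"
proof -
  have "finite S \<Longrightarrow> {w. f w \<noteq> 0} \<subseteq> S \<Longrightarrow> (\<lambda>t. f t - reduce q f t) \<in> Lam_ideal q" for S f
  proof (induction S arbitrary: f rule: finite_induct)
    case empty
    then have "f = (\<lambda>t. 0)" by auto
    then show ?case using reduce_word[of 0 "[]" q] by (simp add: term_of_word_def)
  next
    case (insert v S)
    define g where "g = f(v := 0)"
    have f: "f = (\<lambda>t. g t + term_of_word (f v) v t)" by (auto simp: g_def term_of_word_def)
    have "(\<lambda>t. g t - reduce q g t) \<in> Lam_ideal q"
      using insert.prems by (intro insert.IH) (auto simp: g_def)
    from Lam_ideal_add[OF this reduce_word[of "f v" v q]]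
    have "(\<lambda>t. f t - (reduce q g t + reduce q (term_of_word (f v) v) t)) \<in> Lam_ideal q"
      by (subst f) (simp add: algebra_simps)
    moreover have "reduce q f t = reduce q g t + reduce q (term_of_word (f v) v) t" for t
      by (subst f) (simp add: reduce_def nf_def algebra_simps)
    ultimately show ?case by simp
  qed
  then show ?thesis using assms by (auto simp: fa_carrier)
qed

text \<open>The other half of the basis theorem; the products and sums in \<open>\<Lambda>\<close> are read off from it.\<close>

lemma coset_eq_lam:
  assumes "f \<in> carrier free_algebra"
  shows "Lam_ideal q +>\<^bsub>free_algebra\<^esub> f = lam q (f []) (f [Gx]) (f [Gy]) (f [Gz])
    (f [Gy, Gx] - q * f [Gx, Gy]) (f [Gz, Gx] + f [Gx, Gz] + f [Gz, Gy])"
proof -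
  interpret ideal "Lam_ideal q" free_algebra by (rule Lam_ideal_ideal)
  have "f = (\<lambda>t. f t - reduce q f t) \<oplus>\<^bsub>free_algebra\<^esub> reduce q f" by (simp add: fa_simps)
  then have "f \<in> Lam_ideal q +>\<^bsub>free_algebra\<^esub> reduce q f"
    using reduce_congruent[OF assms, of q] unfolding a_r_coset_def' by blast
  then have "Lam_ideal q +>\<^bsub>free_algebra\<^esub> reduce q f = Lam_ideal q +>\<^bsub>free_algebra\<^esub> f"
    by (intro FA.a_repr_independence a_subgroup) auto
  then show ?thesis by (simp add: lam_def reduce_def)
qed

lemma lam_inject:
  "lam q a0 a1 a2 a3 a4 a5 = lam q b0 b1 b2 b3 b4 b5 \<longleftrightarrow>
     a0 = b0 \<and> a1 = b1 \<and> a2 = b2 \<and> a3 = b3 \<and> a4 = b4 \<and> a5 = b5" (is "?l = ?r \<longleftrightarrow> _")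
proof
  interpret ideal "Lam_ideal q" free_algebra by (rule Lam_ideal_ideal)
  assume "?l = ?r"
  moreover have "\<zero>\<^bsub>free_algebra\<^esub> \<oplus>\<^bsub>free_algebra\<^esub> nf a0 a1 a2 a3 a4 a5 \<in> ?l"
    unfolding lam_def a_r_coset_def' using zero_closed by blast
  ultimately have "nf a0 a1 a2 a3 a4 a5 \<in> Lam_ideal q +>\<^bsub>free_algebra\<^esub> nf b0 b1 b2 b3 b4 b5"
    by (simp add: lam_def)
  then obtain h where h: "h \<in> Lam_ideal q"
    and eq: "nf a0 a1 a2 a3 a4 a5 = (\<lambda>w. h w + nf b0 b1 b2 b3 b4 b5 w)"
    by (auto simp: a_r_coset_def' fa_simps)
  have r: "reduce q h w = 0" for w using reduce_Lam_ideal[OF h] by simp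
  note e = fun_cong[OF eq]
  show "a0 = b0 \<and> a1 = b1 \<and> a2 = b2 \<and> a3 = b3 \<and> a4 = b4 \<and> a5 = b5"
    using r[of "[]"] r[of "[Gx]"] r[of "[Gy]"] r[of "[Gz]"] r[of "[Gy, Gx]"] r[of "[Gz, Gx]"]
      e[of "[]"] e[of "[Gx]"] e[of "[Gy]"] e[of "[Gz]"] e[of "[Gy, Gx]"] e[of "[Gz, Gx]"]
      e[of "[Gx, Gy]"] e[of "[Gx, Gz]"] e[of "[Gz, Gy]"]
    by (simp add: reduce_def nf_def)
qed auto

lemma lam_cases:
  assumes "r \<in> carrier (Lam q)"
  obtains a0 a1 a2 a3 a4 a5 where "r = lam q a0 a1 a2 a3 a4 a5"
proof -
  obtain f where "f \<in> carrier free_algebra" "r = Lam_ideal q +>\<^bsub>free_algebra\<^esub> f"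
    using assms by (auto simp: Lam_def FactRing_def A_RCOSETS_def' a_r_coset_def')
  then show ?thesis using coset_eq_lam[of f q] by (intro that) simp
qed

lemma lam_closed [simp]: "lam q a0 a1 a2 a3 a4 a5 \<in> carrier (Lam q)"
  using nf_closed by (auto simp: Lam_def FactRing_def A_RCOSETS_def' a_r_coset_def' lam_def)

lemma lam_mult:
  "lam q a0 a1 a2 a3 a4 a5 \<otimes>\<^bsub>Lam q\<^esub> lam q b0 b1 b2 b3 b4 b5 =
     lam q (a0 * b0) (a0 * b1 + a1 * b0) (a0 * b2 + a2 * b0) (a0 * b3 + a3 * b0)
       (a0 * b4 + a2 * b1 + a4 * b0 - q * (a1 * b2))
       (a0 * b5 + a3 * b1 + a5 * b0 + a1 * b3 + a3 * b2)"
proof -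
  let ?f = "nf a0 a1 a2 a3 a4 a5" and ?g = "nf b0 b1 b2 b3 b4 b5"
  have "lam q a0 a1 a2 a3 a4 a5 \<otimes>\<^bsub>Lam q\<^esub> lam q b0 b1 b2 b3 b4 b5
      = Lam_ideal q +>\<^bsub>free_algebra\<^esub> (?f \<otimes>\<^bsub>free_algebra\<^esub> ?g)"
    using ideal.rcoset_mult_add[OF Lam_ideal_ideal nf_closed nf_closed] by (simp add: Lam_def FactRing_def lam_def)
  then show ?thesis
    unfolding coset_eq_lam[OF FA.m_closed[OF nf_closed nf_closed]] mult_short_words
    by (simp add: nf_def lam_inject algebra_simps)
qed

lemma lam_add:
  "lam q a0 a1 a2 a3 a4 a5 \<oplus>\<^bsub>Lam q\<^esub> lam q b0 b1 b2 b3 b4 b5 =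
     lam q (a0 + b0) (a1 + b1) (a2 + b2) (a3 + b3) (a4 + b4) (a5 + b5)"
proof -
  interpret ideal "Lam_ideal q" free_algebra by (rule Lam_ideal_ideal)
  let ?f = "nf a0 a1 a2 a3 a4 a5" and ?g = "nf b0 b1 b2 b3 b4 b5"
  have "lam q a0 a1 a2 a3 a4 a5 \<oplus>\<^bsub>Lam q\<^esub> lam q b0 b1 b2 b3 b4 b5
      = Lam_ideal q +>\<^bsub>free_algebra\<^esub> (?f \<oplus>\<^bsub>free_algebra\<^esub> ?g)"
    using a_rcos_sum[OF nf_closed nf_closed] by (simp add: Lam_def FactRing_def lam_def)
  then show ?thesis
    unfolding coset_eq_lam[OF FA.a_closed[OF nf_closed nf_closed]]
    by (simp add: fa_simps(1) nf_def lam_inject)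
qed

lemma lam_zero: "\<zero>\<^bsub>Lam q\<^esub> = lam q 0 0 0 0 0 0"
proof -
  interpret ideal "Lam_ideal q" free_algebra by (rule Lam_ideal_ideal)
  have "\<zero>\<^bsub>Lam q\<^esub> = Lam_ideal q +>\<^bsub>free_algebra\<^esub> \<zero>\<^bsub>free_algebra\<^esub>"
    using a_subset by (simp add: Lam_def FactRing_def)
  then show ?thesis unfolding coset_eq_lam[OF FA.zero_closed] by (simp add: fa_simps(2))
qed

lemma lam_one: "\<one>\<^bsub>Lam q\<^esub> = lam q 1 0 0 0 0 0"
proof -
  have "\<one>\<^bsub>Lam q\<^esub> = Lam_ideal q +>\<^bsub>free_algebra\<^esub> \<one>\<^bsub>free_algebra\<^esub>"
    by (simp add: Lam_def FactRing_def)
  then show ?thesis unfolding coset_eq_lam[OF FA.one_closed]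
    by (simp add: fa_simps(4) term_of_word_def)
qed

lemma Lam_scalar_lam: "Lam_scalar q c = lam q c 0 0 0 0 0"
  unfolding Lam_scalar_def coset_eq_lam[OF term_of_word_closed] by (simp add: term_of_word_def)

lemma Lam_gen_lam:
  "Lam_gen q Gx = lam q 0 1 0 0 0 0" "Lam_gen q Gy = lam q 0 0 1 0 0 0" "Lam_gen q Gz = lam q 0 0 0 1 0 0"
  unfolding Lam_gen_def coset_eq_lam[OF term_of_word_closed] by (simp_all add: term_of_word_def)

lemmas lam_simps = lam_mult lam_add lam_zero lam_one lam_inject

interpretation Lam: ring "Lam q" for q :: "'k::field"
  by (rule ring_Lam)

section \<open>Quotients, isomorphisms and duals of cyclic modules\<close>

lemma regular_uminus [simp]: "\<ominus>\<^bsub>regular_module R\<^esub> x = \<ominus>\<^bsub>R\<^esub> x"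
  by (simp add: a_inv_def m_inv_def)

lemma cyclic_onE:
  assumes "cyclic_on R N m U" "x \<in> carrier N"
  obtains r where "r \<in> carrier R" "x = r \<odot>\<^bsub>N\<^esub> m"
  using assms unfolding cyclic_on_def by blast

lemma cyclic_on_eq_iff:
  assumes "cyclic_on R N m U" "r \<in> carrier R" "s \<in> carrier R"
  shows "r \<odot>\<^bsub>N\<^esub> m = s \<odot>\<^bsub>N\<^esub> m \<longleftrightarrow> r \<ominus>\<^bsub>R\<^esub> s \<in> U"
proof -
  interpret N: left_module R N using assms by (simp add: cyclic_on_def)
  have m: "m \<in> carrier N" using assms unfolding cyclic_on_def by blast
  define p where "p = (\<lambda>r\<in>carrier R. r \<odot>\<^bsub>N\<^esub> m)"
  have p: "p \<in> lin_maps R (regular_module R) N"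
    unfolding p_def by (rule lin_maps_regular[OF N.left_module_axioms m])
  have "p (r \<ominus>\<^bsub>R\<^esub> s) = p r \<ominus>\<^bsub>N\<^esub> p s"
    using lin_maps_minus[OF left_module_regular[OF N.R.ring_axioms] N.left_module_axioms p, of r s] assms(2,3)
    by (simp add: a_minus_def)
  then have "(r \<ominus>\<^bsub>R\<^esub> s) \<odot>\<^bsub>N\<^esub> m = r \<odot>\<^bsub>N\<^esub> m \<ominus>\<^bsub>N\<^esub> s \<odot>\<^bsub>N\<^esub> m"
    using assms(2,3) by (simp add: p_def)
  moreover have "U = {r \<in> carrier R. r \<odot>\<^bsub>N\<^esub> m = \<zero>\<^bsub>N\<^esub>}" using assms(1) by (simp add: cyclic_on_def)
  moreover have "a \<ominus>\<^bsub>N\<^esub> b = \<zero>\<^bsub>N\<^esub> \<longleftrightarrow> a = b" if "a \<in> carrier N" "b \<in> carrier N" for a b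
    using that by (metis N.M.a_inv_closed N.M.minus_equality N.M.minus_minus N.M.r_neg a_minus_def)
  ultimately show ?thesis using assms(2,3) m by auto
qed

lemma module_iso_cyclic:
  assumes M: "cyclic_on R M m U" and N: "cyclic_on R N n U"
  shows "module_iso R M N"
proof -
  interpret M: left_module R M using M by (simp add: cyclic_on_def)
  interpret N: left_module R N using N by (simp add: cyclic_on_def)
  note e = cyclic_on_epi[OF M] cyclic_on_epi[OF N]
  obtain g where g: "g \<in> lin_maps R M N"
    and gr: "\<And>r. r \<in> carrier (regular_module R) \<Longrightarrow>
      g ((\<lambda>r\<in>carrier R. r \<odot>\<^bsub>M\<^esub> m) r) = (\<lambda>r\<in>carrier R. r \<odot>\<^bsub>N\<^esub> n) r"
  proof (rule epi_factor[OF e(1) N.left_module_axioms])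
    show "(\<lambda>r\<in>carrier R. r \<odot>\<^bsub>N\<^esub> n) \<in> lin_maps R (regular_module R) N"
      using e(3) by (simp add: epi_def del: restrict_apply)
    show "(\<lambda>r\<in>carrier R. r \<odot>\<^bsub>N\<^esub> n) u = \<zero>\<^bsub>N\<^esub>"
      if "u \<in> ker (regular_module R) (\<lambda>r\<in>carrier R. r \<odot>\<^bsub>M\<^esub> m) M" for u
      using that unfolding e(2) e(4)[symmetric] by blast
  qed blast
  have gr: "g (r \<odot>\<^bsub>M\<^esub> m) = r \<odot>\<^bsub>N\<^esub> n" if "r \<in> carrier R" for r using gr[of r] that by simp
  have "inj_on g (carrier M)"
  proof (rule inj_onI)
    fix x y assume xy: "x \<in> carrier M" "y \<in> carrier M" "g x = g y"
    obtain r where r: "r \<in> carrier R" "x = r \<odot>\<^bsub>M\<^esub> m" using cyclic_onE[OF M xy(1)] .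
    obtain s where s: "s \<in> carrier R" "y = s \<odot>\<^bsub>M\<^esub> m" using cyclic_onE[OF M xy(2)] .
    have "r \<odot>\<^bsub>N\<^esub> n = s \<odot>\<^bsub>N\<^esub> n" using xy(3) gr r s by simp
    then show "x = y"
      using cyclic_on_eq_iff[OF M r(1) s(1)] cyclic_on_eq_iff[OF N r(1) s(1)] r s by simp
  qed
  moreover have "carrier N \<subseteq> g ` carrier M"
  proof
    fix y assume "y \<in> carrier N"
    then obtain r where r: "r \<in> carrier R" "y = r \<odot>\<^bsub>N\<^esub> n" using cyclic_onE[OF N] by blast
    have "m \<in> carrier M" using M unfolding cyclic_on_def by blast
    then show "y \<in> g ` carrier M" using gr[OF r(1)] r by (intro image_eqI[of _ _ "r \<odot>\<^bsub>M\<^esub> m"]) auto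
  qed
  ultimately have "bij_betw g (carrier M) (carrier N)"
    using lin_maps_closed[OF g] by (auto simp: bij_betw_def)
  with g show ?thesis by (auto simp: module_iso_def)
qed

lemma cyclic_on_iso:
  assumes iso: "module_iso R M N" and M: "left_module R M" and N: "cyclic_on R N n U"
  obtains m where "cyclic_on R M m U"
proof -
  interpret M: left_module R M by fact
  interpret N: left_module R N using N by (simp add: cyclic_on_def)
  obtain f where f: "f \<in> lin_maps R M N" and bij: "bij_betw f (carrier M) (carrier N)"
    using iso by (auto simp: module_iso_def)
  have n: "n \<in> carrier N" using N unfolding cyclic_on_def by blast
  then have "n \<in> f ` carrier M" using bij_betw_imp_surj_on[OF bij] by simp
  then obtain m where m: "m \<in> carrier M" "f m = n" by blast
  have inj: "x = y" if "x \<in> carrier M" "y \<in> carrier M" "f x = f y" for x y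
    using inj_onD[OF bij_betw_imp_inj_on[OF bij] that(3) that(1,2)] .
  have fr: "f (r \<odot>\<^bsub>M\<^esub> m) = r \<odot>\<^bsub>N\<^esub> n" if "r \<in> carrier R" for r
    using lin_maps_smult[OF f that m(1)] m(2) by simp
  have "\<exists>r. x = r \<odot>\<^bsub>M\<^esub> m \<and> r \<in> carrier R" if x: "x \<in> carrier M" for x
  proof -
    obtain r where r: "r \<in> carrier R" "f x = r \<odot>\<^bsub>N\<^esub> n"
      using cyclic_onE[OF N lin_maps_closed[OF f x]] .
    have "x = r \<odot>\<^bsub>M\<^esub> m" using r x m(1) fr[OF r(1)] by (intro inj) auto
    with r show ?thesis by blast
  qed
  then have gen: "carrier M = {r \<odot>\<^bsub>M\<^esub> m | r. r \<in> carrier R}"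
    using M.smult_closed[OF _ m(1)] by (intro equalityI subsetI CollectI) auto
  have "r \<odot>\<^bsub>M\<^esub> m = \<zero>\<^bsub>M\<^esub> \<longleftrightarrow> r \<odot>\<^bsub>N\<^esub> n = \<zero>\<^bsub>N\<^esub>" if r: "r \<in> carrier R" for r
    using fr[OF r] lin_maps_zero[OF M N.left_module_axioms f] inj[of "r \<odot>\<^bsub>M\<^esub> m" "\<zero>\<^bsub>M\<^esub>"] r m(1) by auto
  moreover have "U = {r \<in> carrier R. r \<odot>\<^bsub>N\<^esub> n = \<zero>\<^bsub>N\<^esub>}" using N by (simp add: cyclic_on_def)
  ultimately have ann: "U = {r \<in> carrier R. r \<odot>\<^bsub>M\<^esub> m = \<zero>\<^bsub>M\<^esub>}" by (simp cong: conj_cong)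
  show ?thesis
    by (rule that[of m], unfold cyclic_on_def) (intro conjI M m(1) gen ann)
qed

lemma regular_submoduleI:
  assumes "ring R" "S \<subseteq> carrier R" "\<zero>\<^bsub>R\<^esub> \<in> S"
    and "\<And>x y. x \<in> S \<Longrightarrow> y \<in> S \<Longrightarrow> x \<oplus>\<^bsub>R\<^esub> y \<in> S"
    and mult: "\<And>r x. r \<in> carrier R \<Longrightarrow> x \<in> S \<Longrightarrow> r \<otimes>\<^bsub>R\<^esub> x \<in> S"
  shows "submodule S R (regular_module R)"
proof -
  interpret ring R by fact
  have neg: "\<ominus>\<^bsub>R\<^esub> x \<in> S" if "x \<in> S" for x
    using mult[of "\<ominus>\<^bsub>R\<^esub> \<one>\<^bsub>R\<^esub>" x] that assms(2) by (auto simp: l_minus)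
  show ?thesis
  proof (intro submodule.intro subgroup.intro submodule_axioms.intro)
    fix x assume "x \<in> S"
    then show "inv\<^bsub>add_monoid (regular_module R)\<^esub> x \<in> S"
      using neg[of x] by (simp add: a_inv_def m_inv_def)
  qed (use assms in auto)
qed

lemma quotient_module_cyclic:
  assumes R: "ring R" and U: "submodule U R (regular_module R)"
  shows "cyclic_on R (quotient_module R (regular_module R) U) (U +>\<^bsub>regular_module R\<^esub> \<one>\<^bsub>R\<^esub>) U"
proof -
  interpret ring R by fact
  have reg: "left_module R (regular_module R)" by (rule left_module_regular[OF R])
  interpret reg: left_module R "regular_module R" by fact
  interpret U: submodule U R "regular_module R" by fact
  interpret A: abelian_subgroup U "regular_module R"
    by (intro abelian_subgroupI3 additive_subgroupI U.subgroup_axioms reg.M.abelian_group_axioms)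
  let ?Q = "quotient_module R (regular_module R) U"
  define c where "c x = U +>\<^bsub>regular_module R\<^esub> x" for x
  have UR: "x \<in> carrier R" if "x \<in> U" for x using A.a_subset that by auto
  have c_mem: "y \<in> c x \<longleftrightarrow> (\<exists>u\<in>U. y = u \<oplus>\<^bsub>R\<^esub> x)" for x y
    by (auto simp: c_def a_r_coset_def')
  have c_eq: "c x = c y \<longleftrightarrow> x \<ominus>\<^bsub>R\<^esub> y \<in> U" if "x \<in> carrier R" "y \<in> carrier R" for x y
  proof
    assume "c x = c y"
    moreover have "x \<in> c x" unfolding c_def using A.a_rcos_self[of x] that by simp
    ultimately obtain u where u: "u \<in> U" "x = u \<oplus>\<^bsub>R\<^esub> y" by (auto simp: c_mem)
    then have "x \<ominus>\<^bsub>R\<^esub> y = u" using that UR by (simp add: a_minus_def a_assoc r_neg)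
    with u show "x \<ominus>\<^bsub>R\<^esub> y \<in> U" by simp
  next
    assume "x \<ominus>\<^bsub>R\<^esub> y \<in> U"
    moreover have "x = (x \<ominus>\<^bsub>R\<^esub> y) \<oplus>\<^bsub>R\<^esub> y" using that by (simp add: a_minus_def a_assoc l_neg)
    ultimately have "x \<in> c y" by (auto simp: c_mem)
    then show "c x = c y"
      unfolding c_def using that reg.M.a_repr_independence[OF _ _ U.subgroup_axioms, of x y] by simp
  qed
  have carr: "carrier ?Q = c ` carrier R"
    by (auto simp: quotient_module_def A_RCOSETS_def' a_r_coset_def' c_def)
  have zero: "\<zero>\<^bsub>?Q\<^esub> = c \<zero>\<^bsub>R\<^esub>"
    using reg.M.a_coset_add_zero[OF A.a_subset] by (simp add: quotient_module_def c_def)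
  have add: "c x \<oplus>\<^bsub>?Q\<^esub> c y = c (x \<oplus>\<^bsub>R\<^esub> y)" if "x \<in> carrier R" "y \<in> carrier R" for x y
    using A.a_rcos_sum[of x y] that by (simp add: quotient_module_def c_def)
  have smult: "r \<odot>\<^bsub>?Q\<^esub> c x = c (r \<otimes>\<^bsub>R\<^esub> x)" if "r \<in> carrier R" "x \<in> carrier R" for r x
  proof -
    have "c (r \<otimes>\<^bsub>R\<^esub> y) = c (r \<otimes>\<^bsub>R\<^esub> x)" if y: "y \<in> c x" for y
    proof -
      obtain u where u: "u \<in> U" "y = u \<oplus>\<^bsub>R\<^esub> x" using y by (auto simp: c_mem)
      then have "r \<otimes>\<^bsub>R\<^esub> y \<ominus>\<^bsub>R\<^esub> r \<otimes>\<^bsub>R\<^esub> x = r \<otimes>\<^bsub>R\<^esub> u"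
        using \<open>r \<in> carrier R\<close> \<open>x \<in> carrier R\<close> UR by (simp add: r_distr a_minus_def a_assoc r_neg)
      moreover have "r \<otimes>\<^bsub>R\<^esub> u \<in> U" using U.smult_closed[of r u] u \<open>r \<in> carrier R\<close> by simp
      ultimately show ?thesis using u \<open>r \<in> carrier R\<close> \<open>x \<in> carrier R\<close> UR by (simp add: c_eq)
    qed
    moreover have "x \<in> c x" unfolding c_def using A.a_rcos_self[of x] that by simp
    ultimately have "(\<Union>y\<in>c x. c (r \<otimes>\<^bsub>R\<^esub> y)) = c (r \<otimes>\<^bsub>R\<^esub> x)" by blast
    then show ?thesis by (simp add: quotient_module_def c_def)
  qed
  have closed: "c x \<in> carrier ?Q" if "x \<in> carrier R" for x using that carr by auto
  have Q: "left_module R ?Q"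
  proof (intro left_module.intro left_module_axioms.intro R)
    show "abelian_group ?Q"
    proof (rule abelian_groupI)
      fix X assume "X \<in> carrier ?Q"
      then obtain x where "x \<in> carrier R" "X = c x" by (auto simp: carr)
      then show "\<exists>Y\<in>carrier ?Q. Y \<oplus>\<^bsub>?Q\<^esub> X = \<zero>\<^bsub>?Q\<^esub>"
        by (intro bexI[of _ "c (\<ominus>\<^bsub>R\<^esub> x)"]) (simp_all add: add zero closed l_neg)
    qed (auto simp: carr add zero a_ac)
  qed (auto simp: carr add smult l_distr r_distr m_assoc)
  have "c r = c \<zero>\<^bsub>R\<^esub> \<longleftrightarrow> r \<in> U" if "r \<in> carrier R" for r
    using c_eq[OF that zero_closed] that by (simp add: a_minus_def)
  then have "{r \<in> carrier R. r \<odot>\<^bsub>?Q\<^esub> c \<one>\<^bsub>R\<^esub> = \<zero>\<^bsub>?Q\<^esub>} = {r \<in> carrier R. r \<in> U}"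
    by (simp add: smult zero cong: conj_cong)
  also have "\<dots> = U" using UR by blast
  finally have ann: "U = {r \<in> carrier R. r \<odot>\<^bsub>?Q\<^esub> c \<one>\<^bsub>R\<^esub> = \<zero>\<^bsub>?Q\<^esub>}" by (rule sym)
  have gen: "carrier ?Q = {r \<odot>\<^bsub>?Q\<^esub> c \<one>\<^bsub>R\<^esub> | r. r \<in> carrier R}"
  proof (intro equalityI subsetI)
    fix X assume "X \<in> carrier ?Q"
    then obtain r where "r \<in> carrier R" "X = c r" unfolding carr by blast
    then show "X \<in> {r \<odot>\<^bsub>?Q\<^esub> c \<one>\<^bsub>R\<^esub> | r. r \<in> carrier R}"
      by (intro CollectI exI[of _ r]) (simp add: smult)
  next
    fix X assume "X \<in> {r \<odot>\<^bsub>?Q\<^esub> c \<one>\<^bsub>R\<^esub> | r. r \<in> carrier R}"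
    then obtain r where "r \<in> carrier R" "X = r \<odot>\<^bsub>?Q\<^esub> c \<one>\<^bsub>R\<^esub>" by blast
    then show "X \<in> carrier ?Q" by (simp add: smult closed)
  qed
  show ?thesis
    unfolding cyclic_on_def c_def[symmetric] by (intro conjI Q closed one_closed gen ann)
qed

lemma dual_simps:
  "carrier (dual R M) = lin_maps R M (regular_module R)" "\<zero>\<^bsub>dual R M\<^esub> = (\<lambda>m\<in>carrier M. \<zero>\<^bsub>R\<^esub>)"
  "x \<in> carrier M \<Longrightarrow> (f \<oplus>\<^bsub>dual R M\<^esub> g) x = f x \<oplus>\<^bsub>R\<^esub> g x"
  "x \<in> carrier M \<Longrightarrow> (s \<odot>\<^bsub>dual R M\<^esub> f) x = f x \<otimes>\<^bsub>R\<^esub> s"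
  by (simp_all add: dual_def)

lemma lin_maps_eqI:
  assumes "f \<in> lin_maps R M N" "g \<in> lin_maps R M N" "\<And>x. x \<in> carrier M \<Longrightarrow> f x = g x"
  shows "f = g"
proof -
  have "f \<in> carrier M \<rightarrow>\<^sub>E carrier N" "g \<in> carrier M \<rightarrow>\<^sub>E carrier N"
    using assms by (simp_all add: lin_maps_def)
  then show ?thesis using assms(3) by (rule PiE_ext)
qed

lemma cyclic_on_hom:
  assumes "cyclic_on R M m U" "t \<in> carrier R" "\<And>r. r \<in> U \<Longrightarrow> r \<otimes>\<^bsub>R\<^esub> t = \<zero>\<^bsub>R\<^esub>"
  obtains g where "g \<in> carrier (dual R M)" "\<And>r. r \<in> carrier R \<Longrightarrow> g (r \<odot>\<^bsub>M\<^esub> m) = r \<otimes>\<^bsub>R\<^esub> t"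
proof -
  interpret M: left_module R M using assms(1) by (simp add: cyclic_on_def)
  have reg: "left_module R (regular_module R)" by (rule left_module_regular[OF M.R.ring_axioms])
  note e = cyclic_on_epi[OF assms(1)]
  define p where "p = (\<lambda>r\<in>carrier R. r \<odot>\<^bsub>M\<^esub> m)"
  define f where "f = (\<lambda>r\<in>carrier R. r \<odot>\<^bsub>regular_module R\<^esub> t)"
  note e = e[folded p_def]
  have f: "f \<in> lin_maps R (regular_module R) (regular_module R)"
    unfolding f_def by (rule lin_maps_regular[OF reg]) (simp add: assms(2))
  have f0: "f u = \<zero>\<^bsub>regular_module R\<^esub>" if "u \<in> ker (regular_module R) p M" for u
    using that assms(3)[of u] unfolding e(2) using assms(1) by (simp add: f_def cyclic_on_def)
  obtain g where g: "g \<in> lin_maps R M (regular_module R)"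
    and gp: "\<And>u. u \<in> carrier (regular_module R) \<Longrightarrow> g (p u) = f u"
    using epi_factor[OF e(1) reg f f0] by blast
  have "g (r \<odot>\<^bsub>M\<^esub> m) = r \<otimes>\<^bsub>R\<^esub> t" if "r \<in> carrier R" for r
    using gp[of r] that by (simp add: p_def f_def)
  with g show ?thesis by (intro that) (simp_all add: dual_simps)
qed

lemma cyclic_on_dual_value:
  assumes "cyclic_on R M m U" "f \<in> carrier (dual R M)"
  shows "f m \<in> carrier R" "r \<in> carrier R \<Longrightarrow> f (r \<odot>\<^bsub>M\<^esub> m) = r \<otimes>\<^bsub>R\<^esub> f m"
    "r \<in> U \<Longrightarrow> r \<otimes>\<^bsub>R\<^esub> f m = \<zero>\<^bsub>R\<^esub>"
proof -
  interpret M: left_module R M using assms(1) by (simp add: cyclic_on_def)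
  have reg: "left_module R (regular_module R)" by (rule left_module_regular[OF M.R.ring_axioms])
  have f: "f \<in> lin_maps R M (regular_module R)" using assms(2) by (simp add: dual_simps)
  have m: "m \<in> carrier M" using assms(1) unfolding cyclic_on_def by blast
  show "f m \<in> carrier R" using lin_maps_closed[OF f m] by simp
  show fr: "f (r \<odot>\<^bsub>M\<^esub> m) = r \<otimes>\<^bsub>R\<^esub> f m" if "r \<in> carrier R" for r
    using lin_maps_smult[OF f that m] by simp
  show "r \<otimes>\<^bsub>R\<^esub> f m = \<zero>\<^bsub>R\<^esub>" if "r \<in> U"
  proof -
    have "r \<in> carrier R" "r \<odot>\<^bsub>M\<^esub> m = \<zero>\<^bsub>M\<^esub>" using that assms(1) unfolding cyclic_on_def by blast+
    then show ?thesis
      using fr[of r, symmetric] lin_maps_zero[OF M.left_module_axioms reg f] by simp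
  qed
qed

text \<open>Evaluation at the generator identifies the dual with the right annihilator of \<open>U\<close>.\<close>

lemma cyclic_on_dual:
  assumes M: "cyclic_on R M m U" and u: "u \<in> carrier R"
    and rann: "{t \<in> carrier R. \<forall>r\<in>U. r \<otimes>\<^bsub>R\<^esub> t = \<zero>\<^bsub>R\<^esub>} = {u \<otimes>\<^bsub>R\<^esub> s | s. s \<in> carrier R}"
  obtains g where "cyclic_on (opp_ring R) (dual R M) g {s \<in> carrier R. u \<otimes>\<^bsub>R\<^esub> s = \<zero>\<^bsub>R\<^esub>}"
    "\<And>r. r \<in> carrier R \<Longrightarrow> g (r \<odot>\<^bsub>M\<^esub> m) = r \<otimes>\<^bsub>R\<^esub> u"
proof -
  interpret M: left_module R M using M by (simp add: cyclic_on_def)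
  have D: "left_module (opp_ring R) (dual R M)" by (rule left_module_dual[OF M.left_module_axioms])
  interpret D: left_module "opp_ring R" "dual R M" by fact
  have m: "m \<in> carrier M" using M unfolding cyclic_on_def by blast
  have "u \<in> {u \<otimes>\<^bsub>R\<^esub> s | s. s \<in> carrier R}" using u by (intro CollectI exI[of _ "\<one>\<^bsub>R\<^esub>"]) simp
  then have ann_u: "r \<otimes>\<^bsub>R\<^esub> u = \<zero>\<^bsub>R\<^esub>" if "r \<in> U" for r using that unfolding rann[symmetric] by blast
  obtain g where g: "g \<in> carrier (dual R M)" and gr: "\<And>r. r \<in> carrier R \<Longrightarrow> g (r \<odot>\<^bsub>M\<^esub> m) = r \<otimes>\<^bsub>R\<^esub> u"
    using cyclic_on_hom[OF M u ann_u] by blast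
  have gm: "g m = u" using gr[of "\<one>\<^bsub>R\<^esub>"] m u by simp
  have eqI: "f = f'" if f: "f \<in> carrier (dual R M)" and f': "f' \<in> carrier (dual R M)" and "f m = f' m" for f f'
  proof (rule lin_maps_eqI[of _ R M "regular_module R"])
    fix x assume "x \<in> carrier M"
    then obtain r where r: "r \<in> carrier R" "x = r \<odot>\<^bsub>M\<^esub> m" by (rule cyclic_onE[OF M])
    then show "f x = f' x"
      using cyclic_on_dual_value(2)[OF M f r(1)] cyclic_on_dual_value(2)[OF M f' r(1)] that(3) by simp
  qed (use that in \<open>simp_all add: dual_simps\<close>)
  have sg: "s \<odot>\<^bsub>dual R M\<^esub> g \<in> carrier (dual R M)" "(s \<odot>\<^bsub>dual R M\<^esub> g) m = u \<otimes>\<^bsub>R\<^esub> s" if "s \<in> carrier R" for s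
    using D.smult_closed[of s g] that g m gm by (simp_all add: dual_simps(4))
  have "\<exists>s. f = s \<odot>\<^bsub>dual R M\<^esub> g \<and> s \<in> carrier R" if f: "f \<in> carrier (dual R M)" for f
  proof -
    have "f m \<in> {u \<otimes>\<^bsub>R\<^esub> s | s. s \<in> carrier R}"
      unfolding rann[symmetric] using cyclic_on_dual_value[OF M f] by blast
    then obtain s where s: "s \<in> carrier R" "f m = u \<otimes>\<^bsub>R\<^esub> s" by blast
    then have "f = s \<odot>\<^bsub>dual R M\<^esub> g" using sg[OF s(1)] f by (intro eqI) auto
    with s show ?thesis by blast
  qed
  then have gen: "carrier (dual R M) = {s \<odot>\<^bsub>dual R M\<^esub> g | s. s \<in> carrier (opp_ring R)}"
    using sg(1) by auto
  have "s \<odot>\<^bsub>dual R M\<^esub> g = \<zero>\<^bsub>dual R M\<^esub> \<longleftrightarrow> u \<otimes>\<^bsub>R\<^esub> s = \<zero>\<^bsub>R\<^esub>" if s: "s \<in> carrier R" for s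
    using eqI[OF sg(1)[OF s] D.M.zero_closed] sg(2)[OF s] m by (auto simp: dual_simps(2))
  then have ann: "{s \<in> carrier R. u \<otimes>\<^bsub>R\<^esub> s = \<zero>\<^bsub>R\<^esub>}
      = {s \<in> carrier (opp_ring R). s \<odot>\<^bsub>dual R M\<^esub> g = \<zero>\<^bsub>dual R M\<^esub>}"
    by auto
  show ?thesis
    by (rule that[OF _ gr]) (unfold cyclic_on_def, use D g gen ann in blast)
qed

section \<open>The left ideals \<open>U(a,b,c)\<close>\<close>

lemma lam_ex:
  assumes "r \<in> carrier (Lam q)"
  shows "\<exists>a0 a1 a2 a3 a4 a5. r = lam q a0 a1 a2 a3 a4 a5"
  using assms by (rule lam_cases) blast

lemma lam_submoduleD:
  assumes "submodule T (Lam q) (regular_module (Lam q))"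
  shows "T \<subseteq> carrier (Lam q)" "\<zero>\<^bsub>Lam q\<^esub> \<in> T"
    "r \<in> carrier (Lam q) \<Longrightarrow> x \<in> T \<Longrightarrow> r \<otimes>\<^bsub>Lam q\<^esub> x \<in> T"
    "x \<in> T \<Longrightarrow> y \<in> T \<Longrightarrow> x \<oplus>\<^bsub>Lam q\<^esub> y \<in> T"
proof -
  interpret submodule T "Lam q" "regular_module (Lam q)" by fact
  show "T \<subseteq> carrier (Lam q)" using subset by simp
  show "\<zero>\<^bsub>Lam q\<^esub> \<in> T" using one_closed by simp
  show "r \<in> carrier (Lam q) \<Longrightarrow> x \<in> T \<Longrightarrow> r \<otimes>\<^bsub>Lam q\<^esub> x \<in> T" using smult_closed[of r x] by simp
  show "x \<in> T \<Longrightarrow> y \<in> T \<Longrightarrow> x \<oplus>\<^bsub>Lam q\<^esub> y \<in> T" using m_closed[of x y] by simp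
qed

lemma line_submodule:
  "submodule {lam q 0 0 0 0 (t * e) (t * f) | t. True} (Lam q) (regular_module (Lam q))"
proof (rule regular_submoduleI[OF ring_Lam])
  fix r x assume "r \<in> carrier (Lam q)" "x \<in> {lam q 0 0 0 0 (t * e) (t * f) | t. True}"
  then obtain r0 r1 r2 r3 r4 r5 t where "r = lam q r0 r1 r2 r3 r4 r5" "x = lam q 0 0 0 0 (t * e) (t * f)"
    by (auto elim: lam_cases)
  then show "r \<otimes>\<^bsub>Lam q\<^esub> x \<in> {lam q 0 0 0 0 (t * e) (t * f) | t. True}"
    by (intro CollectI exI[of _ "r0 * t"]) (simp add: lam_simps algebra_simps)
next
  fix x y assume "x \<in> {lam q 0 0 0 0 (t * e) (t * f) | t. True}" "y \<in> {lam q 0 0 0 0 (t * e) (t * f) | t. True}"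
  then obtain s t where "x = lam q 0 0 0 0 (s * e) (s * f)" "y = lam q 0 0 0 0 (t * e) (t * f)" by auto
  then show "x \<oplus>\<^bsub>Lam q\<^esub> y \<in> {lam q 0 0 0 0 (t * e) (t * f) | t. True}"
    by (intro CollectI exI[of _ "s + t"]) (simp add: lam_simps algebra_simps)
qed (auto simp: lam_zero intro!: exI[of _ 0])

text \<open>Every left ideal containing an element outside \<open>J\<^sup>2\<close> contains a line of \<open>J\<^sup>2\<close> properly, hence is not
  simple, whereas the lines of \<open>J\<^sup>2\<close> are simple.\<close>

lemma socle_Lam:
  assumes q: "q \<noteq> 0"
  shows "socle (Lam q) (regular_module (Lam q)) = {lam q 0 0 0 0 e f | e f. True}" (is "_ = ?S")
proof
  let ?l = "\<lambda>e f. {lam q 0 0 0 0 (t * e) (t * f) | t. True}"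
  have S: "submodule ?S (Lam q) (regular_module (Lam q))"
  proof (rule regular_submoduleI[OF ring_Lam])
    fix r x assume "r \<in> carrier (Lam q)" "x \<in> ?S"
    then show "r \<otimes>\<^bsub>Lam q\<^esub> x \<in> ?S" by (elim lam_cases) (auto simp: lam_simps)
  qed (auto simp: lam_simps)
  have "T \<subseteq> ?S" if T: "simple_submodule (Lam q) (regular_module (Lam q)) T" for T
  proof
    fix s assume s: "s \<in> T"
    have sub: "submodule T (Lam q) (regular_module (Lam q))"
      and min: "\<And>e f. ?l e f \<subseteq> T \<Longrightarrow> (e, f) \<noteq> (0, 0) \<Longrightarrow> ?l e f = T"
    proof -
      show "submodule T (Lam q) (regular_module (Lam q))" using T by (simp add: simple_submodule_def)
      fix e f assume "?l e f \<subseteq> T" "(e, f) \<noteq> (0, 0)"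
      moreover have "lam q 0 0 0 0 (1 * e) (1 * f) \<in> ?l e f" by blast
      moreover from \<open>(e, f) \<noteq> (0, 0)\<close> have "lam q 0 0 0 0 (1 * e) (1 * f) \<noteq> \<zero>\<^bsub>Lam q\<^esub>"
        by (auto simp: lam_simps)
      ultimately have "?l e f \<noteq> {\<zero>\<^bsub>Lam q\<^esub>}" by blast
      then show "?l e f = T"
        using T \<open>?l e f \<subseteq> T\<close> line_submodule[of q e f] by (auto simp: simple_submodule_def)
    qed
    have line: "?l e f \<subseteq> T" if "lam q 0 0 0 0 e f \<in> T" for e f
    proof
      fix x assume "x \<in> ?l e f"
      then obtain t where "x = lam q t 0 0 0 0 0 \<otimes>\<^bsub>Lam q\<^esub> lam q 0 0 0 0 e f" by (auto simp: lam_simps)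
      then show "x \<in> T" using lam_submoduleD(3)[OF sub lam_closed that] by simp
    qed
    obtain s0 s1 s2 s3 s4 s5 where sl: "s = lam q s0 s1 s2 s3 s4 s5"
      using lam_ex[OF subsetD[OF lam_submoduleD(1)[OF sub] s]] by blast
    have mem: "r \<otimes>\<^bsub>Lam q\<^esub> s \<in> T" if "r \<in> carrier (Lam q)" for r
      by (rule lam_submoduleD(3)[OF sub that s])
    show "s \<in> ?S"
    proof (rule ccontr)
      assume "s \<notin> ?S"
      then have ne: "(s0, s1, s2, s3) \<noteq> (0, 0, 0, 0)" by (auto simp: sl)
      have notline: "T \<noteq> ?l e f" for e f
      proof
        assume "T = ?l e f"
        then show False using s ne by (auto simp: sl lam_simps)
      qed
      have zero: "e = 0 \<and> f = 0" if "lam q 0 0 0 0 e f \<in> T" for e f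
        using min[OF line[OF that]] notline[of e f] by auto
      have "lam q 0 0 0 0 s0 0 \<in> T"
        using mem[of "lam q 0 0 0 0 1 0"] by (simp add: sl lam_simps)
      then have s0: "s0 = 0" using zero by blast
      have "lam q 0 0 0 0 (- (q * s2)) s3 \<in> T" "lam q 0 0 0 0 s1 0 \<in> T"
        using mem[of "lam q 0 1 0 0 0 0"] mem[of "lam q 0 0 1 0 0 0"] by (simp_all add: sl lam_simps s0)
      then show False using zero[of "- (q * s2)" s3] zero[of s1 0] q ne s0 by simp
    qed
  qed
  then show "socle (Lam q) (regular_module (Lam q)) \<subseteq> ?S"
    unfolding socle_def using S by blast
  show "?S \<subseteq> socle (Lam q) (regular_module (Lam q))"
    unfolding socle_def
  proof (intro Inter_greatest subsetI)
    fix N x assume N: "N \<in> {N. submodule N (Lam q) (regular_module (Lam q)) \<and>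
        (\<forall>S. simple_submodule (Lam q) (regular_module (Lam q)) S \<longrightarrow> S \<subseteq> N)}" and "x \<in> ?S"
    then obtain e f where x: "x = lam q 0 0 0 0 e f" by blast
    show "x \<in> N"
    proof (cases "e = 0 \<and> f = 0")
      case True
      then show ?thesis using N lam_submoduleD(2)[of N q] by (simp add: x lam_zero)
    next
      case False
      have xl: "x \<in> ?l e f" using x by (auto intro!: exI[of _ 1])
      have "simple_submodule (Lam q) (regular_module (Lam q)) (?l e f)"
        unfolding simple_submodule_def
      proof (intro conjI allI impI line_submodule)
        have "x \<noteq> \<zero>\<^bsub>Lam q\<^esub>" using False by (simp add: x lam_simps)
        then show "?l e f \<noteq> {\<zero>\<^bsub>regular_module (Lam q)\<^esub>}" using xl by auto
        fix T assume T: "submodule T (Lam q) (regular_module (Lam q)) \<and> T \<subseteq> ?l e f"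
        note sub = T[THEN conjunct1]
        show "T = {\<zero>\<^bsub>regular_module (Lam q)\<^esub>} \<or> T = ?l e f"
        proof (cases "T \<subseteq> {\<zero>\<^bsub>Lam q\<^esub>}")
          case True
          then show ?thesis using lam_submoduleD(2)[OF sub] by auto
        next
          case False
          then obtain y where y: "y \<in> T" "y \<noteq> \<zero>\<^bsub>Lam q\<^esub>" by blast
          then obtain t where "y = lam q 0 0 0 0 (t * e) (t * f)" using T by blast
          then have t: "lam q 0 0 0 0 (t * e) (t * f) \<in> T" "t \<noteq> 0" using y by (auto simp: lam_simps)
          have "?l e f \<subseteq> T"
          proof
            fix y assume "y \<in> ?l e f"
            then obtain s where "y = lam q (s / t) 0 0 0 0 0 \<otimes>\<^bsub>Lam q\<^esub> lam q 0 0 0 0 (t * e) (t * f)"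
              using t(2) by (auto simp: lam_simps)
            then show "y \<in> T" using lam_submoduleD(3)[OF sub lam_closed t(1)] by simp
          qed
          then show ?thesis using T by blast
        qed
      qed
      then show ?thesis using N xl by blast
    qed
  qed
qed

lemma set_add_iff: "x \<in> A <+>\<^bsub>G\<^esub> B \<longleftrightarrow> (\<exists>a\<in>A. \<exists>b\<in>B. x = a \<oplus>\<^bsub>G\<^esub> b)"
  by (auto simp: set_add_def')

lemma Lam_U_eq:
  assumes q: "q \<noteq> 0"
  shows "Lam_U q a b c = {lam q 0 (t * a) (t * b) (t * c) e f | t e f. True}"
proof -
  let ?w = "Lam_scalar q a \<otimes>\<^bsub>Lam q\<^esub> Lam_gen q Gx \<oplus>\<^bsub>Lam q\<^esub> Lam_scalar q b \<otimes>\<^bsub>Lam q\<^esub> Lam_gen q Gy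
      \<oplus>\<^bsub>Lam q\<^esub> Lam_scalar q c \<otimes>\<^bsub>Lam q\<^esub> Lam_gen q Gz"
  have w: "?w = lam q 0 a b c 0 0" by (simp add: Lam_scalar_lam Lam_gen_lam lam_simps)
  show ?thesis
    unfolding Lam_U_def w socle_Lam[OF q]
  proof (intro equalityI subsetI)
    fix x assume "x \<in> {r \<otimes>\<^bsub>Lam q\<^esub> lam q 0 a b c 0 0 |r. r \<in> carrier (Lam q)} <+>\<^bsub>Lam q\<^esub> {lam q 0 0 0 0 e f | e f. True}"
    then obtain r e f where r: "r \<in> carrier (Lam q)"
      and x: "x = r \<otimes>\<^bsub>Lam q\<^esub> lam q 0 a b c 0 0 \<oplus>\<^bsub>Lam q\<^esub> lam q 0 0 0 0 e f"
      unfolding set_add_iff by auto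
    obtain r0 r1 r2 r3 r4 r5 where "r = lam q r0 r1 r2 r3 r4 r5" using r by (rule lam_cases)
    then have "x = lam q 0 (r0 * a) (r0 * b) (r0 * c) (r2 * a - q * (r1 * b) + e) (r3 * a + r1 * c + r3 * b + f)"
      by (simp add: x lam_simps)
    then show "x \<in> {lam q 0 (t * a) (t * b) (t * c) e f | t e f. True}" by blast
  next
    fix x assume "x \<in> {lam q 0 (t * a) (t * b) (t * c) e f | t e f. True}"
    then obtain t e f where "x = lam q t 0 0 0 0 0 \<otimes>\<^bsub>Lam q\<^esub> lam q 0 a b c 0 0 \<oplus>\<^bsub>Lam q\<^esub> lam q 0 0 0 0 e f"
      by (auto simp: lam_simps)
    then show "x \<in> {r \<otimes>\<^bsub>Lam q\<^esub> lam q 0 a b c 0 0 |r. r \<in> carrier (Lam q)} <+>\<^bsub>Lam q\<^esub> {lam q 0 0 0 0 e f | e f. True}"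
      unfolding set_add_iff using lam_closed by blast
  qed
qed

lemma lam_mem_Lam_U:
  assumes "q \<noteq> 0"
  shows "lam q a0 a1 a2 a3 a4 a5 \<in> Lam_U q 1 b c \<longleftrightarrow> a0 = 0 \<and> a2 = a1 * b \<and> a3 = a1 * c"
  by (auto simp: Lam_U_eq[OF assms] lam_inject)

lemma Lam_U_closed: "q \<noteq> 0 \<Longrightarrow> Lam_U q a b c \<subseteq> carrier (Lam q)"
  by (auto simp: Lam_U_eq)

lemma Lam_U_submodule:
  assumes "q \<noteq> 0"
  shows "submodule (Lam_U q a b c) (Lam q) (regular_module (Lam q))"
  unfolding Lam_U_eq[OF assms]
proof (rule regular_submoduleI[OF ring_Lam])
  let ?U = "{lam q 0 (t * a) (t * b) (t * c) e f | t e f. True}"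
  fix x y assume "x \<in> ?U" "y \<in> ?U"
  then obtain s e f t e' f' where "x = lam q 0 (s * a) (s * b) (s * c) e f" "y = lam q 0 (t * a) (t * b) (t * c) e' f'"
    by auto
  then show "x \<oplus>\<^bsub>Lam q\<^esub> y \<in> ?U"
    by (intro CollectI exI[of _ "s + t", OF exI[of _ "e + e'", OF exI[of _ "f + f'"]]])
      (simp add: lam_simps algebra_simps)
next
  let ?U = "{lam q 0 (t * a) (t * b) (t * c) e f | t e f. True}"
  fix r x assume "r \<in> carrier (Lam q)" "x \<in> ?U"
  then obtain r0 r1 r2 r3 r4 r5 t e f where
    "r = lam q r0 r1 r2 r3 r4 r5" "x = lam q 0 (t * a) (t * b) (t * c) e f"
    by (auto elim: lam_cases)
  then have "r \<otimes>\<^bsub>Lam q\<^esub> x = lam q 0 ((r0 * t) * a) ((r0 * t) * b) ((r0 * t) * c)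
      (r0 * e + r2 * (t * a) - q * (r1 * (t * b))) (r0 * f + r3 * (t * a) + r1 * (t * c) + r3 * (t * b))"
    by (simp add: lam_simps)
  then show "r \<otimes>\<^bsub>Lam q\<^esub> x \<in> ?U" by blast
qed (auto simp: lam_zero intro!: exI[of _ 0])

lemma Lam_M_cyclic:
  assumes "q \<noteq> 0"
  obtains m where "cyclic_on (Lam q) (Lam_M q a b c) m (Lam_U q a b c)"
  using quotient_module_cyclic[OF ring_Lam Lam_U_submodule[OF assms]] unfolding Lam_M_def by blast

lemma module_iso_Lam_M_iff:
  assumes "q \<noteq> 0" "left_module (Lam q) M"
  shows "module_iso (Lam q) M (Lam_M q a b c) \<longleftrightarrow> (\<exists>m. cyclic_on (Lam q) M m (Lam_U q a b c))"
  using Lam_M_cyclic[OF assms(1)] cyclic_on_iso[OF _ assms(2)] module_iso_cyclic by metis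

text \<open>For \<open>w = x + by + cz\<close> the right ideal generated by \<open>w\<close> always contains the socle, the left ideal
  does if \<open>b \<noteq> -1\<close>. Annihilators have complementary dimension \<open>3\<close> in these cases, and are again of the
  form \<open>U(1,b',c')\<close>.\<close>

lemma left_ideal_gen:
  assumes "q \<noteq> 0" "1 + b \<noteq> 0"
  shows "{s \<otimes>\<^bsub>Lam q\<^esub> lam q 0 1 b c 0 0 | s. s \<in> carrier (Lam q)} = Lam_U q 1 b c"
proof (intro equalityI subsetI)
  fix x assume "x \<in> {s \<otimes>\<^bsub>Lam q\<^esub> lam q 0 1 b c 0 0 | s. s \<in> carrier (Lam q)}"
  then show "x \<in> Lam_U q 1 b c" by (auto simp: lam_mult lam_mem_Lam_U[OF assms(1)] elim!: lam_cases)
next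
  fix x assume "x \<in> Lam_U q 1 b c"
  then obtain t e f where "x = lam q 0 t (t * b) (t * c) e f" by (auto simp: Lam_U_eq[OF assms(1)])
  moreover have "f / (1 + b) + f / (1 + b) * b = f / (1 + b) * (1 + b)" by (simp only: distrib_left mult_1_right)
  ultimately have "x = lam q t 0 e (f / (1 + b)) 0 0 \<otimes>\<^bsub>Lam q\<^esub> lam q 0 1 b c 0 0"
    using assms by (simp add: lam_simps)
  then show "x \<in> {s \<otimes>\<^bsub>Lam q\<^esub> lam q 0 1 b c 0 0 | s. s \<in> carrier (Lam q)}" using lam_closed by blast
qed

lemma left_annihilator:
  assumes "q \<noteq> 0" "1 + b \<noteq> 0"
  shows "{r \<in> carrier (Lam q). r \<otimes>\<^bsub>Lam q\<^esub> lam q 0 1 b c 0 0 = \<zero>\<^bsub>Lam q\<^esub>} = Lam_U q 1 (q * b) (- c / (1 + b))"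
proof (rule Set.set_eqI)
  fix r
  have "r \<otimes>\<^bsub>Lam q\<^esub> lam q 0 1 b c 0 0 = \<zero>\<^bsub>Lam q\<^esub> \<longleftrightarrow> r \<in> Lam_U q 1 (q * b) (- c / (1 + b))"
    if rL: "r \<in> carrier (Lam q)"
  proof -
    obtain r0 r1 r2 r3 r4 r5 where r: "r = lam q r0 r1 r2 r3 r4 r5" using lam_ex[OF rL] by blast
    have "r3 + r1 * c + r3 * b = 0 \<longleftrightarrow> r3 = - (r1 * c) / (1 + b)"
    proof -
      have "r3 + r1 * c + r3 * b = r3 * (1 + b) - - (r1 * c)" by (simp add: algebra_simps)
      then show ?thesis by (simp only: nonzero_eq_divide_eq[OF assms(2)] right_minus_eq)
    qed
    then show ?thesis
      by (auto simp: r lam_mult lam_zero lam_inject lam_mem_Lam_U[OF assms(1)] mult_ac)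
  qed
  then show "r \<in> {r \<in> carrier (Lam q). r \<otimes>\<^bsub>Lam q\<^esub> lam q 0 1 b c 0 0 = \<zero>\<^bsub>Lam q\<^esub>}
      \<longleftrightarrow> r \<in> Lam_U q 1 (q * b) (- c / (1 + b))"
    using Lam_U_closed[OF assms(1)] by blast
qed

lemma right_ideal_gen:
  assumes "q \<noteq> 0"
  shows "{lam q 0 1 b c 0 0 \<otimes>\<^bsub>Lam q\<^esub> s | s. s \<in> carrier (Lam q)} = Lam_U q 1 b c"
proof (intro equalityI subsetI)
  fix x assume "x \<in> {lam q 0 1 b c 0 0 \<otimes>\<^bsub>Lam q\<^esub> s | s. s \<in> carrier (Lam q)}"
  then show "x \<in> Lam_U q 1 b c" by (auto simp: lam_mult lam_mem_Lam_U[OF assms(1)] mult_ac elim!: lam_cases)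
next
  fix x assume "x \<in> Lam_U q 1 b c"
  then obtain t e f where "x = lam q 0 t (t * b) (t * c) e f" by (auto simp: Lam_U_eq[OF assms(1)])
  then have "x = lam q 0 1 b c 0 0 \<otimes>\<^bsub>Lam q\<^esub> lam q t 0 (- e / q) (f + c * e / q) 0 0"
    using assms by (simp add: lam_simps field_simps)
  then show "x \<in> {lam q 0 1 b c 0 0 \<otimes>\<^bsub>Lam q\<^esub> s | s. s \<in> carrier (Lam q)}" using lam_closed by blast
qed

lemma right_annihilator:
  assumes "q \<noteq> 0"
  shows "{s \<in> carrier (Lam q). lam q 0 1 b c 0 0 \<otimes>\<^bsub>Lam q\<^esub> s = \<zero>\<^bsub>Lam q\<^esub>} = Lam_U q 1 (b / q) (- c * (1 + b / q))"
proof (rule Set.set_eqI)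
  fix s
  have "lam q 0 1 b c 0 0 \<otimes>\<^bsub>Lam q\<^esub> s = \<zero>\<^bsub>Lam q\<^esub> \<longleftrightarrow> s \<in> Lam_U q 1 (b / q) (- c * (1 + b / q))"
    if sL: "s \<in> carrier (Lam q)"
  proof -
    obtain s0 s1 s2 s3 s4 s5 where s: "s = lam q s0 s1 s2 s3 s4 s5" using lam_ex[OF sL] by blast
    have "b * s1 - q * s2 = 0 \<longleftrightarrow> s2 = s1 * (b / q)"
      using assms by (auto simp: field_simps)
    moreover have "c * s1 + s3 + c * s2 = 0 \<longleftrightarrow> s3 = s1 * (- c * (1 + b / q))" if "s2 = s1 * (b / q)"
      unfolding that by (simp add: eq_neg_iff_add_eq_0 algebra_simps)
    ultimately show ?thesis
      by (auto simp: s lam_mult lam_zero lam_inject lam_mem_Lam_U[OF assms(1)])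
  qed
  then show "s \<in> {s \<in> carrier (Lam q). lam q 0 1 b c 0 0 \<otimes>\<^bsub>Lam q\<^esub> s = \<zero>\<^bsub>Lam q\<^esub>}
      \<longleftrightarrow> s \<in> Lam_U q 1 (b / q) (- c * (1 + b / q))"
    using Lam_U_closed[OF assms(1)] by blast
qed

text \<open>An element annihilated by \<open>w\<close> has constant term \<open>0\<close>, so the socle annihilates it as well.\<close>

lemma right_annihilator_Lam_U:
  assumes q: "q \<noteq> 0"
  shows "{t \<in> carrier (Lam q). \<forall>r\<in>Lam_U q 1 b c. r \<otimes>\<^bsub>Lam q\<^esub> t = \<zero>\<^bsub>Lam q\<^esub>} = Lam_U q 1 (b / q) (- c * (1 + b / q))"
  unfolding right_annihilator[OF q, symmetric]
proof (intro Collect_cong conj_cong refl)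
  fix t assume t: "t \<in> carrier (Lam q)"
  show "(\<forall>r\<in>Lam_U q 1 b c. r \<otimes>\<^bsub>Lam q\<^esub> t = \<zero>\<^bsub>Lam q\<^esub>) \<longleftrightarrow> lam q 0 1 b c 0 0 \<otimes>\<^bsub>Lam q\<^esub> t = \<zero>\<^bsub>Lam q\<^esub>"
  proof
    assume "\<forall>r\<in>Lam_U q 1 b c. r \<otimes>\<^bsub>Lam q\<^esub> t = \<zero>\<^bsub>Lam q\<^esub>"
    moreover have "lam q 0 1 b c 0 0 \<in> Lam_U q 1 b c" by (simp add: lam_mem_Lam_U[OF q])
    ultimately show "lam q 0 1 b c 0 0 \<otimes>\<^bsub>Lam q\<^esub> t = \<zero>\<^bsub>Lam q\<^esub>" by blast
  next
    assume w: "lam q 0 1 b c 0 0 \<otimes>\<^bsub>Lam q\<^esub> t = \<zero>\<^bsub>Lam q\<^esub>"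
    obtain t0 t1 t2 t3 t4 t5 where tl: "t = lam q t0 t1 t2 t3 t4 t5" using t by (rule lam_cases)
    have t0: "t0 = 0" using w by (simp add: tl lam_simps)
    show "\<forall>r\<in>Lam_U q 1 b c. r \<otimes>\<^bsub>Lam q\<^esub> t = \<zero>\<^bsub>Lam q\<^esub>"
    proof
      fix r assume "r \<in> Lam_U q 1 b c"
      then obtain s e f where "r = lam q 0 s (s * b) (s * c) e f" by (auto simp: Lam_U_eq[OF q])
      then have "r \<otimes>\<^bsub>Lam q\<^esub> t = lam q s 0 0 0 0 0 \<otimes>\<^bsub>Lam q\<^esub> (lam q 0 1 b c 0 0 \<otimes>\<^bsub>Lam q\<^esub> t)"
        by (simp add: tl t0 lam_simps algebra_simps)
      then show "r \<otimes>\<^bsub>Lam q\<^esub> t = \<zero>\<^bsub>Lam q\<^esub>" by (simp add: w)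
    qed
  qed
qed

text \<open>The dual of \<open>M(1,b,c)\<close> is the right ideal generated by \<open>u = x + (b/q) y - c (1 + b/q) z\<close>, with \<open>u\<close> being the value at
  the generator of \<open>M(1,b,c)\<close> of the generator \<open>g\<close> of the dual.\<close>

lemma dual_cyclic_Lam:
  assumes q: "q \<noteq> 0" and M: "cyclic_on (Lam q) M m (Lam_U q 1 b c)"
  obtains g where "cyclic_on (opp_ring (Lam q)) (dual (Lam q) M) g
      (Lam_U q 1 (b / q / q) (c * (1 + b / q) * (1 + b / q / q)))"
    "\<And>r. r \<in> carrier (Lam q) \<Longrightarrow>
      g (r \<odot>\<^bsub>M\<^esub> m) = r \<otimes>\<^bsub>Lam q\<^esub> lam q 0 1 (b / q) (- c * (1 + b / q)) 0 0"
proof (rule cyclic_on_dual[OF M, of "lam q 0 1 (b / q) (- c * (1 + b / q)) 0 0"])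
  show "{t \<in> carrier (Lam q). \<forall>r\<in>Lam_U q 1 b c. r \<otimes>\<^bsub>Lam q\<^esub> t = \<zero>\<^bsub>Lam q\<^esub>}
      = {lam q 0 1 (b / q) (- c * (1 + b / q)) 0 0 \<otimes>\<^bsub>Lam q\<^esub> s | s. s \<in> carrier (Lam q)}"
    unfolding right_annihilator_Lam_U[OF q] right_ideal_gen[OF q] ..
  fix g assume "cyclic_on (opp_ring (Lam q)) (dual (Lam q) M) g
       {s \<in> carrier (Lam q). lam q 0 1 (b / q) (- c * (1 + b / q)) 0 0 \<otimes>\<^bsub>Lam q\<^esub> s = \<zero>\<^bsub>Lam q\<^esub>}"
    and gr: "\<And>r. r \<in> carrier (Lam q) \<Longrightarrow>
      g (r \<odot>\<^bsub>M\<^esub> m) = r \<otimes>\<^bsub>Lam q\<^esub> lam q 0 1 (b / q) (- c * (1 + b / q)) 0 0"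
  then show thesis
    by (intro that[OF _ gr]) (simp_all add: right_annihilator[OF q] algebra_simps)
qed simp_all

section \<open>The modules \<open>M(1,-q,c)\<close>\<close>

text \<open>The parameters \<open>(-q\<^sup>n\<^sup>+\<^sup>1, c\<^sub>n)\<close> of the successive syzygies satisfy \<open>c\<^sub>n\<^sub>+\<^sub>1 = - c\<^sub>n / (1 - q\<^sup>n\<^sup>+\<^sup>1)\<close>; passing to
  right annihilators runs through the same sequence backwards.\<close>

lemma semi_Gorenstein_projective_M:
  fixes q :: "'k::field"
  assumes q: "q \<noteq> 0" "\<forall>n::nat. n > 0 \<longrightarrow> q ^ n \<noteq> 1"
    and M: "cyclic_on (Lam q) M m (Lam_U q 1 (- q) c)"
  shows "semi_Gorenstein_projective (Lam q) M"
proof -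
  define cc where "cc = rec_nat c (\<lambda>n c. - c / (1 + - (q ^ Suc n)))"
  have cc: "cc 0 = c" "cc (Suc n) = - cc n / (1 + - (q ^ Suc n))" for n by (simp_all add: cc_def)
  define w where "w n = lam q 0 1 (- (q ^ Suc n)) (cc n) 0 0" for n
  have ne: "1 + - (q ^ Suc n) \<noteq> 0" for n using q(2) by (metis add.right_neutral add_uminus_conv_diff eq_iff_diff_eq_0 zero_less_Suc)
  have gen: "{s \<otimes>\<^bsub>Lam q\<^esub> w n | s. s \<in> carrier (Lam q)} = Lam_U q 1 (- (q ^ Suc n)) (cc n)" for n
    unfolding w_def by (rule left_ideal_gen[OF q(1) ne])
  show ?thesis
  proof (rule semi_Gorenstein_projective_cyclic[of _ _ m w])
    show "cyclic_on (Lam q) M m {s \<otimes>\<^bsub>Lam q\<^esub> w 0 | s. s \<in> carrier (Lam q)}"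
      using M by (simp add: gen cc)
    show "w n \<in> carrier (Lam q)" for n by (simp add: w_def)
    show "{r \<in> carrier (Lam q). r \<otimes>\<^bsub>Lam q\<^esub> w n = \<zero>\<^bsub>Lam q\<^esub>}
        = {s \<otimes>\<^bsub>Lam q\<^esub> w (Suc n) | s. s \<in> carrier (Lam q)}" for n
      unfolding gen cc(2) by (simp add: w_def left_annihilator[OF q(1) ne, simplified])
    show "\<exists>s\<in>carrier (Lam q). t = w n \<otimes>\<^bsub>Lam q\<^esub> s"
      if "t \<in> carrier (Lam q)" "w (Suc n) \<otimes>\<^bsub>Lam q\<^esub> t = \<zero>\<^bsub>Lam q\<^esub>" for n t
    proof -
      have "t \<in> {s \<in> carrier (Lam q). w (Suc n) \<otimes>\<^bsub>Lam q\<^esub> s = \<zero>\<^bsub>Lam q\<^esub>}" using that by simp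
      also have "\<dots> = Lam_U q 1 (- (q ^ Suc (Suc n)) / q) (- cc (Suc n) * (1 + - (q ^ Suc (Suc n)) / q))"
        unfolding w_def by (rule right_annihilator[OF q(1)])
      also have "- (q ^ Suc (Suc n)) / q = - (q ^ Suc n)" using q(1) by simp
      also have "- cc (Suc n) * (1 + - (q ^ Suc n)) = cc n" unfolding cc(2) using ne[of n] by simp
      also have "Lam_U q 1 (- (q ^ Suc n)) (cc n) = {w n \<otimes>\<^bsub>Lam q\<^esub> s | s. s \<in> carrier (Lam q)}"
        unfolding w_def by (rule right_ideal_gen[OF q(1), symmetric])
      finally show ?thesis by blast
    qed
  qed
qed

lemma semi_Gorenstein_projective_dual:
  fixes q :: "'k::field"
  assumes q: "q \<noteq> 0" "\<forall>n::nat. n > 0 \<longrightarrow> q ^ n \<noteq> 1"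
    and N: "cyclic_on (opp_ring (Lam q)) N g (Lam_U q 1 (- 1 / q) 0)"
  shows "semi_Gorenstein_projective (opp_ring (Lam q)) N"
proof -
  define w where "w n = lam q 0 1 (- 1 / q ^ Suc n) 0 0 0" for n
  have ne: "1 + - 1 / q ^ Suc n \<noteq> 0" for n
    using q by (simp add: field_simps del: power_Suc)
  have gen: "{w n \<otimes>\<^bsub>Lam q\<^esub> s | s. s \<in> carrier (Lam q)} = Lam_U q 1 (- 1 / q ^ Suc n) 0" for n
    unfolding w_def by (rule right_ideal_gen[OF q(1)])
  show ?thesis
  proof (rule semi_Gorenstein_projective_cyclic[of _ _ g w], unfold opp_ring_simps)
    show "cyclic_on (opp_ring (Lam q)) N g {w 0 \<otimes>\<^bsub>Lam q\<^esub> s | s. s \<in> carrier (Lam q)}"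
      using N by (simp add: gen)
    show "w n \<in> carrier (Lam q)" for n by (simp add: w_def)
    show "{r \<in> carrier (Lam q). w n \<otimes>\<^bsub>Lam q\<^esub> r = \<zero>\<^bsub>Lam q\<^esub>}
        = {w (Suc n) \<otimes>\<^bsub>Lam q\<^esub> s | s. s \<in> carrier (Lam q)}" for n
      unfolding gen by (simp add: w_def right_annihilator[OF q(1)] mult.commute)
    show "\<exists>s\<in>carrier (Lam q). t = s \<otimes>\<^bsub>Lam q\<^esub> w n"
      if "t \<in> carrier (Lam q)" "t \<otimes>\<^bsub>Lam q\<^esub> w (Suc n) = \<zero>\<^bsub>Lam q\<^esub>" for n t
    proof -
      have "t \<in> {s \<in> carrier (Lam q). s \<otimes>\<^bsub>Lam q\<^esub> w (Suc n) = \<zero>\<^bsub>Lam q\<^esub>}" using that by simp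
      also have "\<dots> = Lam_U q 1 (q * (- 1 / q ^ Suc (Suc n))) (- 0 / (1 + - 1 / q ^ Suc (Suc n)))"
        unfolding w_def by (rule left_annihilator[OF q(1) ne])
      also have "q * (- 1 / q ^ Suc (Suc n)) = - 1 / q ^ Suc n" using q(1) by simp
      also have "Lam_U q 1 (- 1 / q ^ Suc n) (- 0 / (1 + - 1 / q ^ Suc (Suc n)))
          = {s \<otimes>\<^bsub>Lam q\<^esub> w n | s. s \<in> carrier (Lam q)}"
        unfolding w_def using left_ideal_gen[OF q(1) ne] by simp
      finally show ?thesis by blast
    qed
  qed
qed

lemma dual_M:
  assumes q: "q \<noteq> 0" and M: "cyclic_on (Lam q) M m (Lam_U q 1 (- q) c)"
  obtains g where "cyclic_on (opp_ring (Lam q)) (dual (Lam q) M) g (Lam_U q 1 (- 1 / q) 0)"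
proof -
  obtain g where "cyclic_on (opp_ring (Lam q)) (dual (Lam q) M) g
      (Lam_U q 1 (- q / q / q) (c * (1 + - q / q) * (1 + - q / q / q)))"
    using dual_cyclic_Lam[OF q M] by blast
  then show ?thesis using q by (intro that[of g]) simp
qed

text \<open>The element \<open>z m\<close> is annihilated by all maps to \<open>\<Lambda>\<close>, since these send \<open>m\<close> to elements of
  the right ideal of \<open>x - y\<close>, and \<open>z (x - y) = 0\<close>.\<close>

lemma not_torsionless_M:
  assumes q: "q \<noteq> 0" and M: "cyclic_on (Lam q) M m (Lam_U q 1 (- q) c)"
  shows "\<not> torsionless (Lam q) M"
proof
  let ?z = "lam q 0 0 0 1 0 0"
  interpret M: left_module "Lam q" M using M by (simp add: cyclic_on_def)
  assume tl: "torsionless (Lam q) M"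
  have m: "m \<in> carrier M" using M unfolding cyclic_on_def by blast
  have "canonical_map (Lam q) M (?z \<odot>\<^bsub>M\<^esub> m) = canonical_map (Lam q) M \<zero>\<^bsub>M\<^esub>"
    unfolding canonical_map_def
  proof (rule restrict_ext)
    fix f assume f: "f \<in> carrier (dual (Lam q) M)"
    have "f m \<in> {t \<in> carrier (Lam q). \<forall>r\<in>Lam_U q 1 (- q) c. r \<otimes>\<^bsub>Lam q\<^esub> t = \<zero>\<^bsub>Lam q\<^esub>}"
      using cyclic_on_dual_value(1,3)[OF M f] by simp
    then have "f m \<in> Lam_U q 1 (- 1) 0"
      using q unfolding right_annihilator_Lam_U[OF q] by simp
    then obtain t e f' where "f m = lam q 0 t (- t) 0 e f'"
      by (auto simp: Lam_U_eq[OF q])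
    then have "?z \<otimes>\<^bsub>Lam q\<^esub> f m = \<zero>\<^bsub>Lam q\<^esub>" by (simp add: lam_simps)
    then have "f (?z \<odot>\<^bsub>M\<^esub> m) = \<zero>\<^bsub>Lam q\<^esub>"
      using cyclic_on_dual_value(2)[OF M f lam_closed] by simp
    moreover have "f \<zero>\<^bsub>M\<^esub> = \<zero>\<^bsub>Lam q\<^esub>"
      using f lin_maps_zero[OF M.left_module_axioms left_module_regular[OF ring_Lam], of f] by (simp add: dual_simps(1))
    ultimately show "f (?z \<odot>\<^bsub>M\<^esub> m) = f \<zero>\<^bsub>M\<^esub>" by simp
  qed
  then have "?z \<odot>\<^bsub>M\<^esub> m = \<zero>\<^bsub>M\<^esub>"
    by (rule inj_onD[OF tl[unfolded torsionless_def]]) (simp_all add: m)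
  moreover have "Lam_U q 1 (- q) c = {r \<in> carrier (Lam q). r \<odot>\<^bsub>M\<^esub> m = \<zero>\<^bsub>M\<^esub>}"
    using M by (simp add: cyclic_on_def)
  ultimately have "?z \<in> Lam_U q 1 (- q) c" by simp
  then show False by (simp add: lam_mem_Lam_U[OF q])
qed

lemma not_reflexive_if_not_torsionless: "\<not> torsionless R M \<Longrightarrow> \<not> reflexive R M"
  by (auto simp: torsionless_def reflexive_def bij_betw_def)

section \<open>Reflexivity\<close>

lemma reflexive_zero_module:
  assumes M: "left_module R M" and zero: "carrier M = {\<zero>\<^bsub>M\<^esub>}"
  shows "reflexive R M"
proof -
  interpret M: left_module R M by fact
  have D: "left_module (opp_ring R) (dual R M)" by (rule left_module_dual[OF M])
  have reg: "left_module R (regular_module R)" by (rule left_module_regular[OF M.R.ring_axioms])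
  have reg': "left_module (opp_ring R) (regular_module (opp_ring R))"
    by (rule left_module_regular[OF ring_opp_ring[OF M.R.ring_axioms]])
  interpret D: left_module "opp_ring R" "dual R M" by fact
  have dual0: "f = \<zero>\<^bsub>dual R M\<^esub>" if "f \<in> carrier (dual R M)" for f
  proof (rule lin_maps_eqI[of _ R M "regular_module R"])
    show "f \<in> lin_maps R M (regular_module R)" "\<zero>\<^bsub>dual R M\<^esub> \<in> lin_maps R M (regular_module R)"
      using that D.M.zero_closed by (simp_all add: dual_simps(1))
    show "f x = \<zero>\<^bsub>dual R M\<^esub> x" if "x \<in> carrier M" for x
      using that zero lin_maps_zero[OF M reg \<open>f \<in> lin_maps R M (regular_module R)\<close>]
      by (simp add: dual_simps(2))
  qed
  have cm: "canonical_map R M \<zero>\<^bsub>M\<^esub> \<in> carrier (bidual R M)"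
    using lin_maps_closed[OF canonical_map_linear[OF M], of "\<zero>\<^bsub>M\<^esub>"] by simp
  have "F = canonical_map R M \<zero>\<^bsub>M\<^esub>" if F: "F \<in> carrier (bidual R M)" for F
  proof (rule lin_maps_eqI[of _ "opp_ring R" "dual R M" "regular_module (opp_ring R)"])
    show F1: "F \<in> lin_maps (opp_ring R) (dual R M) (regular_module (opp_ring R))"
      and F2: "canonical_map R M \<zero>\<^bsub>M\<^esub> \<in> lin_maps (opp_ring R) (dual R M) (regular_module (opp_ring R))"
      using F cm by (simp_all add: bidual_def dual_simps(1))
    show "F f = canonical_map R M \<zero>\<^bsub>M\<^esub> f" if "f \<in> carrier (dual R M)" for f
      unfolding dual0[OF that] lin_maps_zero[OF D reg' F1] lin_maps_zero[OF D reg' F2] ..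
  qed
  then have "carrier (bidual R M) = {canonical_map R M \<zero>\<^bsub>M\<^esub>}" using cm by blast
  then show ?thesis by (simp add: reflexive_def zero bij_betw_def)
qed

text \<open>Let \<open>u\<close> generate the dual as a right ideal and \<open>v\<close> the right annihilator of \<open>u\<close>. The canonical map is
  \<open>r m \<mapsto> r u\<close> followed by the inclusion of \<open>\<Lambda>u\<close> in the left annihilator of \<open>v\<close>, which is the bidual. Under
  the two conditions the left annihilator of \<open>u\<close> is \<open>U(1,b,c)\<close> and that of \<open>v\<close> is \<open>\<Lambda>u\<close>.\<close>

lemma reflexive_M:
  assumes q: "q \<noteq> 0" and M: "cyclic_on (Lam q) M m (Lam_U q 1 b c)"
    and b1: "1 + b / q \<noteq> 0" and b2: "1 + b / q / q \<noteq> 0"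
  shows "reflexive (Lam q) M"
proof -
  interpret M: left_module "Lam q" M using M by (simp add: cyclic_on_def)
  have m: "m \<in> carrier M" using M unfolding cyclic_on_def by blast
  let ?u = "lam q 0 1 (b / q) (- c * (1 + b / q)) 0 0"
  let ?v = "lam q 0 1 (b / q / q) (c * (1 + b / q) * (1 + b / q / q)) 0 0"
  obtain g where D: "cyclic_on (opp_ring (Lam q)) (dual (Lam q) M) g
      (Lam_U q 1 (b / q / q) (c * (1 + b / q) * (1 + b / q / q)))"
    and gr: "\<And>r. r \<in> carrier (Lam q) \<Longrightarrow> g (r \<odot>\<^bsub>M\<^esub> m) = r \<otimes>\<^bsub>Lam q\<^esub> ?u"
    using dual_cyclic_Lam[OF q M] by blast
  have g: "g \<in> carrier (dual (Lam q) M)" using D unfolding cyclic_on_def by blast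
  have cm: "canonical_map (Lam q) M x \<in> carrier (bidual (Lam q) M)" if "x \<in> carrier M" for x
    using lin_maps_closed[OF canonical_map_linear[OF M.left_module_axioms] that] that by simp
  have "inj_on (canonical_map (Lam q) M) (carrier M)"
  proof (rule inj_onI)
    fix x y assume x: "x \<in> carrier M" and y: "y \<in> carrier M"
      and eq: "canonical_map (Lam q) M x = canonical_map (Lam q) M y"
    obtain r where r: "r \<in> carrier (Lam q)" "x = r \<odot>\<^bsub>M\<^esub> m" using cyclic_onE[OF M x] .
    obtain s where s: "s \<in> carrier (Lam q)" "y = s \<odot>\<^bsub>M\<^esub> m" using cyclic_onE[OF M y] .
    have "g x = g y" using fun_cong[OF eq, of g] g by (simp add: canonical_map_def)
    then have "(r \<ominus>\<^bsub>Lam q\<^esub> s) \<otimes>\<^bsub>Lam q\<^esub> ?u = \<zero>\<^bsub>Lam q\<^esub>"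
      using gr r s by (simp add: a_minus_def Lam.l_distr Lam.l_minus Lam.r_neg)
    then have "r \<ominus>\<^bsub>Lam q\<^esub> s \<in> {r \<in> carrier (Lam q). r \<otimes>\<^bsub>Lam q\<^esub> ?u = \<zero>\<^bsub>Lam q\<^esub>}"
      using r s by simp
    then have "r \<ominus>\<^bsub>Lam q\<^esub> s \<in> Lam_U q 1 b c"
      unfolding left_annihilator[OF q b1] using q b1 by simp
    then show "x = y" using cyclic_on_eq_iff[OF M r(1) s(1)] r s by simp
  qed
  moreover have "F \<in> canonical_map (Lam q) M ` carrier M" if F: "F \<in> carrier (bidual (Lam q) M)" for F
  proof -
    have F': "F \<in> carrier (dual (opp_ring (Lam q)) (dual (Lam q) M))" using F by (simp add: bidual_def)
    note val = cyclic_on_dual_value[OF D F', unfolded opp_ring_simps]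
    have "?v \<in> Lam_U q 1 (b / q / q) (c * (1 + b / q) * (1 + b / q / q))"
      by (simp add: lam_mem_Lam_U[OF q])
    from val(3)[OF this] have "F g \<in> {r \<in> carrier (Lam q). r \<otimes>\<^bsub>Lam q\<^esub> ?v = \<zero>\<^bsub>Lam q\<^esub>}"
      using val(1) by simp
    then have "F g \<in> Lam_U q 1 (b / q) (- c * (1 + b / q))"
      unfolding left_annihilator[OF q b2] using q b2 by simp
    then obtain r where r: "r \<in> carrier (Lam q)" "F g = r \<otimes>\<^bsub>Lam q\<^esub> ?u"
      unfolding left_ideal_gen[OF q b1, symmetric] by blast
    have "F = canonical_map (Lam q) M (r \<odot>\<^bsub>M\<^esub> m)"
    proof (rule lin_maps_eqI[of _ "opp_ring (Lam q)" "dual (Lam q) M" "regular_module (opp_ring (Lam q))"])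
      show "F \<in> lin_maps (opp_ring (Lam q)) (dual (Lam q) M) (regular_module (opp_ring (Lam q)))"
        "canonical_map (Lam q) M (r \<odot>\<^bsub>M\<^esub> m)
          \<in> lin_maps (opp_ring (Lam q)) (dual (Lam q) M) (regular_module (opp_ring (Lam q)))"
        using F cm[of "r \<odot>\<^bsub>M\<^esub> m"] r m by (simp_all add: bidual_def dual_simps(1))
      fix f assume f: "f \<in> carrier (dual (Lam q) M)"
      then obtain s where s: "s \<in> carrier (opp_ring (Lam q))" "f = s \<odot>\<^bsub>dual (Lam q) M\<^esub> g"
        using cyclic_onE[OF D] by blast
      then have s1: "s \<in> carrier (Lam q)" by simp
      have "F f = F g \<otimes>\<^bsub>Lam q\<^esub> s" using val(2)[OF s1] s by simp
      also have "\<dots> = f (r \<odot>\<^bsub>M\<^esub> m)" using r m gr[OF r(1)] s(2) by (simp add: dual_simps(4))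
      finally show "F f = canonical_map (Lam q) M (r \<odot>\<^bsub>M\<^esub> m) f"
        using f by (simp add: canonical_map_def)
    qed
    then show ?thesis using r m by blast
  qed
  ultimately show ?thesis
    unfolding reflexive_def bij_betw_def using cm by blast
qed

section \<open>Consequences of the vanishing of \<open>Ext\<^sup>1\<close>\<close>

definition coord :: "'k::field \<Rightarrow> (gen list \<Rightarrow> 'k) set \<Rightarrow> 'k \<times> 'k \<times> 'k \<times> 'k \<times> 'k \<times> 'k" where
  "coord q r = (THE t. case t of (a0, a1, a2, a3, a4, a5) \<Rightarrow> r = lam q a0 a1 a2 a3 a4 a5)"

lemma coord_lam [simp]: "coord q (lam q a0 a1 a2 a3 a4 a5) = (a0, a1, a2, a3, a4, a5)"
  unfolding coord_def by (rule the_equality) (auto simp: lam_inject)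

text \<open>The right ideal \<open>(x - y)\<Lambda>\<close> has the linear map sending \<open>x - y\<close> to \<open>zx\<close>, but
  \<open>\<Lambda>(x - y)\<close> is spanned by \<open>x - y\<close> and \<open>yx\<close>, so that map is no left multiplication.\<close>

lemma Ext1_dual_exceptional:
  assumes q: "q \<noteq> 0" and N: "cyclic_on (opp_ring (Lam q)) N g (Lam_U q 1 (- 1) 0)"
    and triv: "trivial_group (Ext (opp_ring (Lam q)) 1 N (regular_module (opp_ring (Lam q))))"
  shows False
proof -
  let ?R = "opp_ring (Lam q)" and ?U = "Lam_U q 1 (- 1) 0"
  have R: "ring ?R" by (rule ring_opp_ring[OF ring_Lam])
  have reg: "left_module ?R (regular_module ?R)" by (rule left_module_regular[OF R])
  have N1: "left_module ?R N" using N by (simp add: cyclic_on_def)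
  have "submodule (ker (regular_module ?R) (\<lambda>r\<in>carrier ?R. r \<odot>\<^bsub>N\<^esub> g) N) ?R (regular_module ?R)"
    using cyclic_on_epi(1)[OF N] by (intro submodule_kernel reg N1) (simp only: epi_def)
  then have U: "left_module ?R ((regular_module ?R)\<lparr>carrier := ?U\<rparr>)"
    unfolding cyclic_on_epi(2)[OF N] by (rule left_module_submodule[OF reg])
  have Uex: "\<exists>t e f. x = lam q 0 t (- t) 0 e f" if "x \<in> ?U" for x using that by (auto simp: Lam_U_eq[OF q])
  define \<phi> where "\<phi> r = (case coord q r of (a0, a1, a2, a3, a4, a5) \<Rightarrow> lam q 0 0 0 0 0 a1)" for r
  have "(\<lambda>x\<in>carrier ((regular_module ?R)\<lparr>carrier := ?U\<rparr>). \<phi> x)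
      \<in> lin_maps ?R ((regular_module ?R)\<lparr>carrier := ?U\<rparr>) (regular_module ?R)"
  proof (rule lin_mapsI[OF _ _ _ U])
    fix x assume "x \<in> carrier ((regular_module ?R)\<lparr>carrier := ?U\<rparr>)"
    then have "x \<in> ?U" by simp
    then obtain t e f where x: "x = lam q 0 t (- t) 0 e f" using Uex by blast
    then show "\<phi> x \<in> carrier (regular_module ?R)" by (simp add: \<phi>_def)
    { fix y assume "y \<in> carrier ((regular_module ?R)\<lparr>carrier := ?U\<rparr>)"
      then have "y \<in> ?U" by simp
      then obtain t' e' f' where "y = lam q 0 t' (- t') 0 e' f'" using Uex by blast
      then show "\<phi> (x \<oplus>\<^bsub>(regular_module ?R)\<lparr>carrier := ?U\<rparr>\<^esub> y) = \<phi> x \<oplus>\<^bsub>regular_module ?R\<^esub> \<phi> y"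
        by (simp add: x \<phi>_def lam_simps) }
    { fix r assume "r \<in> carrier ?R"
      then obtain r0 r1 r2 r3 r4 r5 where "r = lam q r0 r1 r2 r3 r4 r5" using lam_ex[of r q] by auto
      then show "\<phi> (r \<odot>\<^bsub>(regular_module ?R)\<lparr>carrier := ?U\<rparr>\<^esub> x) = r \<odot>\<^bsub>regular_module ?R\<^esub> \<phi> x"
        by (simp add: x \<phi>_def lam_simps) }
  qed
  then obtain \<psi> where \<psi>: "\<psi> \<in> lin_maps ?R (regular_module ?R) (regular_module ?R)"
    and eq: "\<And>x. x \<in> ?U \<Longrightarrow> \<psi> x = (\<lambda>x\<in>carrier ((regular_module ?R)\<lparr>carrier := ?U\<rparr>). \<phi> x) x"
    using hom_extendsD[OF Ext1_cyclic[OF triv N]] by blast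
  let ?w = "lam q 0 1 (- 1) 0 0 0"
  have w: "?w \<in> ?U" by (simp add: lam_mem_Lam_U[OF q])
  have "\<psi> \<one>\<^bsub>?R\<^esub> \<in> carrier (Lam q)"
    using lin_maps_closed[OF \<psi>, of "\<one>\<^bsub>?R\<^esub>"] by simp
  then obtain s0 s1 s2 s3 s4 s5 where s: "\<psi> \<one>\<^bsub>?R\<^esub> = lam q s0 s1 s2 s3 s4 s5" using lam_ex by blast
  have "lam q s0 s1 s2 s3 s4 s5 \<otimes>\<^bsub>Lam q\<^esub> ?w = lam q 0 0 0 0 0 1"
    using lin_maps_regular_eq[OF R \<psi>, of ?w] eq[OF w] w by (simp add: s[simplified] \<phi>_def)
  then show False by (simp add: lam_simps)
qed

text \<open>The map \<open>lam q 0 x1 x2 x3 x4 x5 \<mapsto> (k1 x1 + k2 x2) z + p x4 yx + (r x4 + s x5) zx\<close> on \<open>U(a,b,c)\<close> is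
  linear under the stated equations. A right multiplication by an element with constant term \<open>s0\<close> is
  multiplication by \<open>s0\<close> on the socle, so this map can only be one if \<open>p = s = s0\<close> and \<open>r = 0\<close>.\<close>

lemma Ext1_M_obstruction:
  assumes q: "q \<noteq> 0" and ext: "hom_extends (Lam q) (regular_module (Lam q)) (Lam_U q a b c) (regular_module (Lam q))"
    and lin: "p * a = 0" "p * b = 0" "r * a = 0" "s * (a + b) = 0" "s * c = k1 * a + k2 * b + q * (r * b)"
  shows "p = s \<and> r = 0"
proof -
  let ?R = "Lam q" and ?U = "Lam_U q a b c"
  have R: "ring ?R" by (rule ring_Lam)
  have reg: "left_module ?R (regular_module ?R)" by (rule left_module_regular[OF R])
  have U: "left_module ?R ((regular_module ?R)\<lparr>carrier := ?U\<rparr>)"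
    by (rule left_module_submodule[OF reg Lam_U_submodule[OF q]])
  have Uex: "\<exists>t e f. x = lam q 0 (t * a) (t * b) (t * c) e f" if "x \<in> ?U" for x
    using that by (auto simp: Lam_U_eq[OF q])
  define \<phi> where "\<phi> x = (case coord q x of (x0, x1, x2, x3, x4, x5) \<Rightarrow>
      lam q 0 0 0 (k1 * x1 + k2 * x2) (p * x4) (r * x4 + s * x5))" for x
  have "(\<lambda>x\<in>carrier ((regular_module ?R)\<lparr>carrier := ?U\<rparr>). \<phi> x)
      \<in> lin_maps ?R ((regular_module ?R)\<lparr>carrier := ?U\<rparr>) (regular_module ?R)"
  proof (rule lin_mapsI[OF _ _ _ U])
    fix x assume "x \<in> carrier ((regular_module ?R)\<lparr>carrier := ?U\<rparr>)"
    then have "x \<in> ?U" by simp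
    then obtain t e f where x: "x = lam q 0 (t * a) (t * b) (t * c) e f" using Uex by blast
    then show "\<phi> x \<in> carrier (regular_module ?R)" by (simp add: \<phi>_def)
    { fix y assume "y \<in> carrier ((regular_module ?R)\<lparr>carrier := ?U\<rparr>)"
      then have "y \<in> ?U" by simp
      then obtain t' e' f' where "y = lam q 0 (t' * a) (t' * b) (t' * c) e' f'" using Uex by blast
      then show "\<phi> (x \<oplus>\<^bsub>(regular_module ?R)\<lparr>carrier := ?U\<rparr>\<^esub> y) = \<phi> x \<oplus>\<^bsub>regular_module ?R\<^esub> \<phi> y"
        by (simp add: x \<phi>_def lam_simps algebra_simps) }
    { fix u assume "u \<in> carrier ?R"
      then obtain u0 u1 u2 u3 u4 u5 where u: "u = lam q u0 u1 u2 u3 u4 u5" using lam_ex by blast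
      have "p * (u0 * e + u2 * (t * a) - q * (u1 * (t * b))) = u0 * (p * e) + u2 * t * (p * a) - q * u1 * t * (p * b)"
        by (simp add: algebra_simps)
      then have 1: "p * (u0 * e + u2 * (t * a) - q * (u1 * (t * b))) = u0 * (p * e)"
        using lin by simp
      have "r * (u0 * e + u2 * (t * a) - q * (u1 * (t * b))) + s * (u0 * f + u3 * (t * a) + u1 * (t * c) + u3 * (t * b))
          = u0 * (r * e + s * f) + u2 * t * (r * a) + u3 * t * (s * (a + b)) + u1 * t * (s * c - q * (r * b))"
        by (simp add: algebra_simps)
      then have 2: "r * (u0 * e + u2 * (t * a) - q * (u1 * (t * b))) + s * (u0 * f + u3 * (t * a) + u1 * (t * c) + u3 * (t * b))
          = u0 * (r * e + s * f) + u1 * (k1 * (t * a) + k2 * (t * b))"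
        unfolding lin by (simp add: algebra_simps)
      show "\<phi> (u \<odot>\<^bsub>(regular_module ?R)\<lparr>carrier := ?U\<rparr>\<^esub> x) = u \<odot>\<^bsub>regular_module ?R\<^esub> \<phi> x"
        using 1 2 by (simp add: x u \<phi>_def lam_mult lam_inject) (simp add: algebra_simps) }
  qed
  then obtain \<psi> where \<psi>: "\<psi> \<in> lin_maps ?R (regular_module ?R) (regular_module ?R)"
    and eq: "\<And>x. x \<in> ?U \<Longrightarrow> \<psi> x = (\<lambda>x\<in>carrier ((regular_module ?R)\<lparr>carrier := ?U\<rparr>). \<phi> x) x"
    using hom_extendsD[OF ext] by blast
  have "\<psi> \<one>\<^bsub>?R\<^esub> \<in> carrier ?R"
    using lin_maps_closed[OF \<psi>, of "\<one>\<^bsub>?R\<^esub>"] by simp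
  then obtain s0 s1 s2 s3 s4 s5 where s: "\<psi> \<one>\<^bsub>?R\<^esub> = lam q s0 s1 s2 s3 s4 s5" using lam_ex by blast
  have "\<phi> (lam q 0 0 0 0 e f) = lam q 0 0 0 0 e f \<otimes>\<^bsub>?R\<^esub> lam q s0 s1 s2 s3 s4 s5" for e f
  proof -
    have "lam q 0 (0 * a) (0 * b) (0 * c) e f \<in> ?U" unfolding Lam_U_eq[OF q] by blast
    then have x: "lam q 0 0 0 0 e f \<in> ?U" by simp
    show ?thesis using lin_maps_regular_eq[OF R \<psi>, of "lam q 0 0 0 0 e f"] eq[OF x] x by (simp add: s)
  qed
  from this[of 1 0] this[of 0 1] show ?thesis by (simp add: \<phi>_def lam_mult lam_inject)
qed

text \<open>The obstruction maps used in the four cases send \<open>w = ax + by + cz\<close> to \<open>z\<close>, \<open>0\<close>, \<open>0\<close> and \<open>z\<close>. In the first and the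
  last case \<open>z\<close> is annihilated by the left annihilator of \<open>w\<close> but does not lie in \<open>w\<Lambda>\<close>; in the others \<open>\<Lambda>w\<close> misses
  a line of the socle, on which the map can be prescribed independently.\<close>

lemma Ext1_M_nonzero:
  assumes q: "q \<noteq> 0"
    and ext: "hom_extends (Lam q) (regular_module (Lam q)) (Lam_U q a b c) (regular_module (Lam q))"
  shows "a \<noteq> 0 \<and> a + b \<noteq> 0"
proof (rule ccontr)
  note obs = Ext1_M_obstruction[OF q ext]
  assume not: "\<not> (a \<noteq> 0 \<and> a + b \<noteq> 0)"
  consider "a = 0" "b \<noteq> 0" | "a = 0" "b = 0" | "a \<noteq> 0" "a + b = 0" "c = 0" | "a \<noteq> 0" "a + b = 0" "c \<noteq> 0"
    using not by auto
  then show False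
  proof cases
    case 1
    then show False using obs[of 0 "- 1 / (q * b)" 0 0 "1 / b"] q by simp
  next
    case 2
    then show False using obs[of 1 0 0 0 0] by simp
  next
    case 3
    then show False using obs[of 0 0 1 0 0] by simp
  next
    case 4
    then show False using obs[of 0 0 "1 / c" "1 / a" 0] by simp
  qed
qed

lemma Lam_U_scale:
  assumes "q \<noteq> 0" "a \<noteq> 0"
  shows "Lam_U q a b c = Lam_U q 1 (b / a) (c / a)"
  unfolding Lam_U_eq[OF assms(1)]
proof (intro equalityI subsetI)
  fix x assume "x \<in> {lam q 0 (t * a) (t * b) (t * c) e f | t e f. True}"
  then obtain t e f where "x = lam q 0 (t * a) (t * b) (t * c) e f" by blast
  then have "x = lam q 0 ((t * a) * 1) ((t * a) * (b / a)) ((t * a) * (c / a)) e f"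
    using assms(2) by simp
  then show "x \<in> {lam q 0 (t * 1) (t * (b / a)) (t * (c / a)) e f | t e f. True}" by blast
next
  fix x assume "x \<in> {lam q 0 (t * 1) (t * (b / a)) (t * (c / a)) e f | t e f. True}"
  then obtain t e f where "x = lam q 0 (t * 1) (t * (b / a)) (t * (c / a)) e f" by blast
  then have "x = lam q 0 ((t / a) * a) ((t / a) * b) ((t / a) * c) e f"
    using assms(2) by simp
  then show "x \<in> {lam q 0 (t * a) (t * b) (t * c) e f | t e f. True}" by blast
qed

section \<open>Linear algebra over \<open>k\<close> inside a module\<close>

text \<open>More unknowns than equations, by elimination of one unknown per equation.\<close>

lemma homogeneous_system:
  fixes f :: "'i \<Rightarrow> 'b \<Rightarrow> 'k::field"
  assumes "finite B" "finite I" "card B < card I"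
  shows "\<exists>c. (\<exists>i\<in>I. c i \<noteq> 0) \<and> (\<forall>b\<in>B. (\<Sum>i\<in>I. c i * f i b) = 0)"
  using assms
proof (induction B arbitrary: I f rule: finite_induct)
  case empty
  then obtain i where "i \<in> I" by (auto simp: card_gt_0_iff)
  then show ?case by (intro exI[of _ "\<lambda>_. 1"]) auto
next
  case (insert b B)
  show ?case
  proof (cases "\<forall>i\<in>I. f i b = 0")
    case True
    obtain c where "\<exists>i\<in>I. c i \<noteq> 0" "\<forall>b\<in>B. (\<Sum>i\<in>I. c i * f i b) = 0"
      using insert.IH[of I f] insert.prems insert.hyps by auto
    then show ?thesis using True by (intro exI[of _ c]) auto
  next
    case False
    then obtain j where j: "j \<in> I" "f j b \<noteq> 0" by blast
    define g where "g i b' = f i b' - f i b / f j b * f j b'" for i b'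
    have "card B < card (I - {j})" using insert.prems insert.hyps j by simp
    then obtain c where c: "\<exists>i\<in>I - {j}. c i \<noteq> 0" "\<forall>b'\<in>B. (\<Sum>i\<in>I - {j}. c i * g i b') = 0"
      using insert.IH[of "I - {j}" g] insert.prems by auto
    define d where "d = c(j := - (\<Sum>i\<in>I - {j}. c i * f i b / f j b))"
    have split: "(\<Sum>i\<in>I. d i * f i b') = (\<Sum>i\<in>I - {j}. c i * g i b')" for b'
    proof -
      have "(\<Sum>i\<in>I. d i * f i b') = d j * f j b' + (\<Sum>i\<in>I - {j}. d i * f i b')"
        using insert.prems j by (simp add: sum.remove)
      also have "(\<Sum>i\<in>I - {j}. d i * f i b') = (\<Sum>i\<in>I - {j}. c i * f i b')"
        by (rule sum.cong) (auto simp: d_def)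
      also have "d j * f j b' + \<dots> = (\<Sum>i\<in>I - {j}. c i * g i b')"
        by (simp add: d_def g_def right_diff_distrib sum_subtractf sum_distrib_right mult.assoc)
      finally show ?thesis .
    qed
    have "(\<Sum>i\<in>I - {j}. c i * g i b) = 0" using j by (simp add: g_def)
    then have "\<forall>b'\<in>insert b B. (\<Sum>i\<in>I. d i * f i b') = 0" using c(2) by (simp add: split)
    moreover have "\<exists>i\<in>I. d i \<noteq> 0" using c(1) by (auto simp: d_def)
    ultimately show ?thesis by blast
  qed
qed

lemma separating_functional:
  fixes scale :: "'k::field \<Rightarrow> 'v::ab_group_add \<Rightarrow> 'v"
  assumes "vector_space scale" "Modules.module.subspace scale S" "v \<notin> S"
  shows "\<exists>g. Vector_Spaces.linear scale (*) g \<and> (\<forall>x\<in>S. g x = 0) \<and> g v = (1::'k)"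
proof -
  interpret V: vector_space scale by fact
  interpret K: vector_space "(*) :: 'k \<Rightarrow> 'k \<Rightarrow> 'k" by unfold_locales (auto simp: algebra_simps)
  interpret P: vector_space_pair scale "(*) :: 'k \<Rightarrow> 'k \<Rightarrow> 'k" ..
  obtain B where B: "B \<subseteq> S" "V.independent B" "S \<subseteq> V.span B"
    using V.maximal_independent_subset[of S] by blast
  have "V.span B \<subseteq> S" using B(1) assms(2) by (rule V.span_minimal)
  then have "v \<notin> V.span B" using assms(3) by blast
  then have "V.independent (insert v B)" using B(2) by (rule V.independent_insertI)
  then obtain g where g: "Vector_Spaces.linear scale (*) g"
    "\<forall>x\<in>insert v B. g x = (if x = v then 1 else 0)"
    using P.linear_independent_extend[of "insert v B" "\<lambda>x. if x = v then 1 else 0"] by blast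
  interpret g: Vector_Spaces.linear scale "(*)" g by (rule g(1))
  have "v \<notin> B" using B(1) assms(3) by blast
  then have gB: "g x = 0" if "x \<in> B" for x using g(2) that by auto
  have "V.subspace {x. g x = 0}"
    by (rule V.subspaceI) (simp_all add: g.zero g.add g.scale)
  then have "V.span B \<subseteq> {x. g x = 0}" using gB by (intro V.span_minimal) auto
  then have "\<forall>x\<in>S. g x = 0" using B(3) by blast
  with g show ?thesis by auto
qed

text \<open>The coordinates embed \<open>M\<close> into a vector space that is a type, the functions on \<open>'m\<close>, which makes
  linear algebra for types applicable; they are continued by \<open>0\<close> outside \<open>B\<close>.\<close>

lemma k_basis_coordinates:
  fixes M :: "((gen list \<Rightarrow> 'k::field) set, 'm) module"
  assumes M: "left_module (Lam q) M" and B: "k_basis q M B"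
  shows "\<exists>\<kappa> :: 'm \<Rightarrow> 'm \<Rightarrow> 'k.
    (\<forall>x\<in>carrier M. \<forall>y\<in>carrier M. \<kappa> (x \<oplus>\<^bsub>M\<^esub> y) = (\<lambda>b. \<kappa> x b + \<kappa> y b)) \<and>
    (\<forall>t. \<forall>x\<in>carrier M. \<kappa> (lam q t 0 0 0 0 0 \<odot>\<^bsub>M\<^esub> x) = (\<lambda>b. t * \<kappa> x b)) \<and>
    inj_on \<kappa> (carrier M) \<and> (\<forall>x b. b \<notin> B \<longrightarrow> \<kappa> x b = 0)"
proof -
  interpret M: left_module "Lam q" M by fact
  have fin: "finite B" and BM: "B \<subseteq> carrier M"
    and ex: "\<And>x. x \<in> carrier M \<Longrightarrow> \<exists>!f. f \<in> B \<rightarrow>\<^sub>E UNIV \<and> x = (\<Oplus>\<^bsub>M\<^esub>b\<in>B. Lam_scalar q (f b) \<odot>\<^bsub>M\<^esub> b)"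
    using B by (auto simp: k_basis_def)
  define lc where "lc f = (\<Oplus>\<^bsub>M\<^esub>b\<in>B. lam q (f b) 0 0 0 0 0 \<odot>\<^bsub>M\<^esub> b)" for f :: "'m \<Rightarrow> 'k"
  have BM': "b \<in> carrier M" if "b \<in> B" for b using BM that by blast
  have lc_closed: "lc f \<in> carrier M" for f
    unfolding lc_def by (rule M.M.finsum_closed) (auto simp: BM')
  have lc_cong: "lc f = lc g" if "\<And>b. b \<in> B \<Longrightarrow> f b = g b" for f g
    unfolding lc_def by (rule M.M.finsum_cong') (auto simp: BM' that)
  have lc_add: "lc (\<lambda>b. f b + g b) = lc f \<oplus>\<^bsub>M\<^esub> lc g" for f g
  proof -
    have "lc (\<lambda>b. f b + g b) = (\<Oplus>\<^bsub>M\<^esub>b\<in>B. lam q (f b) 0 0 0 0 0 \<odot>\<^bsub>M\<^esub> b \<oplus>\<^bsub>M\<^esub> lam q (g b) 0 0 0 0 0 \<odot>\<^bsub>M\<^esub> b)"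
      unfolding lc_def
    proof (rule M.M.finsum_cong')
      fix b assume "b \<in> B"
      have "lam q (f b + g b) 0 0 0 0 0 = lam q (f b) 0 0 0 0 0 \<oplus>\<^bsub>Lam q\<^esub> lam q (g b) 0 0 0 0 0"
        by (simp add: lam_add)
      then show "lam q (f b + g b) 0 0 0 0 0 \<odot>\<^bsub>M\<^esub> b
          = lam q (f b) 0 0 0 0 0 \<odot>\<^bsub>M\<^esub> b \<oplus>\<^bsub>M\<^esub> lam q (g b) 0 0 0 0 0 \<odot>\<^bsub>M\<^esub> b"
        using \<open>b \<in> B\<close> by (simp add: M.smult_l_distr BM' del: lam_add)
    qed (auto simp: BM')
    also have "\<dots> = lc f \<oplus>\<^bsub>M\<^esub> lc g"
      unfolding lc_def by (rule M.M.finsum_addf) (auto simp: BM')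
    finally show ?thesis .
  qed
  have lc_scale: "lc (\<lambda>b. t * f b) = lam q t 0 0 0 0 0 \<odot>\<^bsub>M\<^esub> lc f" for t f
  proof -
    have "lam q t 0 0 0 0 0 \<odot>\<^bsub>M\<^esub> lc f = (\<Oplus>\<^bsub>M\<^esub>b\<in>B. lam q t 0 0 0 0 0 \<odot>\<^bsub>M\<^esub> (lam q (f b) 0 0 0 0 0 \<odot>\<^bsub>M\<^esub> b))"
      unfolding lc_def by (rule finsum_smult[OF M fin lam_closed]) (auto simp: BM')
    also have "\<dots> = lc (\<lambda>b. t * f b)"
      unfolding lc_def by (rule M.M.finsum_cong') (auto simp: BM' M.smult_assoc1[symmetric] lam_mult)
    finally show ?thesis by simp
  qed
  have uniq: "f b = g b" if "lc f = lc g" "b \<in> B" for f g b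
  proof -
    have r: "lc (restrict h B) = lc h" for h :: "'m \<Rightarrow> 'k" by (rule lc_cong) simp
    have P: "restrict h B \<in> B \<rightarrow>\<^sub>E UNIV \<and> lc h = (\<Oplus>\<^bsub>M\<^esub>b\<in>B. Lam_scalar q (restrict h B b) \<odot>\<^bsub>M\<^esub> b)" for h :: "'m \<Rightarrow> 'k"
      using r[of h] by (simp add: lc_def Lam_scalar_lam)
    obtain h where h: "\<And>h'. h' \<in> B \<rightarrow>\<^sub>E UNIV \<and> lc f = (\<Oplus>\<^bsub>M\<^esub>b\<in>B. Lam_scalar q (h' b) \<odot>\<^bsub>M\<^esub> b) \<Longrightarrow> h' = h"
      using ex[OF lc_closed[of f]] unfolding Ex1_def by blast
    have "restrict f B = h" by (rule h[OF P[of f]])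
    moreover have "restrict g B = h" by (rule h[OF P[of g, folded that(1)]])
    ultimately have "restrict f B b = restrict g B b" by simp
    then show ?thesis using that(2) by simp
  qed
  have surj: "\<exists>f. (\<forall>b. b \<notin> B \<longrightarrow> f b = 0) \<and> x = lc f" if x: "x \<in> carrier M" for x
  proof -
    obtain f where f: "x = (\<Oplus>\<^bsub>M\<^esub>b\<in>B. Lam_scalar q (f b) \<odot>\<^bsub>M\<^esub> b)" using ex[OF x] by blast
    have "lc (\<lambda>b. if b \<in> B then f b else 0) = lc f" by (rule lc_cong) simp
    then have "x = lc (\<lambda>b. if b \<in> B then f b else 0)" using f by (simp add: lc_def Lam_scalar_lam)
    then show ?thesis by (intro exI[of _ "\<lambda>b. if b \<in> B then f b else 0"]) simp
  qed
  define \<kappa> where "\<kappa> x = (if x \<in> carrier M then SOME f. (\<forall>b. b \<notin> B \<longrightarrow> f b = 0) \<and> x = lc f else (\<lambda>b. 0))" for x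
  have \<kappa>: "(\<forall>b. b \<notin> B \<longrightarrow> \<kappa> x b = 0) \<and> x = lc (\<kappa> x)" if "x \<in> carrier M" for x
    using someI_ex[OF surj[OF that]] that by (simp add: \<kappa>_def)
  have eqI: "\<kappa> x = f" if "x \<in> carrier M" "x = lc f" "\<And>b. b \<notin> B \<Longrightarrow> f b = 0" for x f
  proof
    fix b
    have "lc (\<kappa> x) = lc f" using conjunct2[OF \<kappa>[OF that(1)]] that(2) by argo
    then show "\<kappa> x b = f b" using conjunct1[OF \<kappa>[OF that(1)]] uniq[of "\<kappa> x" f b] that(3) by (cases "b \<in> B") auto
  qed
  show ?thesis
  proof (intro exI[of _ \<kappa>] conjI ballI allI impI)
    fix x y assume x: "x \<in> carrier M" and y: "y \<in> carrier M"
    have "x \<oplus>\<^bsub>M\<^esub> y = lc (\<lambda>b. \<kappa> x b + \<kappa> y b)"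
      unfolding lc_add using conjunct2[OF \<kappa>[OF x]] conjunct2[OF \<kappa>[OF y]] by argo
    then show "\<kappa> (x \<oplus>\<^bsub>M\<^esub> y) = (\<lambda>b. \<kappa> x b + \<kappa> y b)"
      using x y conjunct1[OF \<kappa>[OF x]] conjunct1[OF \<kappa>[OF y]] by (intro eqI) (auto simp: lc_closed)
  next
    fix t x assume x: "x \<in> carrier M"
    have "lam q t 0 0 0 0 0 \<odot>\<^bsub>M\<^esub> x = lc (\<lambda>b. t * \<kappa> x b)"
      unfolding lc_scale using conjunct2[OF \<kappa>[OF x]] by argo
    then show "\<kappa> (lam q t 0 0 0 0 0 \<odot>\<^bsub>M\<^esub> x) = (\<lambda>b. t * \<kappa> x b)"
      using x conjunct1[OF \<kappa>[OF x]] by (intro eqI) (auto simp: lc_closed)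
  next
    show "inj_on \<kappa> (carrier M)" using \<kappa> by (intro inj_on_inverseI[of _ lc]) auto
    show "\<kappa> x b = 0" if "b \<notin> B" for x b
      using conjunct1[OF \<kappa>[of x]] that by (cases "x \<in> carrier M") (auto simp: \<kappa>_def)
  qed
qed

lemma four_dependent:
  fixes M :: "((gen list \<Rightarrow> 'k::field) set, 'm) module"
  assumes M: "left_module (Lam q) M" and dim: "k_dim_at_most q M 3"
    and n: "n0 \<in> carrier M" "n1 \<in> carrier M" "n2 \<in> carrier M" "n3 \<in> carrier M"
  obtains c0 c1 c2 c3 where "(c0, c1, c2, c3) \<noteq> (0, 0, 0, 0)"
    "lam q c0 0 0 0 0 0 \<odot>\<^bsub>M\<^esub> n0 \<oplus>\<^bsub>M\<^esub> lam q c1 0 0 0 0 0 \<odot>\<^bsub>M\<^esub> n1 \<oplus>\<^bsub>M\<^esub>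
     lam q c2 0 0 0 0 0 \<odot>\<^bsub>M\<^esub> n2 \<oplus>\<^bsub>M\<^esub> lam q c3 0 0 0 0 0 \<odot>\<^bsub>M\<^esub> n3 = \<zero>\<^bsub>M\<^esub>"
proof -
  interpret M: left_module "Lam q" M by fact
  obtain B where B: "k_basis q M B" "card B \<le> 3" using dim by (auto simp: k_dim_at_most_def)
  obtain \<kappa> :: "'m \<Rightarrow> 'm \<Rightarrow> 'k" where
    \<kappa>: "\<forall>x\<in>carrier M. \<forall>y\<in>carrier M. \<kappa> (x \<oplus>\<^bsub>M\<^esub> y) = (\<lambda>b. \<kappa> x b + \<kappa> y b)"
      "\<forall>t. \<forall>x\<in>carrier M. \<kappa> (lam q t 0 0 0 0 0 \<odot>\<^bsub>M\<^esub> x) = (\<lambda>b. t * \<kappa> x b)"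
    and inj: "inj_on \<kappa> (carrier M)" and \<kappa>0: "\<forall>x b. b \<notin> B \<longrightarrow> \<kappa> x b = 0"
    using k_basis_coordinates[OF M B(1)] by blast
  note \<kappa>_add = \<kappa>(1)[rule_format] and \<kappa>_scale = \<kappa>(2)[rule_format] and \<kappa>0 = \<kappa>0[rule_format]
  let ?n = "\<lambda>i::nat. if i = 0 then n0 else if i = 1 then n1 else if i = 2 then n2 else n3"
  have "finite B" using B(1) by (simp add: k_basis_def)
  then obtain c where c: "\<exists>i\<in>{..<4::nat}. c i \<noteq> 0" "\<forall>b\<in>B. (\<Sum>i<4. c i * \<kappa> (?n i) b) = 0"
    using homogeneous_system[of B "{..<4::nat}" "\<lambda>i. \<kappa> (?n i)"] B(2) by auto
  have four: "{..<4::nat} = {0, 1, 2, 3}" by auto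
  let ?s = "lam q (c 0) 0 0 0 0 0 \<odot>\<^bsub>M\<^esub> n0 \<oplus>\<^bsub>M\<^esub> lam q (c 1) 0 0 0 0 0 \<odot>\<^bsub>M\<^esub> n1 \<oplus>\<^bsub>M\<^esub>
     lam q (c 2) 0 0 0 0 0 \<odot>\<^bsub>M\<^esub> n2 \<oplus>\<^bsub>M\<^esub> lam q (c 3) 0 0 0 0 0 \<odot>\<^bsub>M\<^esub> n3"
  have "\<kappa> ?s b = 0" for b
    using c(2) n \<kappa>0[of b] by (cases "b \<in> B") (simp_all add: four \<kappa>_add \<kappa>_scale add.assoc)
  moreover have "\<kappa> \<zero>\<^bsub>M\<^esub> b = 0" for b
    using \<kappa>_scale[OF M.M.zero_closed, of 0] left_module_smult_zero[OF M lam_closed] by simp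
  ultimately have "\<kappa> ?s = \<kappa> \<zero>\<^bsub>M\<^esub>" by (intro ext) simp
  then have "?s = \<zero>\<^bsub>M\<^esub>" by (rule inj_onD[OF inj]) (simp_all add: n)
  moreover have "(c 0, c 1, c 2, c 3) \<noteq> (0, 0, 0, 0)" using c(1) by (auto simp: four)
  ultimately show ?thesis by (rule that[rotated])
qed

section \<open>Modules of dimension at most three with vanishing \<open>Ext\<^sup>1\<close>\<close>

text \<open>The submodule \<open>JM\<close>; three summands suffice as \<open>J\<close> is generated by \<open>x, y, z\<close> as a right ideal.\<close>

definition rad_part :: "'k::field \<Rightarrow> ((gen list \<Rightarrow> 'k) set, 'm) module \<Rightarrow> 'm set" where
  "rad_part q M = {lam q 0 1 0 0 0 0 \<odot>\<^bsub>M\<^esub> x \<oplus>\<^bsub>M\<^esub> lam q 0 0 1 0 0 0 \<odot>\<^bsub>M\<^esub> y \<oplus>\<^bsub>M\<^esub> lam q 0 0 0 1 0 0 \<odot>\<^bsub>M\<^esub> z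
     | x y z. x \<in> carrier M \<and> y \<in> carrier M \<and> z \<in> carrier M}"

lemma rad_partI:
  assumes M: "left_module (Lam q) M" and m: "m \<in> carrier M"
  shows "lam q 0 a1 a2 a3 a4 a5 \<odot>\<^bsub>M\<^esub> m \<in> rad_part q M"
proof -
  interpret M: left_module "Lam q" M by fact
  have "lam q 0 a1 a2 a3 a4 a5 = lam q 0 1 0 0 0 0 \<otimes>\<^bsub>Lam q\<^esub> lam q a1 0 0 0 0 0
      \<oplus>\<^bsub>Lam q\<^esub> lam q 0 0 1 0 0 0 \<otimes>\<^bsub>Lam q\<^esub> lam q a2 a4 0 0 0 0
      \<oplus>\<^bsub>Lam q\<^esub> lam q 0 0 0 1 0 0 \<otimes>\<^bsub>Lam q\<^esub> lam q a3 a5 0 0 0 0"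
    by (simp add: lam_simps)
  then have "lam q 0 a1 a2 a3 a4 a5 \<odot>\<^bsub>M\<^esub> m = lam q 0 1 0 0 0 0 \<odot>\<^bsub>M\<^esub> (lam q a1 0 0 0 0 0 \<odot>\<^bsub>M\<^esub> m)
      \<oplus>\<^bsub>M\<^esub> lam q 0 0 1 0 0 0 \<odot>\<^bsub>M\<^esub> (lam q a2 a4 0 0 0 0 \<odot>\<^bsub>M\<^esub> m)
      \<oplus>\<^bsub>M\<^esub> lam q 0 0 0 1 0 0 \<odot>\<^bsub>M\<^esub> (lam q a3 a5 0 0 0 0 \<odot>\<^bsub>M\<^esub> m)"
    using m by (simp only: M.smult_l_distr M.smult_assoc1 lam_closed Lam.m_closed Lam.a_closed)
  then show ?thesis
    unfolding rad_part_def using m lam_closed M.smult_closed by blast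
qed

lemma smult_combine:
  assumes "left_module (Lam q) M" "m \<in> carrier M"
  shows "lam q a0 a1 a2 a3 a4 a5 \<odot>\<^bsub>M\<^esub> m \<oplus>\<^bsub>M\<^esub> lam q b0 b1 b2 b3 b4 b5 \<odot>\<^bsub>M\<^esub> m =
      lam q (a0 + b0) (a1 + b1) (a2 + b2) (a3 + b3) (a4 + b4) (a5 + b5) \<odot>\<^bsub>M\<^esub> m"
    and "lam q t 0 0 0 0 0 \<odot>\<^bsub>M\<^esub> (lam q b0 b1 b2 b3 b4 b5 \<odot>\<^bsub>M\<^esub> m) =
      lam q (t * b0) (t * b1) (t * b2) (t * b3) (t * b4) (t * b5) \<odot>\<^bsub>M\<^esub> m"
proof -
  interpret M: left_module "Lam q" M by fact
  show "lam q a0 a1 a2 a3 a4 a5 \<odot>\<^bsub>M\<^esub> m \<oplus>\<^bsub>M\<^esub> lam q b0 b1 b2 b3 b4 b5 \<odot>\<^bsub>M\<^esub> m =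
      lam q (a0 + b0) (a1 + b1) (a2 + b2) (a3 + b3) (a4 + b4) (a5 + b5) \<odot>\<^bsub>M\<^esub> m"
    using assms(2) by (simp add: M.smult_l_distr[symmetric] lam_add)
  show "lam q t 0 0 0 0 0 \<odot>\<^bsub>M\<^esub> (lam q b0 b1 b2 b3 b4 b5 \<odot>\<^bsub>M\<^esub> m) =
      lam q (t * b0) (t * b1) (t * b2) (t * b3) (t * b4) (t * b5) \<odot>\<^bsub>M\<^esub> m"
    using assms(2) by (simp add: M.smult_assoc1[symmetric] lam_mult)
qed

lemma not_rad_part_coeff:
  assumes M: "left_module (Lam q) M" and m: "m \<in> carrier M" "m \<notin> rad_part q M"
    and rel: "lam q a0 a1 a2 a3 a4 a5 \<odot>\<^bsub>M\<^esub> m = \<zero>\<^bsub>M\<^esub>"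
  shows "a0 = 0"
proof (rule ccontr)
  interpret M: left_module "Lam q" M by fact
  assume a0: "a0 \<noteq> 0"
  let ?d = "- 1 / a0"
  have "m = \<one>\<^bsub>Lam q\<^esub> \<odot>\<^bsub>M\<^esub> m" using m(1) by simp
  also have "\<dots> = lam q 1 0 0 0 0 0 \<odot>\<^bsub>M\<^esub> m \<oplus>\<^bsub>M\<^esub> lam q ?d 0 0 0 0 0 \<odot>\<^bsub>M\<^esub> (lam q a0 a1 a2 a3 a4 a5 \<odot>\<^bsub>M\<^esub> m)"
    using m(1) rel left_module_smult_zero[OF M lam_closed] by (simp add: lam_one)
  also have "\<dots> = lam q 0 (?d * a1) (?d * a2) (?d * a3) (?d * a4) (?d * a5) \<odot>\<^bsub>M\<^esub> m"
    unfolding smult_combine[OF M m(1)] using a0 by simp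
  finally have "m \<in> rad_part q M" using rad_partI[OF M m(1)] by metis
  with m(2) show False by blast
qed

text \<open>Nakayama's lemma: \<open>M = JM\<close> implies \<open>M = J\<^sup>3M = 0\<close>.\<close>

lemma rad_part_proper:
  assumes M: "left_module (Lam q) M" and "carrier M \<subseteq> rad_part q M"
  shows "carrier M = {\<zero>\<^bsub>M\<^esub>}"
proof -
  interpret M: left_module "Lam q" M by fact
  have expand: "\<exists>x y z. x \<in> carrier M \<and> y \<in> carrier M \<and> z \<in> carrier M \<and>
      n = lam q 0 1 0 0 0 0 \<odot>\<^bsub>M\<^esub> x \<oplus>\<^bsub>M\<^esub> lam q 0 0 1 0 0 0 \<odot>\<^bsub>M\<^esub> y \<oplus>\<^bsub>M\<^esub> lam q 0 0 0 1 0 0 \<odot>\<^bsub>M\<^esub> z"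
    if "n \<in> carrier M" for n
    using subsetD[OF assms(2) that] unfolding rad_part_def by blast
  have act: "lam q 0 a1 a2 a3 a4 a5 \<odot>\<^bsub>M\<^esub> (lam q 0 1 0 0 0 0 \<odot>\<^bsub>M\<^esub> x \<oplus>\<^bsub>M\<^esub> lam q 0 0 1 0 0 0 \<odot>\<^bsub>M\<^esub> y
        \<oplus>\<^bsub>M\<^esub> lam q 0 0 0 1 0 0 \<odot>\<^bsub>M\<^esub> z)
      = lam q 0 0 0 0 a2 a3 \<odot>\<^bsub>M\<^esub> x \<oplus>\<^bsub>M\<^esub> lam q 0 0 0 0 (- (q * a1)) a3 \<odot>\<^bsub>M\<^esub> y \<oplus>\<^bsub>M\<^esub> lam q 0 0 0 0 0 a1 \<odot>\<^bsub>M\<^esub> z"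
    if "x \<in> carrier M" "y \<in> carrier M" "z \<in> carrier M" for a1 a2 a3 a4 a5 x y z
    using that by (simp add: M.smult_r_distr M.smult_assoc1[symmetric] lam_mult)
  have zero: "lam q 0 0 0 0 0 0 \<odot>\<^bsub>M\<^esub> x = \<zero>\<^bsub>M\<^esub>" if "x \<in> carrier M" for x
    using left_module_zero_smult[OF M that] by (simp add: lam_zero)
  have soc: "lam q 0 0 0 0 a4 a5 \<odot>\<^bsub>M\<^esub> n = \<zero>\<^bsub>M\<^esub>" if n: "n \<in> carrier M" for n a4 a5
  proof -
    obtain x y z where "x \<in> carrier M" "y \<in> carrier M" "z \<in> carrier M"
      "n = lam q 0 1 0 0 0 0 \<odot>\<^bsub>M\<^esub> x \<oplus>\<^bsub>M\<^esub> lam q 0 0 1 0 0 0 \<odot>\<^bsub>M\<^esub> y \<oplus>\<^bsub>M\<^esub> lam q 0 0 0 1 0 0 \<odot>\<^bsub>M\<^esub> z"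
      using expand[OF n] by blast
    then show ?thesis by (simp add: act zero)
  qed
  have rad: "lam q 0 a1 a2 a3 0 0 \<odot>\<^bsub>M\<^esub> n = \<zero>\<^bsub>M\<^esub>" if n: "n \<in> carrier M" for n a1 a2 a3
  proof -
    obtain x y z where "x \<in> carrier M" "y \<in> carrier M" "z \<in> carrier M"
      "n = lam q 0 1 0 0 0 0 \<odot>\<^bsub>M\<^esub> x \<oplus>\<^bsub>M\<^esub> lam q 0 0 1 0 0 0 \<odot>\<^bsub>M\<^esub> y \<oplus>\<^bsub>M\<^esub> lam q 0 0 0 1 0 0 \<odot>\<^bsub>M\<^esub> z"
      using expand[OF n] by blast
    then show ?thesis by (simp add: act soc)
  qed
  have "n = \<zero>\<^bsub>M\<^esub>" if n: "n \<in> carrier M" for n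
    using expand[OF n] rad by auto
  then show ?thesis by auto
qed

text \<open>A functional on \<open>M/JM\<close> that does not vanish at \<open>m\<close>; it exists because \<open>JM\<close> is a \<open>k\<close>-subspace.\<close>

lemma rad_functional:
  fixes M :: "((gen list \<Rightarrow> 'k::field) set, 'm) module"
  assumes M: "left_module (Lam q) M" and dim: "k_dim_at_most q M 3"
    and m: "m \<in> carrier M" "m \<notin> rad_part q M"
  obtains \<theta> :: "'m \<Rightarrow> 'k" where "\<theta> m = 1"
    "\<And>x y. x \<in> carrier M \<Longrightarrow> y \<in> carrier M \<Longrightarrow> \<theta> (x \<oplus>\<^bsub>M\<^esub> y) = \<theta> x + \<theta> y"
    "\<And>x a0 a1 a2 a3 a4 a5. x \<in> carrier M \<Longrightarrow> \<theta> (lam q a0 a1 a2 a3 a4 a5 \<odot>\<^bsub>M\<^esub> x) = a0 * \<theta> x"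
proof -
  interpret M: left_module "Lam q" M by fact
  obtain B where B: "k_basis q M B" using dim by (auto simp: k_dim_at_most_def)
  obtain \<kappa> :: "'m \<Rightarrow> 'm \<Rightarrow> 'k" where
    \<kappa>: "\<forall>x\<in>carrier M. \<forall>y\<in>carrier M. \<kappa> (x \<oplus>\<^bsub>M\<^esub> y) = (\<lambda>b. \<kappa> x b + \<kappa> y b)"
      "\<forall>t. \<forall>x\<in>carrier M. \<kappa> (lam q t 0 0 0 0 0 \<odot>\<^bsub>M\<^esub> x) = (\<lambda>b. t * \<kappa> x b)"
    and inj: "inj_on \<kappa> (carrier M)" and \<kappa>0: "\<forall>x b. b \<notin> B \<longrightarrow> \<kappa> x b = 0"
    using k_basis_coordinates[OF M B(1)] by blast
  note \<kappa>_add = \<kappa>(1)[rule_format] and \<kappa>_scale = \<kappa>(2)[rule_format] and \<kappa>0 = \<kappa>0[rule_format]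
  have V: "vector_space (\<lambda>(t::'k) (f :: 'm \<Rightarrow> 'k). \<lambda>b. t * f b)"
    by unfold_locales (auto simp: algebra_simps fun_eq_iff)
  interpret V: vector_space "\<lambda>(t::'k) (f :: 'm \<Rightarrow> 'k). \<lambda>b. t * f b" by (rule V)
  let ?J = "rad_part q M"
  let ?g = "\<lambda>i. if i = (0::nat) then lam q 0 1 0 0 0 0 else if i = 1 then lam q 0 0 1 0 0 0 else lam q 0 0 0 1 0 0"
  have JM: "?J \<subseteq> carrier M" by (auto simp: rad_part_def)
  have J_add: "x \<oplus>\<^bsub>M\<^esub> y \<in> ?J" if "x \<in> ?J" "y \<in> ?J" for x y
  proof -
    obtain x1 x2 x3 y1 y2 y3 where xy: "x1 \<in> carrier M" "x2 \<in> carrier M" "x3 \<in> carrier M"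
        "y1 \<in> carrier M" "y2 \<in> carrier M" "y3 \<in> carrier M"
      "x = ?g 0 \<odot>\<^bsub>M\<^esub> x1 \<oplus>\<^bsub>M\<^esub> ?g 1 \<odot>\<^bsub>M\<^esub> x2 \<oplus>\<^bsub>M\<^esub> ?g 2 \<odot>\<^bsub>M\<^esub> x3"
      "y = ?g 0 \<odot>\<^bsub>M\<^esub> y1 \<oplus>\<^bsub>M\<^esub> ?g 1 \<odot>\<^bsub>M\<^esub> y2 \<oplus>\<^bsub>M\<^esub> ?g 2 \<odot>\<^bsub>M\<^esub> y3"
      using \<open>x \<in> ?J\<close> \<open>y \<in> ?J\<close> by (auto simp: rad_part_def)
    then have "x \<oplus>\<^bsub>M\<^esub> y = ?g 0 \<odot>\<^bsub>M\<^esub> (x1 \<oplus>\<^bsub>M\<^esub> y1) \<oplus>\<^bsub>M\<^esub> ?g 1 \<odot>\<^bsub>M\<^esub> (x2 \<oplus>\<^bsub>M\<^esub> y2) \<oplus>\<^bsub>M\<^esub> ?g 2 \<odot>\<^bsub>M\<^esub> (x3 \<oplus>\<^bsub>M\<^esub> y3)"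
      by (simp add: M.smult_r_distr M.M.a_ac)
    then show ?thesis unfolding rad_part_def using xy
      by (intro CollectI exI[of _ "x1 \<oplus>\<^bsub>M\<^esub> y1", OF exI[of _ "x2 \<oplus>\<^bsub>M\<^esub> y2", OF exI[of _ "x3 \<oplus>\<^bsub>M\<^esub> y3"]]]) simp
  qed
  have J_scale: "lam q t 0 0 0 0 0 \<odot>\<^bsub>M\<^esub> x \<in> ?J" if "x \<in> ?J" for t x
  proof -
    obtain x1 x2 x3 where x: "x1 \<in> carrier M" "x2 \<in> carrier M" "x3 \<in> carrier M"
      "x = ?g 0 \<odot>\<^bsub>M\<^esub> x1 \<oplus>\<^bsub>M\<^esub> ?g 1 \<odot>\<^bsub>M\<^esub> x2 \<oplus>\<^bsub>M\<^esub> ?g 2 \<odot>\<^bsub>M\<^esub> x3"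
      using \<open>x \<in> ?J\<close> by (auto simp: rad_part_def)
    have "lam q t 0 0 0 0 0 \<odot>\<^bsub>M\<^esub> x = lam q 0 t 0 0 0 0 \<odot>\<^bsub>M\<^esub> x1 \<oplus>\<^bsub>M\<^esub> lam q 0 0 t 0 0 0 \<odot>\<^bsub>M\<^esub> x2 \<oplus>\<^bsub>M\<^esub> lam q 0 0 0 t 0 0 \<odot>\<^bsub>M\<^esub> x3"
      using x by (simp add: M.smult_r_distr M.smult_assoc1[symmetric] lam_mult)
    then show ?thesis using x by (auto intro!: J_add rad_partI[OF M])
  qed
  have zJ: "\<zero>\<^bsub>M\<^esub> \<in> ?J"
    using rad_partI[OF M M.M.zero_closed, of 0 0 0 0 0] left_module_smult_zero[OF M lam_closed] by simp
  have \<kappa>z: "\<kappa> \<zero>\<^bsub>M\<^esub> = (\<lambda>b. 0)"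
    using \<kappa>_scale[OF M.M.zero_closed, of 0] left_module_smult_zero[OF M lam_closed] by simp
  have "V.subspace (\<kappa> ` ?J)"
  proof (rule V.subspaceI)
    show "0 \<in> \<kappa> ` ?J" by (rule image_eqI[OF _ zJ]) (simp add: \<kappa>z zero_fun_def)
    show "f + g \<in> \<kappa> ` ?J" if fg: "f \<in> \<kappa> ` ?J" "g \<in> \<kappa> ` ?J" for f g
    proof -
      obtain x y where xy: "x \<in> ?J" "y \<in> ?J" "f = \<kappa> x" "g = \<kappa> y" using fg by blast
      then have "f + g = \<kappa> (x \<oplus>\<^bsub>M\<^esub> y)"
        using \<kappa>_add[OF subsetD[OF JM] subsetD[OF JM], of x y] by (simp add: plus_fun_def)
      then show ?thesis using J_add[OF xy(1,2)] by blast
    qed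
    show "(\<lambda>b. t * f b) \<in> \<kappa> ` ?J" if f: "f \<in> \<kappa> ` ?J" for t f
    proof -
      obtain x where x: "x \<in> ?J" "f = \<kappa> x" using f by blast
      then have "(\<lambda>b. t * f b) = \<kappa> (lam q t 0 0 0 0 0 \<odot>\<^bsub>M\<^esub> x)"
        using \<kappa>_scale[of x t] JM by auto
      then show ?thesis using J_scale[OF x(1)] by blast
    qed
  qed
  moreover have "\<kappa> m \<notin> \<kappa> ` ?J"
  proof
    assume "\<kappa> m \<in> \<kappa> ` ?J"
    then obtain x where "x \<in> ?J" "\<kappa> m = \<kappa> x" by blast
    then show False using inj_onD[OF inj, of m x] m JM by auto
  qed
  ultimately obtain g where g: "Vector_Spaces.linear (\<lambda>(t::'k) (f :: 'm \<Rightarrow> 'k). \<lambda>b. t * f b) (*) g"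
    "\<forall>f\<in>\<kappa> ` ?J. g f = 0" "g (\<kappa> m) = (1::'k)"
    using separating_functional[OF V] by blast
  interpret g: Vector_Spaces.linear "\<lambda>(t::'k) (f :: 'm \<Rightarrow> 'k). \<lambda>b. t * f b" "(*)" g by (rule g(1))
  have add: "g (\<kappa> (x \<oplus>\<^bsub>M\<^esub> y)) = g (\<kappa> x) + g (\<kappa> y)" if "x \<in> carrier M" "y \<in> carrier M" for x y
    using g.add[of "\<kappa> x" "\<kappa> y"] \<kappa>_add[OF that] by (simp add: plus_fun_def)
  show ?thesis
  proof (rule that[of "\<lambda>x. g (\<kappa> x)"])
    show "g (\<kappa> m) = 1" by (rule g(3))
    show "g (\<kappa> (x \<oplus>\<^bsub>M\<^esub> y)) = g (\<kappa> x) + g (\<kappa> y)" if "x \<in> carrier M" "y \<in> carrier M" for x y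
      by (rule add[OF that])
    fix x a0 a1 a2 a3 a4 a5 assume x: "x \<in> carrier M"
    have "lam q a0 a1 a2 a3 a4 a5 \<odot>\<^bsub>M\<^esub> x = lam q a0 0 0 0 0 0 \<odot>\<^bsub>M\<^esub> x \<oplus>\<^bsub>M\<^esub> lam q 0 a1 a2 a3 a4 a5 \<odot>\<^bsub>M\<^esub> x"
      unfolding smult_combine(1)[OF M x] by simp
    moreover have "g (\<kappa> (lam q 0 a1 a2 a3 a4 a5 \<odot>\<^bsub>M\<^esub> x)) = 0" using g(2) rad_partI[OF M x] by blast
    moreover have "g (\<kappa> (lam q a0 0 0 0 0 0 \<odot>\<^bsub>M\<^esub> x)) = a0 * g (\<kappa> x)"
      using g.scale[of a0 "\<kappa> x"] \<kappa>_scale[OF x, of a0] by simp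
    ultimately show "g (\<kappa> (lam q a0 a1 a2 a3 a4 a5 \<odot>\<^bsub>M\<^esub> x)) = a0 * g (\<kappa> x)"
      using add[of "lam q a0 0 0 0 0 0 \<odot>\<^bsub>M\<^esub> x" "lam q 0 a1 a2 a3 a4 a5 \<odot>\<^bsub>M\<^esub> x"] x by simp
  qed
qed

text \<open>The coefficients \<open>h, l\<close> describe a linear map \<open>\<eta>\<close> from the span of \<open>x, y, z\<close> to the socle. As the
  cocycle \<open>(u, n) \<mapsto> \<theta>(n) \<eta>(u)\<close> is a coboundary, there is \<open>s\<close> with \<open>u s + \<eta>(u) = 0\<close> for every
  relation \<open>u m \<in> J\<^sup>2m\<close>. The existence of one nonzero relation \<open>v\<close> forces the constant term of the value at
  \<open>m\<close> to vanish.\<close>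

lemma Ext1_relation:
  fixes M :: "((gen list \<Rightarrow> 'k::field) set, 'm) module"
  assumes M: "left_module (Lam q) M" and dim: "k_dim_at_most q M 3"
    and m: "m \<in> carrier M" "m \<notin> rad_part q M"
    and triv: "trivial_group (Ext (Lam q) 1 M (regular_module (Lam q)))"
    and v: "(v1, v2, v3) \<noteq> (0, 0, 0)" "lam q 0 v1 v2 v3 v4 v5 \<odot>\<^bsub>M\<^esub> m = \<zero>\<^bsub>M\<^esub>"
  obtains s1 s2 s3 where
    "\<And>u1 u2 u3 u4 u5. lam q 0 u1 u2 u3 u4 u5 \<odot>\<^bsub>M\<^esub> m = \<zero>\<^bsub>M\<^esub> \<Longrightarrow>
       u2 * s1 - q * u1 * s2 + (h1 * u1 + h2 * u2 + h3 * u3) = 0 \<and>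
       u3 * s1 + u1 * s3 + u3 * s2 + (l1 * u1 + l2 * u2 + l3 * u3) = 0"
proof -
  interpret M: left_module "Lam q" M by fact
  obtain \<theta> where \<theta>: "\<theta> m = 1"
    "\<And>x y. x \<in> carrier M \<Longrightarrow> y \<in> carrier M \<Longrightarrow> \<theta> (x \<oplus>\<^bsub>M\<^esub> y) = \<theta> x + \<theta> y"
    "\<And>x a0 a1 a2 a3 a4 a5. x \<in> carrier M \<Longrightarrow> \<theta> (lam q a0 a1 a2 a3 a4 a5 \<odot>\<^bsub>M\<^esub> x) = a0 * \<theta> x"
    using rad_functional[OF M dim m] by metis
  define c where "c r x = (case coord q r of (r0, r1, r2, r3, r4, r5) \<Rightarrow>
      lam q 0 0 0 0 (\<theta> x * (h1 * r1 + h2 * r2 + h3 * r3)) (\<theta> x * (l1 * r1 + l2 * r2 + l3 * r3)))" for r x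
  have c_lam: "c (lam q r0 r1 r2 r3 r4 r5) x =
      lam q 0 0 0 0 (\<theta> x * (h1 * r1 + h2 * r2 + h3 * r3)) (\<theta> x * (l1 * r1 + l2 * r2 + l3 * r3))"
    for r0 r1 r2 r3 r4 r5 x by (simp add: c_def)
  obtain s where s_closed: "\<And>x. x \<in> carrier M \<Longrightarrow> s x \<in> carrier (Lam q)"
    and s_smult: "\<And>r x. r \<in> carrier (Lam q) \<Longrightarrow> x \<in> carrier M \<Longrightarrow>
       s (r \<odot>\<^bsub>M\<^esub> x) = r \<otimes>\<^bsub>Lam q\<^esub> s x \<oplus>\<^bsub>Lam q\<^esub> c r x"
  proof (rule Ext1_cocycle[OF triv M, of c])
    fix r x assume r: "r \<in> carrier (Lam q)" and x: "x \<in> carrier M"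
    obtain r0 r1 r2 r3 r4 r5 where rl: "r = lam q r0 r1 r2 r3 r4 r5" using lam_ex[OF r] by blast
    show "c r x \<in> carrier (Lam q)" by (simp add: rl c_lam)
    show "c r (x \<oplus>\<^bsub>M\<^esub> y) = c r x \<oplus>\<^bsub>Lam q\<^esub> c r y" if "y \<in> carrier M" for y
      using x that by (simp add: rl c_lam lam_add lam_inject \<theta>(2) algebra_simps)
    fix r' assume r': "r' \<in> carrier (Lam q)"
    obtain r0' r1' r2' r3' r4' r5' where rl': "r' = lam q r0' r1' r2' r3' r4' r5'" using lam_ex[OF r'] by blast
    show "c (r \<oplus>\<^bsub>Lam q\<^esub> r') x = c r x \<oplus>\<^bsub>Lam q\<^esub> c r' x"
      by (simp add: rl rl' lam_add c_lam lam_inject algebra_simps)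
    show "c (r \<otimes>\<^bsub>Lam q\<^esub> r') x = r \<otimes>\<^bsub>Lam q\<^esub> c r' x \<oplus>\<^bsub>Lam q\<^esub> c r (r' \<odot>\<^bsub>M\<^esub> x)"
      using x by (simp add: rl rl' lam_add lam_mult c_lam lam_inject \<theta>(3) algebra_simps)
  qed blast
  have s0: "s \<zero>\<^bsub>M\<^esub> = lam q 0 0 0 0 0 0"
    using s_smult[OF Lam.zero_closed M.M.zero_closed] s_closed[OF M.M.zero_closed]
    by (simp add: left_module_smult_zero[OF M] lam_zero c_lam) (simp add: lam_zero[symmetric])
  obtain s0 s1 s2 s3 s4 s5 where sm: "s m = lam q s0 s1 s2 s3 s4 s5" using lam_ex[OF s_closed[OF m(1)]] by blast
  have rel: "lam q 0 u1 u2 u3 u4 u5 \<otimes>\<^bsub>Lam q\<^esub> lam q s0 s1 s2 s3 s4 s5 \<oplus>\<^bsub>Lam q\<^esub>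
      lam q 0 0 0 0 (h1 * u1 + h2 * u2 + h3 * u3) (l1 * u1 + l2 * u2 + l3 * u3) = lam q 0 0 0 0 0 0"
    if "lam q 0 u1 u2 u3 u4 u5 \<odot>\<^bsub>M\<^esub> m = \<zero>\<^bsub>M\<^esub>" for u1 u2 u3 u4 u5
    using s_smult[OF lam_closed m(1), of 0 u1 u2 u3 u4 u5] that s0 by (simp add: sm c_lam \<theta>(1))
  have "s0 = 0" using rel[OF v(2)] v(1) by (auto simp: lam_mult lam_add lam_inject)
  show ?thesis
  proof (rule that[of s1 s2 s3])
    fix u1 u2 u3 u4 u5 assume "lam q 0 u1 u2 u3 u4 u5 \<odot>\<^bsub>M\<^esub> m = \<zero>\<^bsub>M\<^esub>"
    from rel[OF this] show "u2 * s1 - q * u1 * s2 + (h1 * u1 + h2 * u2 + h3 * u3) = 0 \<and>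
       u3 * s1 + u1 * s3 + u3 * s2 + (l1 * u1 + l2 * u2 + l3 * u3) = 0"
      by (simp add: lam_mult lam_add lam_inject \<open>s0 = 0\<close> algebra_simps)
  qed
qed

text \<open>For two independent relations the values of \<open>\<eta>\<close> are arbitrary, so the equations of the previous lemma
  would be four inhomogeneous conditions with arbitrary right hand sides on the three coordinates of
  \<open>s\<close>; the vector \<open>L\<close> is a linear dependence between their left hand sides.\<close>

lemma Ext1_relations_proportional:
  fixes M :: "((gen list \<Rightarrow> 'k::field) set, 'm) module"
  assumes M: "left_module (Lam q) M" and dim: "k_dim_at_most q M 3"
    and m: "m \<in> carrier M" "m \<notin> rad_part q M"
    and triv: "trivial_group (Ext (Lam q) 1 M (regular_module (Lam q)))"
    and v: "lam q 0 v1 v2 v3 v4 v5 \<odot>\<^bsub>M\<^esub> m = \<zero>\<^bsub>M\<^esub>"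
    and w: "lam q 0 w1 w2 w3 w4 w5 \<odot>\<^bsub>M\<^esub> m = \<zero>\<^bsub>M\<^esub>"
  shows "v2 * w3 = v3 * w2 \<and> v3 * w1 = v1 * w3 \<and> v1 * w2 = v2 * w1"
proof (cases "(v1, v2, v3) = (0, 0, 0)")
  case False
  define f where "f i b = (if i = (0::nat) then (if b = (0::nat) then v2 else if b = 1 then - q * v1 else 0)
    else if i = 1 then (if b = 0 then v3 else if b = 1 then v3 else v1)
    else if i = 2 then (if b = 0 then w2 else if b = 1 then - q * w1 else 0)
    else (if b = 0 then w3 else if b = 1 then w3 else w1))" for i b
  have four: "{..<4::nat} = {0, 1, 2, 3}" "{..<3::nat} = {0, 1, 2}" by auto
  obtain L where L: "\<exists>i\<in>{..<4}. L i \<noteq> 0" "\<forall>b\<in>{..<3}. (\<Sum>i<4. L i * f i b) = 0"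
    using homogeneous_system[of "{..<3::nat}" "{..<4::nat}" f] by auto
  have L0: "L 0 * v2 + L 1 * v3 + L 2 * w2 + L 3 * w3 = 0"
    and L1: "- q * L 0 * v1 + L 1 * v3 - q * L 2 * w1 + L 3 * w3 = 0"
    and L2: "L 1 * v1 + L 3 * w1 = 0"
    using L(2) by (simp_all add: four f_def algebra_simps)
  have comb: "L 0 * (h1 * v1 + h2 * v2 + h3 * v3) + L 1 * (l1 * v1 + l2 * v2 + l3 * v3)
      + L 2 * (h1 * w1 + h2 * w2 + h3 * w3) + L 3 * (l1 * w1 + l2 * w2 + l3 * w3) = 0" for h1 h2 h3 l1 l2 l3
  proof -
    obtain s1 s2 s3 where s: "\<And>u1 u2 u3 u4 u5. lam q 0 u1 u2 u3 u4 u5 \<odot>\<^bsub>M\<^esub> m = \<zero>\<^bsub>M\<^esub> \<Longrightarrow>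
       u2 * s1 - q * u1 * s2 + (h1 * u1 + h2 * u2 + h3 * u3) = 0 \<and>
       u3 * s1 + u1 * s3 + u3 * s2 + (l1 * u1 + l2 * u2 + l3 * u3) = 0"
      using Ext1_relation[OF M dim m triv False v, of h1 h2 h3 l1 l2 l3] by blast
    define A1 A2 A3 A4 where "A1 = h1 * v1 + h2 * v2 + h3 * v3" and "A2 = l1 * v1 + l2 * v2 + l3 * v3"
      and "A3 = h1 * w1 + h2 * w2 + h3 * w3" and "A4 = l1 * w1 + l2 * w2 + l3 * w3"
    have "v2 * s1 - q * v1 * s2 + A1 = 0" "v3 * s1 + v1 * s3 + v3 * s2 + A2 = 0"
      "w2 * s1 - q * w1 * s2 + A3 = 0" "w3 * s1 + w1 * s3 + w3 * s2 + A4 = 0"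
      using s[OF v] s[OF w] by (simp_all add: A1_def A2_def A3_def A4_def)
    then have "L 0 * (v2 * s1 - q * v1 * s2 + A1) + L 1 * (v3 * s1 + v1 * s3 + v3 * s2 + A2)
        + L 2 * (w2 * s1 - q * w1 * s2 + A3) + L 3 * (w3 * s1 + w1 * s3 + w3 * s2 + A4) = 0" by simp
    moreover have "L 0 * (v2 * s1 - q * v1 * s2 + A1) + L 1 * (v3 * s1 + v1 * s3 + v3 * s2 + A2)
        + L 2 * (w2 * s1 - q * w1 * s2 + A3) + L 3 * (w3 * s1 + w1 * s3 + w3 * s2 + A4)
      = s1 * (L 0 * v2 + L 1 * v3 + L 2 * w2 + L 3 * w3)
        + s2 * (- q * L 0 * v1 + L 1 * v3 - q * L 2 * w1 + L 3 * w3) + s3 * (L 1 * v1 + L 3 * w1)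
        + (L 0 * A1 + L 1 * A2 + L 2 * A3 + L 3 * A4)" by (simp add: algebra_simps)
    ultimately have "L 0 * A1 + L 1 * A2 + L 2 * A3 + L 3 * A4 = 0" by (simp only: L0 L1 L2) simp
    then show ?thesis by (simp only: A1_def A2_def A3_def A4_def)
  qed
  have cross: "d = 0"
    if d: "d = p1 * (v2 * w3 - v3 * w2) + p2 * (v3 * w1 - v1 * w3) + p3 * (v1 * w2 - v2 * w1)" for d p1 p2 p3
  proof (rule ccontr)
    assume "d \<noteq> 0"
    \<comment> \<open>\<open>v \<mapsto> det(p, v, w)\<close> and \<open>w \<mapsto> det(p, v, w)\<close> as linear forms\<close>
    define a1 a2 a3 where "a1 = p3 * w2 - p2 * w3" and "a2 = p1 * w3 - p3 * w1" and "a3 = p2 * w1 - p1 * w2"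
    define b1 b2 b3 where "b1 = p2 * v3 - p3 * v2" and "b2 = p3 * v1 - p1 * v3" and "b3 = p1 * v2 - p2 * v1"
    have "a1 * v1 + a2 * v2 + a3 * v3 = d" "a1 * w1 + a2 * w2 + a3 * w3 = 0"
      "b1 * v1 + b2 * v2 + b3 * v3 = 0" "b1 * w1 + b2 * w2 + b3 * w3 = d"
      unfolding a1_def a2_def a3_def b1_def b2_def b3_def d by (simp_all add: algebra_simps)
    then have "L 0 = 0" "L 1 = 0" "L 2 = 0" "L 3 = 0"
      using comb[of a1 a2 a3 0 0 0] comb[of 0 0 0 a1 a2 a3] comb[of b1 b2 b3 0 0 0] comb[of 0 0 0 b1 b2 b3]
        \<open>d \<noteq> 0\<close> by simp_all
    with L(1) show False by (auto simp: four)
  qed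
  show ?thesis using cross[OF refl, of 1 0 0] cross[OF refl, of 0 1 0] cross[OF refl, of 0 0 1] by simp
qed auto

text \<open>As \<open>m, xm, ym, zm\<close> are dependent, the relations \<open>w\<close> of \<open>m\<close> form exactly a line. For \<open>p, r\<close> completing \<open>w\<close> to a
  basis of the span of \<open>x, y, z\<close>, the elements \<open>m, p m, r m\<close> are then independent modulo \<open>J\<^sup>2m\<close>, so they
  span \<open>M\<close> and \<open>J\<^sup>2m = 0\<close>.\<close>

lemma Ext1_structure:
  fixes M :: "((gen list \<Rightarrow> 'k::field) set, 'm) module"
  assumes q: "q \<noteq> 0" and M: "left_module (Lam q) M" and dim: "k_dim_at_most q M 3"
    and m: "m \<in> carrier M" "m \<notin> rad_part q M"
    and triv: "trivial_group (Ext (Lam q) 1 M (regular_module (Lam q)))"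
  obtains a b c where "cyclic_on (Lam q) M m (Lam_U q a b c)"
proof -
  interpret M: left_module "Lam q" M by fact
  note combine = smult_combine[OF M m(1)]
  let ?m = "\<lambda>a1 a2 a3 a4 a5. lam q 0 a1 a2 a3 a4 a5 \<odot>\<^bsub>M\<^esub> m"
  note cl = M.smult_closed[OF lam_closed m(1)]
  obtain c0 w1 w2 w3 where nz: "(c0, w1, w2, w3) \<noteq> (0, 0, 0, 0)"
    and "lam q c0 0 0 0 0 0 \<odot>\<^bsub>M\<^esub> m \<oplus>\<^bsub>M\<^esub> lam q w1 0 0 0 0 0 \<odot>\<^bsub>M\<^esub> ?m 1 0 0 0 0 \<oplus>\<^bsub>M\<^esub>
      lam q w2 0 0 0 0 0 \<odot>\<^bsub>M\<^esub> ?m 0 1 0 0 0 \<oplus>\<^bsub>M\<^esub> lam q w3 0 0 0 0 0 \<odot>\<^bsub>M\<^esub> ?m 0 0 1 0 0 = \<zero>\<^bsub>M\<^esub>"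
    using four_dependent[OF M dim m(1) cl cl cl] by metis
  then have "lam q c0 w1 w2 w3 0 0 \<odot>\<^bsub>M\<^esub> m = \<zero>\<^bsub>M\<^esub>" by (simp add: combine)
  note w = nz this
  have "c0 = 0" by (rule not_rad_part_coeff[OF M m w(2)])
  with w have w: "(w1, w2, w3) \<noteq> (0, 0, 0)" "lam q 0 w1 w2 w3 0 0 \<odot>\<^bsub>M\<^esub> m = \<zero>\<^bsub>M\<^esub>" by auto
  have rel: "a0 = 0 \<and> (\<exists>t. u1 = t * w1 \<and> u2 = t * w2 \<and> u3 = t * w3)"
    if u: "lam q a0 u1 u2 u3 u4 u5 \<odot>\<^bsub>M\<^esub> m = \<zero>\<^bsub>M\<^esub>" for a0 u1 u2 u3 u4 u5
  proof -
    have a0: "a0 = 0" by (rule not_rad_part_coeff[OF M m u])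
    have cross: "u2 * w3 = u3 * w2 \<and> u3 * w1 = u1 * w3 \<and> u1 * w2 = u2 * w1"
      by (rule Ext1_relations_proportional[OF M dim m triv u[unfolded a0] w(2)])
    consider "w1 \<noteq> 0" | "w2 \<noteq> 0" | "w3 \<noteq> 0" using w(1) by auto
    then have "\<exists>t. u1 = t * w1 \<and> u2 = t * w2 \<and> u3 = t * w3"
    proof cases
      case 1
      have "u1 * w2 = u2 * w1" "u1 * w3 = u3 * w1" using cross by simp_all
      with 1 show ?thesis by (intro exI[of _ "u1 / w1"]) simp
    next
      case 2
      have "u2 * w1 = u1 * w2" "u2 * w3 = u3 * w2" using cross by simp_all
      with 2 show ?thesis by (intro exI[of _ "u2 / w2"]) simp
    next
      case 3
      have "u3 * w1 = u1 * w3" "u3 * w2 = u2 * w3" using cross by simp_all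
      with 3 show ?thesis by (intro exI[of _ "u3 / w3"]) simp
    qed
    with a0 show ?thesis by blast
  qed
  obtain p1 p2 p3 r1 r2 r3 where indep: "\<And>\<beta> \<gamma> t. \<beta> * p1 + \<gamma> * r1 = t * w1 \<Longrightarrow> \<beta> * p2 + \<gamma> * r2 = t * w2 \<Longrightarrow>
      \<beta> * p3 + \<gamma> * r3 = t * w3 \<Longrightarrow> \<beta> = 0 \<and> \<gamma> = 0"
  proof -
    consider "w1 \<noteq> 0" | "w2 \<noteq> 0" | "w3 \<noteq> 0" using w(1) by auto
    then show thesis
    proof cases
      case 1 then show thesis by (intro that[of 0 0 1 0 0 1]) auto
    next
      case 2 then show thesis by (intro that[of 1 0 0 0 0 1]) auto
    next
      case 3 then show thesis by (intro that[of 1 0 0 1 0 0]) auto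
    qed
  qed
  have rel0: "\<alpha> = 0 \<and> \<beta> = 0 \<and> \<gamma> = 0"
    if z: "lam q \<alpha> (\<beta> * p1 + \<gamma> * r1) (\<beta> * p2 + \<gamma> * r2) (\<beta> * p3 + \<gamma> * r3) e f \<odot>\<^bsub>M\<^esub> m = \<zero>\<^bsub>M\<^esub>"
    for \<alpha> \<beta> \<gamma> e f
  proof -
    obtain t where "\<beta> * p1 + \<gamma> * r1 = t * w1" "\<beta> * p2 + \<gamma> * r2 = t * w2" "\<beta> * p3 + \<gamma> * r3 = t * w3"
      using rel[OF z] by blast
    then show ?thesis using indep rel[OF z] by blast
  qed
  have dep: "\<exists>\<alpha> \<beta> \<gamma> \<delta>. (\<alpha>, \<beta>, \<gamma>, \<delta>) \<noteq> (0, 0, 0, 0) \<and>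
      lam q \<alpha> (\<beta> * p1 + \<gamma> * r1) (\<beta> * p2 + \<gamma> * r2) (\<beta> * p3 + \<gamma> * r3) 0 0 \<odot>\<^bsub>M\<^esub> m
        \<oplus>\<^bsub>M\<^esub> lam q \<delta> 0 0 0 0 0 \<odot>\<^bsub>M\<^esub> n = \<zero>\<^bsub>M\<^esub>" if n: "n \<in> carrier M" for n
  proof -
    obtain \<alpha> \<beta> \<gamma> \<delta> where "(\<alpha>, \<beta>, \<gamma>, \<delta>) \<noteq> (0, 0, 0, 0)"
      "lam q \<alpha> 0 0 0 0 0 \<odot>\<^bsub>M\<^esub> m \<oplus>\<^bsub>M\<^esub> lam q \<beta> 0 0 0 0 0 \<odot>\<^bsub>M\<^esub> ?m p1 p2 p3 0 0 \<oplus>\<^bsub>M\<^esub>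
        lam q \<gamma> 0 0 0 0 0 \<odot>\<^bsub>M\<^esub> ?m r1 r2 r3 0 0 \<oplus>\<^bsub>M\<^esub> lam q \<delta> 0 0 0 0 0 \<odot>\<^bsub>M\<^esub> n = \<zero>\<^bsub>M\<^esub>"
      using four_dependent[OF M dim m(1) cl cl n] by metis
    then show ?thesis
      by (intro exI[of _ \<alpha>, OF exI[of _ \<beta>, OF exI[of _ \<gamma>, OF exI[of _ \<delta>]]]]) (simp add: combine)
  qed
  have soc: "?m 0 0 0 e f = \<zero>\<^bsub>M\<^esub>" for e f
  proof -
    obtain \<alpha> \<beta> \<gamma> \<delta> where nz: "(\<alpha>, \<beta>, \<gamma>, \<delta>) \<noteq> (0, 0, 0, 0)"
      and z: "lam q \<alpha> (\<beta> * p1 + \<gamma> * r1) (\<beta> * p2 + \<gamma> * r2) (\<beta> * p3 + \<gamma> * r3) 0 0 \<odot>\<^bsub>M\<^esub> m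
        \<oplus>\<^bsub>M\<^esub> lam q \<delta> 0 0 0 0 0 \<odot>\<^bsub>M\<^esub> ?m 0 0 0 e f = \<zero>\<^bsub>M\<^esub>"
      using dep[of "?m 0 0 0 e f"] m(1) by auto
    have z': "lam q \<alpha> (\<beta> * p1 + \<gamma> * r1) (\<beta> * p2 + \<gamma> * r2) (\<beta> * p3 + \<gamma> * r3) (\<delta> * e) (\<delta> * f) \<odot>\<^bsub>M\<^esub> m = \<zero>\<^bsub>M\<^esub>"
      using z by (simp add: combine)
    from rel0[OF z'] have 0: "\<alpha> = 0" "\<beta> = 0" "\<gamma> = 0" by simp_all
    with nz have "\<delta> \<noteq> 0" by auto
    then have "?m 0 0 0 e f = lam q (1 / \<delta>) 0 0 0 0 0 \<odot>\<^bsub>M\<^esub> ?m 0 0 0 (\<delta> * e) (\<delta> * f)"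
      unfolding combine by simp
    also have "\<dots> = \<zero>\<^bsub>M\<^esub>" using z' left_module_smult_zero[OF M lam_closed] by (simp add: 0)
    finally show ?thesis .
  qed
  have gen: "\<exists>r. n = r \<odot>\<^bsub>M\<^esub> m \<and> r \<in> carrier (Lam q)" if n: "n \<in> carrier M" for n
  proof -
    obtain \<alpha> \<beta> \<gamma> \<delta> where nz: "(\<alpha>, \<beta>, \<gamma>, \<delta>) \<noteq> (0, 0, 0, 0)"
      and z: "lam q \<alpha> (\<beta> * p1 + \<gamma> * r1) (\<beta> * p2 + \<gamma> * r2) (\<beta> * p3 + \<gamma> * r3) 0 0 \<odot>\<^bsub>M\<^esub> m
        \<oplus>\<^bsub>M\<^esub> lam q \<delta> 0 0 0 0 0 \<odot>\<^bsub>M\<^esub> n = \<zero>\<^bsub>M\<^esub>" (is "?r \<odot>\<^bsub>M\<^esub> m \<oplus>\<^bsub>M\<^esub> _ = _")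
      using dep[OF n] by blast
    have \<delta>: "\<delta> \<noteq> 0"
    proof
      assume 0: "\<delta> = 0"
      have "lam q 0 0 0 0 0 0 \<odot>\<^bsub>M\<^esub> n = \<zero>\<^bsub>M\<^esub>" using left_module_zero_smult[OF M n] by (simp add: lam_zero)
      then have "?r \<odot>\<^bsub>M\<^esub> m = \<zero>\<^bsub>M\<^esub>" using z m(1) by (simp add: 0)
      from rel0[OF this] have "\<alpha> = 0" "\<beta> = 0" "\<gamma> = 0" by simp_all
      with nz 0 show False by simp
    qed
    let ?u1 = "(\<beta> * p1 + \<gamma> * r1) / \<delta>" and ?u2 = "(\<beta> * p2 + \<gamma> * r2) / \<delta>" and ?u3 = "(\<beta> * p3 + \<gamma> * r3) / \<delta>"
    have "lam q (1 / \<delta>) 0 0 0 0 0 \<odot>\<^bsub>M\<^esub> (lam q \<delta> 0 0 0 0 0 \<odot>\<^bsub>M\<^esub> n) = n"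
      using n \<delta> by (simp add: M.smult_assoc1[symmetric] lam_mult lam_one[symmetric])
    moreover have "lam q (1 / \<delta>) 0 0 0 0 0 \<odot>\<^bsub>M\<^esub> (?r \<odot>\<^bsub>M\<^esub> m) = lam q (\<alpha> / \<delta>) ?u1 ?u2 ?u3 0 0 \<odot>\<^bsub>M\<^esub> m"
      unfolding combine by simp
    moreover have "lam q (1 / \<delta>) 0 0 0 0 0 \<odot>\<^bsub>M\<^esub> (?r \<odot>\<^bsub>M\<^esub> m) \<oplus>\<^bsub>M\<^esub>
        lam q (1 / \<delta>) 0 0 0 0 0 \<odot>\<^bsub>M\<^esub> (lam q \<delta> 0 0 0 0 0 \<odot>\<^bsub>M\<^esub> n) = \<zero>\<^bsub>M\<^esub>"
      using z left_module_smult_zero[OF M lam_closed, of "1 / \<delta>" 0 0 0 0 0]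
      by (simp only: M.smult_r_distr[symmetric] lam_closed cl n M.smult_closed)
    ultimately have e1: "lam q (\<alpha> / \<delta>) ?u1 ?u2 ?u3 0 0 \<odot>\<^bsub>M\<^esub> m \<oplus>\<^bsub>M\<^esub> n = \<zero>\<^bsub>M\<^esub>" by simp
    have "lam q 0 0 0 0 0 0 \<odot>\<^bsub>M\<^esub> m = \<zero>\<^bsub>M\<^esub>" using left_module_zero_smult[OF M m(1)] by (simp add: lam_zero)
    then have "lam q (- (\<alpha> / \<delta>)) (- ?u1) (- ?u2) (- ?u3) 0 0 \<odot>\<^bsub>M\<^esub> m \<oplus>\<^bsub>M\<^esub>
        lam q (\<alpha> / \<delta>) ?u1 ?u2 ?u3 0 0 \<odot>\<^bsub>M\<^esub> m = \<zero>\<^bsub>M\<^esub>"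
      unfolding combine by simp
    then have "n = lam q (- (\<alpha> / \<delta>)) (- ?u1) (- ?u2) (- ?u3) 0 0 \<odot>\<^bsub>M\<^esub> m \<oplus>\<^bsub>M\<^esub>
        lam q (\<alpha> / \<delta>) ?u1 ?u2 ?u3 0 0 \<odot>\<^bsub>M\<^esub> m \<oplus>\<^bsub>M\<^esub> n"
      using n by simp
    also have "\<dots> = lam q (- (\<alpha> / \<delta>)) (- ?u1) (- ?u2) (- ?u3) 0 0 \<odot>\<^bsub>M\<^esub> m"
      using e1 cl n by (simp only: M.M.a_assoc M.M.r_zero)
    finally have "n = lam q (- (\<alpha> / \<delta>)) (- ?u1) (- ?u2) (- ?u3) 0 0 \<odot>\<^bsub>M\<^esub> m" .
    then show ?thesis
      by (intro exI[of _ "lam q (- (\<alpha> / \<delta>)) (- ?u1) (- ?u2) (- ?u3) 0 0"]) simp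
  qed
  have ann: "r \<odot>\<^bsub>M\<^esub> m = \<zero>\<^bsub>M\<^esub> \<longleftrightarrow> r \<in> Lam_U q w1 w2 w3" if r: "r \<in> carrier (Lam q)" for r
  proof
    assume z: "r \<odot>\<^bsub>M\<^esub> m = \<zero>\<^bsub>M\<^esub>"
    obtain a0 u1 u2 u3 e f where rl: "r = lam q a0 u1 u2 u3 e f" using lam_ex[OF r] by blast
    from rel z obtain t where "a0 = 0" "u1 = t * w1" "u2 = t * w2" "u3 = t * w3" unfolding rl by blast
    then show "r \<in> Lam_U q w1 w2 w3" unfolding Lam_U_eq[OF q] rl by blast
  next
    assume "r \<in> Lam_U q w1 w2 w3"
    then obtain t e f where "r = lam q 0 (t * w1) (t * w2) (t * w3) e f" by (auto simp: Lam_U_eq[OF q])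
    then have "r \<odot>\<^bsub>M\<^esub> m = lam q t 0 0 0 0 0 \<odot>\<^bsub>M\<^esub> ?m w1 w2 w3 0 0 \<oplus>\<^bsub>M\<^esub> ?m 0 0 0 e f"
      by (simp add: combine)
    then show "r \<odot>\<^bsub>M\<^esub> m = \<zero>\<^bsub>M\<^esub>" by (simp add: w(2) soc left_module_smult_zero[OF M lam_closed])
  qed
  have "carrier M = {r \<odot>\<^bsub>M\<^esub> m | r. r \<in> carrier (Lam q)}"
    using gen M.smult_closed[OF _ m(1)] by (intro equalityI subsetI CollectI) auto
  moreover have "{r \<in> carrier (Lam q). r \<odot>\<^bsub>M\<^esub> m = \<zero>\<^bsub>M\<^esub>}
      = {r \<in> carrier (Lam q). r \<in> Lam_U q w1 w2 w3}"
    by (rule Collect_cong) (simp add: ann cong: conj_cong)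
  with Lam_U_closed[OF q, of w1 w2 w3] have "Lam_U q w1 w2 w3 = {r \<in> carrier (Lam q). r \<odot>\<^bsub>M\<^esub> m = \<zero>\<^bsub>M\<^esub>}"
    by blast
  ultimately have "cyclic_on (Lam q) M m (Lam_U q w1 w2 w3)"
    unfolding cyclic_on_def by (intro conjI M m(1))
  then show ?thesis by (rule that)
qed

section \<open>The theorem\<close>

text \<open>Up to scaling \<open>M = M(1,b,c)\<close>; the case \<open>b = -q\<^sup>2\<close> is excluded by \<open>Ext1_dual_exceptional\<close>, and every \<open>b\<close> other
  than \<open>-q\<close> and \<open>-q\<^sup>2\<close> by \<open>reflexive_M\<close>.\<close>

lemma Ext1_vanishing_non_reflexive:
  fixes M :: "((gen list \<Rightarrow> 'k::field) set, 'm) module"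
  assumes q: "q \<noteq> 0" and M: "left_module (Lam q) M" and dim: "k_dim_at_most q M 3"
    and Ext: "trivial_group (Ext (Lam q) 1 M (regular_module (Lam q)))"
    and Ext': "trivial_group (Ext (opp_ring (Lam q)) 1 (dual (Lam q) M) (regular_module (opp_ring (Lam q))))"
    and nr: "\<not> reflexive (Lam q) M"
  shows "\<exists>c m. cyclic_on (Lam q) M m (Lam_U q 1 (- q) c)"
proof -
  obtain m where m: "m \<in> carrier M" "m \<notin> rad_part q M"
    using nr reflexive_zero_module[OF M] rad_part_proper[OF M] by blast
  obtain a b c where cyc: "cyclic_on (Lam q) M m (Lam_U q a b c)"
    using Ext1_structure[OF q M dim m Ext] by blast
  have "a \<noteq> 0 \<and> a + b \<noteq> 0" by (rule Ext1_M_nonzero[OF q Ext1_cyclic[OF Ext cyc]])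
  then have cyc: "cyclic_on (Lam q) M m (Lam_U q 1 (b / a) (c / a))"
    using cyc Lam_U_scale[OF q, of a b c] by simp
  define b' where "b' = b / a"
  have "b' = - q"
  proof (rule ccontr)
    assume ne: "b' \<noteq> - q"
    have b1: "1 + b' / q \<noteq> 0"
    proof
      assume "1 + b' / q = 0"
      then have "b' / q = - 1" by (simp add: add_eq_0_iff)
      then show False using q ne by (simp add: divide_eq_eq)
    qed
    show False
    proof (cases "1 + b' / q / q = 0")
      case True
      then have *: "b' / q / q = - 1" by (simp add: add_eq_0_iff)
      obtain g where "cyclic_on (opp_ring (Lam q)) (dual (Lam q) M) g
          (Lam_U q 1 (b' / q / q) (c / a * (1 + b' / q) * (1 + b' / q / q)))"
        using dual_cyclic_Lam[OF q cyc[folded b'_def]] by blast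
      then show False using Ext1_dual_exceptional[OF q _ Ext'] unfolding * by simp
    next
      case False
      then show False using reflexive_M[OF q cyc[folded b'_def] b1] nr by blast
    qed
  qed
  then show ?thesis using cyc b'_def by metis
qed

theorem mainTheorem5:
  fixes q :: "'k::field"
    and M :: "((gen list \<Rightarrow> 'k) set, 'm) module"
  assumes "q \<noteq> 0" and "\<forall>n::nat. n > 0 \<longrightarrow> q ^ n \<noteq> 1"
    and "left_module (Lam q) M" and "k_dim_at_most q M 3"
  shows "((semi_Gorenstein_projective (Lam q) M \<and>
           semi_Gorenstein_projective (opp_ring (Lam q)) (dual (Lam q) M) \<and>
           \<not> reflexive (Lam q) M)
          \<longleftrightarrow> (\<exists>c. module_iso (Lam q) M (Lam_M q 1 (- q) c)))
       \<and> ((\<exists>c. module_iso (Lam q) M (Lam_M q 1 (- q) c)) \<longrightarrow> \<not> torsionless (Lam q) M)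
       \<and> (\<forall>c c'. module_iso (opp_ring (Lam q))
             (dual (Lam q) (Lam_M q 1 (- q) c)) (dual (Lam q) (Lam_M q 1 (- q) c')))"
proof (intro conjI)
  note q = assms(1) and M = assms(3)
  have iso: "(\<exists>c. module_iso (Lam q) M (Lam_M q 1 (- q) c))
      \<longleftrightarrow> (\<exists>c m. cyclic_on (Lam q) M m (Lam_U q 1 (- q) c))"
    using module_iso_Lam_M_iff[OF q M] by blast
  show "(\<exists>c. module_iso (Lam q) M (Lam_M q 1 (- q) c)) \<longrightarrow> \<not> torsionless (Lam q) M"
    unfolding iso by (intro impI; elim exE) (rule not_torsionless_M[OF q])
  show "(semi_Gorenstein_projective (Lam q) M \<and>
           semi_Gorenstein_projective (opp_ring (Lam q)) (dual (Lam q) M) \<and>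
           \<not> reflexive (Lam q) M)
          \<longleftrightarrow> (\<exists>c. module_iso (Lam q) M (Lam_M q 1 (- q) c))"
    unfolding iso
  proof
    assume "semi_Gorenstein_projective (Lam q) M \<and>
           semi_Gorenstein_projective (opp_ring (Lam q)) (dual (Lam q) M) \<and> \<not> reflexive (Lam q) M"
    then show "\<exists>c m. cyclic_on (Lam q) M m (Lam_U q 1 (- q) c)"
      by (intro Ext1_vanishing_non_reflexive[OF q M assms(4)]) (simp_all add: semi_Gorenstein_projective_def)
  next
    assume "\<exists>c m. cyclic_on (Lam q) M m (Lam_U q 1 (- q) c)"
    then obtain c m where cyc: "cyclic_on (Lam q) M m (Lam_U q 1 (- q) c)" by blast
    obtain g where g: "cyclic_on (opp_ring (Lam q)) (dual (Lam q) M) g (Lam_U q 1 (- 1 / q) 0)"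
      by (rule dual_M[OF q cyc])
    show "semi_Gorenstein_projective (Lam q) M \<and>
           semi_Gorenstein_projective (opp_ring (Lam q)) (dual (Lam q) M) \<and> \<not> reflexive (Lam q) M"
      by (intro conjI semi_Gorenstein_projective_M[OF q assms(2) cyc]
          semi_Gorenstein_projective_dual[OF q assms(2) g]
          not_reflexive_if_not_torsionless not_torsionless_M[OF q cyc])
  qed
  show "\<forall>c c'. module_iso (opp_ring (Lam q))
             (dual (Lam q) (Lam_M q 1 (- q) c)) (dual (Lam q) (Lam_M q 1 (- q) c'))"
  proof (intro allI)
    fix c c'
    obtain m where "cyclic_on (Lam q) (Lam_M q 1 (- q) c) m (Lam_U q 1 (- q) c)"
      using Lam_M_cyclic[OF q] .
    then obtain g where g: "cyclic_on (opp_ring (Lam q)) (dual (Lam q) (Lam_M q 1 (- q) c)) g (Lam_U q 1 (- 1 / q) 0)"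
      by (rule dual_M[OF q])
    obtain m' where "cyclic_on (Lam q) (Lam_M q 1 (- q) c') m' (Lam_U q 1 (- q) c')"
      using Lam_M_cyclic[OF q] .
    then obtain g' where "cyclic_on (opp_ring (Lam q)) (dual (Lam q) (Lam_M q 1 (- q) c')) g' (Lam_U q 1 (- 1 / q) 0)"
      by (rule dual_M[OF q])
    with g show "module_iso (opp_ring (Lam q))
             (dual (Lam q) (Lam_M q 1 (- q) c)) (dual (Lam q) (Lam_M q 1 (- q) c'))"
      by (rule module_iso_cyclic)
  qed
qed

end
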